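(* Let $\Omega\subset\mathbb C$ be a bounded domain and let $r_0>0$ be a given sufficiently small number. For every $\varepsilon>0$ there exists $\gamma>0$ such that $$|K_{\Omega\setminus E}(z,w)-K_\Omega(z,w)|<\varepsilon$$ holds for every closed set $E\subset\mathbb C$ with logarithmic capacity $\mathcal C_l(E)<\gamma$ and all $z,w\in\Omega$ with $\min\{\delta_{\Omega\setminus E}(z),\delta_{\Omega\setminus E}(w)\}\ge r_0$.
   Context: For an open set $D\subset\mathbb C$, $K_D(z,w)$ is the Bergman kernel of $D$, i.e. the reproducing kernel of the Hilbert space $A^2(D)$ of holomorphic functions $f$ on $D$ with $\int_D|f|^2<\infty$; it is holomorphic in $z$ and satisfies $f(z)=\int_D f\,\overline{K_D(\cdot,z)}$. $\delta_D(z)$ denotes the Euclidean distance from $z$ to $\mathbb C\setminus D$. $\mathcal C_l$ denotes the (standard) logarithmic capacity of planar sets. *)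

theory Defs
  imports "HOL-Analysis.Analysis"
begin

definition bergman_space :: "complex set \<Rightarrow> (complex \<Rightarrow> complex) set" where
  "bergman_space D = {f. f holomorphic_on D \<and>
      set_integrable lborel D (\<lambda>\<zeta>. (cmod (f \<zeta>))\<^sup>2)}"

definition bergman_kernel :: "complex set \<Rightarrow> complex \<Rightarrow> complex \<Rightarrow> complex" where
  "bergman_kernel D z w =
     (THE k. k \<in> bergman_space D \<and> (\<forall>\<zeta>. \<zeta> \<notin> D \<longrightarrow> k \<zeta> = 0) \<and>
        (\<forall>f\<in>bergman_space D. f w = (LINT \<zeta>:D|lborel. f \<zeta> * cnj (k \<zeta>)))) z"

definition bdist :: "complex set \<Rightarrow> complex \<Rightarrow> real" where
  "bdist D z = infdist z (UNIV - D)"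

definition cpt_prob_measures :: "complex set \<Rightarrow> complex measure set" where
  "cpt_prob_measures E = {\<mu>. sets \<mu> = sets borel \<and> emeasure \<mu> (space \<mu>) = 1 \<and>
      (\<exists>K. compact K \<and> K \<subseteq> E \<and> emeasure \<mu> (space \<mu> - K) = 0)}"

text \<open>Logarithmic energy I(mu) = double integral of log|z-w|, as an extended real
  (positive part minus negative part; log 0 = -infinity).\<close>
definition log_energy :: "complex measure \<Rightarrow> ereal" where
  "log_energy \<mu> =
     enn2ereal (\<integral>\<^sup>+ p. ennreal (max 0 (ln (cmod (fst p - snd p)))) \<partial>(\<mu> \<Otimes>\<^sub>M \<mu>))
   - enn2ereal (\<integral>\<^sup>+ p. (if fst p = snd p then \<infinity>
                          else ennreal (max 0 (- ln (cmod (fst p - snd p))))) \<partial>(\<mu> \<Otimes>\<^sub>M \<mu>))"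

definition exp_ereal :: "ereal \<Rightarrow> ereal" where
  "exp_ereal x = (if x = -\<infinity> then 0 else if x = \<infinity> then \<infinity> else ereal (exp (real_of_ereal x)))"

text \<open>Logarithmic capacity (Ransford, Def. 5.1.1): sup of exp(I(mu)) over Borel probability
  measures with compact support in E; capacity of the empty set is 0.\<close>
definition log_capacity :: "complex set \<Rightarrow> ereal" where
  "log_capacity E = Sup (insert 0 (exp_ereal ` log_energy ` cpt_prob_measures E))"

end

theory Submission
  imports Defs "HOL-Complex_Analysis.Complex_Analysis"
begin

text \<open>
  Write \<open>D = \<Omega> - E\<close> and \<open>f = K\<^sub>D(-, w)\<close>. Then \<open>f(z) - K\<^sub>\<Omega>(z,w)\<close> is the integral over \<open>D\<close> of \<open>f\<close> against
  \<open>b - cnj K\<^sub>\<Omega>(-, z)\<close>, where \<open>b\<close> is a radial bump at \<open>z\<close>. This function is orthogonal to the Bergman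
  space of \<open>\<Omega>\<close>, hence an \<open>L\<^sup>2\<close> limit of \<open>dbar \<phi>\<close> with \<open>\<phi>\<close> compactly supported in \<open>\<Omega>\<close>. If \<open>\<theta>\<close> is a cutoff
  equal to 1 near \<open>E\<close>, then \<open>f\<close> annihilates \<open>dbar ((1 - \<theta>) \<phi>)\<close>, so only \<open>dbar (\<theta> \<phi>)\<close> contributes, and this
  is controlled by the Sobolev norm of \<open>\<theta>\<close>. Compactness makes the choice of \<open>\<phi>\<close> uniform in \<open>z\<close>.

  A cutoff of small Sobolev norm exists because the logarithmic energy is comparable to the energy of
  a flow on a tree of rectangles: if the conductance of the tree of cells meeting \<open>E\<close> stayed bounded
  below at all depths, the limiting unit current would define a probability measure on \<open>E\<close> of bounded
  energy. At a finite depth where the conductance is small, the current gives the cutoff.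
\<close>

text \<open>Capacity is a supremum over measures, so its smallness says only that every measure on
  \<open>E\<close> has large energy, whereas a cutoff is a dual object. A resistor network converts
  one into the other because a single current plays both roles: its energy is the resistance of the
  tree, and its drop along every path to a live leaf is the same constant. Bumps weighted by the
  current therefore add up to a function that is at least 1 near \<open>E\<close> and whose Sobolev
  norm is controlled by the conductance. The limiting measure is the image of Lebesgue measure on
  \<open>[0,1)\<close> under the map from numbers to branches, which replaces a weak limit of
  measures. On the analytic side \<open>f\<close> is controlled only in \<open>L^2\<close>, with no
  bound near \<open>E\<close>. Test functions \<phi> are bounded together with their derivatives, so
  \<open>dbar (\<theta> \<phi>)\<close> is small in \<open>L^2\<close> as soon as \<theta> and its
  gradient are. The bound for the norm of \<open>f\<close> comes from a disc of fixed radius around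
  \<open>w\<close> inside \<open>D\<close>, hence is the same for all \<open>E\<close>.\<close>

subsection \<open>A self-similar tree of rectangles\<close>

text \<open>A rectangle with sides in ratio \<open>sqrt 2\<close> is the union of two copies of itself, scaled and
  rotated by \<open>tilt\<close>. Iterating gives a binary tree whose cells at each level are congruent; a node is
  addressed by a list of bits, most recent first, and \<open>node_pos v\<close> are the lattice coordinates of the
  centre of its cell, measured in the frame of level \<open>length v\<close>.\<close>

definition tilt :: complex where "tilt = \<i> / of_real (sqrt 2)"

lemma tilt_nz [simp]: "tilt \<noteq> 0"
  by (simp add: tilt_def)

lemma norm_tilt [simp]: "cmod tilt = 1 / sqrt 2"
  by (simp add: tilt_def norm_divide)

fun node_pos :: "bool list \<Rightarrow> int \<times> int" where
  "node_pos [] = (0, 0)"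
| "node_pos (b # v) = (2 * snd (node_pos v), (if b then 1 else -1) - fst (node_pos v))"

definition node_pt :: "bool list \<Rightarrow> complex" where
  "node_pt v = Complex (of_int (fst (node_pos v))) (sqrt 2 * of_int (snd (node_pos v)))"

lemma node_pt_Cons: "tilt * node_pt (b # v) = node_pt v - (if b then 1 else -1)"
  by (simp add: tilt_def node_pt_def complex_eq_iff divide_simps)

text \<open>The recursion exchanges the two coordinates, so congruence modulo 4 of the first and
  modulo 2 of the second must be carried together. Injectivity uses the first: two differing last
  bits would shift the second coordinate by 2, which a multiple of 4 cannot compensate.\<close>

lemma node_pos_level:
  assumes "length u = length v"
  shows "4 dvd fst (node_pos u) - fst (node_pos v)"
proof -
  have "4 dvd fst (node_pos u) - fst (node_pos v) \<and> 2 dvd snd (node_pos u) - snd (node_pos v)"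
    using assms
  proof (induction u v rule: list_induct2)
    case (Cons a u b v)
    obtain x y where "fst (node_pos u) - fst (node_pos v) = 4 * x"
      and "snd (node_pos u) - snd (node_pos v) = 2 * y"
      using Cons.IH unfolding dvd_def by blast
    then have x: "fst (node_pos v) = fst (node_pos u) - 4 * x"
      and y: "snd (node_pos v) = snd (node_pos u) - 2 * y" by auto
    have "fst (node_pos (a # u)) - fst (node_pos (b # v)) = 4 * y"
      by (simp add: y)
    moreover have "snd (node_pos (a # u)) - snd (node_pos (b # v)) =
        2 * ((if a = b then 0 else if a then 1 else -1) - 2 * x)"
      by (simp add: x)
    ultimately show ?case by (metis dvd_triv_left)
  qed auto
  then show ?thesis by blast
qed

lemma node_pos_inj:
  "length u = length v \<Longrightarrow> node_pos u = node_pos v \<Longrightarrow> u = v"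
proof (induction u v rule: list_induct2)
  case (Cons a u b v)
  obtain x where x: "fst (node_pos u) - fst (node_pos v) = 4 * x"
    using node_pos_level[OF Cons.hyps] by (auto elim!: dvdE)
  have "(if a then 1 else -1) - fst (node_pos u) = (if b then 1 else -1) - fst (node_pos v)"
    and s: "snd (node_pos u) = snd (node_pos v)"
    using Cons.prems by simp_all
  then have f: "fst (node_pos u) - fst (node_pos v) = (if a then 1 else -1) - (if b then 1 else -1)"
    by linarith
  then have "(if a then 1 else -1) - (if b then 1 else -1) = 4 * x"
    using x by simp
  then have "a = b"
    by (cases a; cases b; simp; presburger)
  with f have "a = b \<and> fst (node_pos u) = fst (node_pos v)"
    by simp
  with s show ?case
    using Cons.IH by (simp add: prod_eq_iff)
qed simp

section \<open>Sums over one level and over neighbouring cells\<close>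

abbreviation level :: "nat \<Rightarrow> bool list set" where
  "level n \<equiv> {v. length v = n}"

lemma finite_level [simp]: "finite (level n)"
  using finite_lists_length_eq[of "UNIV :: bool set" n] by simp

lemma sum_level_0 [simp]: "sum g (level 0) = g []"
proof -
  have "level 0 = {[]}" by auto
  then show ?thesis by simp
qed

lemma sum_level_Suc:
  "sum g (level (Suc n)) = (\<Sum>v\<in>level n. g (False # v) + g (True # v))"
proof -
  have eq: "level (Suc n) = (#) False ` level n \<union> (#) True ` level n"
    by (auto simp: length_Suc_conv image_iff)
  have "sum g (level (Suc n)) = sum g ((#) False ` level n) + sum g ((#) True ` level n)"
    unfolding eq by (rule sum.union_disjoint) auto
  also have "\<dots> = (\<Sum>v\<in>level n. g (False # v)) + (\<Sum>v\<in>level n. g (True # v))"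
    by (simp add: sum.reindex inj_on_def)
  finally show ?thesis by (simp add: sum.distrib)
qed

text \<open>Distance is measured in the frame of the level, where the centres lie on a lattice. The
  radius 15 leaves room for a cell radius 5/2 and two disc radii 6, as
  \<open>majorant_le_near\<close> requires.\<close>

definition near :: "bool list \<Rightarrow> bool list \<Rightarrow> bool" where
  "near u v \<longleftrightarrow> length u = length v \<and> cmod (node_pt u - node_pt v) \<le> 15"

lemma near_sym: "near u v \<longleftrightarrow> near v u"
  by (auto simp: near_def norm_minus_commute)

lemma card_near: "card {v. near u v} \<le> 961"
proof -
  \<comment> \<open>The centres lie in Z x sqrt 2 Z, so each integer coordinate takes at most 31
    values, and 31^2 = 961.\<close>
  let ?B = "{fst (node_pos u) - 15..fst (node_pos u) + 15} \<times>
            {snd (node_pos u) - 15..snd (node_pos u) + 15}"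
  have "node_pos ` {v. near u v} \<subseteq> ?B"
  proof (rule image_subsetI)
    fix v assume "v \<in> {v. near u v}"
    then have n: "cmod (node_pt u - node_pt v) \<le> 15"
      by (simp add: near_def)
    have "\<bar>real_of_int (fst (node_pos u) - fst (node_pos v))\<bar> \<le> 15"
      using order_trans[OF abs_Re_le_cmod n] by (simp add: node_pt_def)
    moreover have "\<bar>real_of_int (snd (node_pos u) - snd (node_pos v))\<bar> \<le> 15"
    proof -
      have "sqrt 2 * \<bar>real_of_int (snd (node_pos u) - snd (node_pos v))\<bar> \<le> 15"
        using order_trans[OF abs_Im_le_cmod n]
        by (simp add: node_pt_def flip: right_diff_distrib abs_mult_pos')
      moreover have "1 * \<bar>real_of_int (snd (node_pos u) - snd (node_pos v))\<bar> \<le>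
          sqrt 2 * \<bar>real_of_int (snd (node_pos u) - snd (node_pos v))\<bar>"
        by (intro mult_right_mono) auto
      ultimately show ?thesis
        by (metis mult_1 order_trans)
    qed
    ultimately show "node_pos v \<in> ?B"
      by (auto simp: mem_Times_iff abs_le_iff)
  qed
  moreover have "inj_on node_pos {v. near u v}"
    by (rule inj_onI) (auto simp: near_def intro: node_pos_inj)
  ultimately have "card {v. near u v} \<le> card ?B"
    by (intro card_inj_on_le) auto
  then show ?thesis by simp
qed

lemma finite_near [simp]: "finite {v. near u v}"
  by (rule finite_subset[of _ "level (length u)"]) (auto simp: near_def)

text \<open>Schur's test for a symmetric relation of degree at most 961: bound each product by half
  the sum of the squares and swap the two summations.\<close>

lemma sum_near_le:
  fixes f :: "bool list \<Rightarrow> real"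
  shows "(\<Sum>u\<in>level n. f u * (\<Sum>v | near u v. f v)) \<le> 961 * (\<Sum>u\<in>level n. (f u)\<^sup>2)"
proof -
  have sq: "(\<Sum>u\<in>level n. \<Sum>v | near u v. (f u)\<^sup>2) \<le> 961 * (\<Sum>u\<in>level n. (f u)\<^sup>2)"
    unfolding sum_distrib_left
  proof (intro sum_mono)
    fix u
    have "real (card {v. near u v}) \<le> 961"
      using card_near[of u] by linarith
    then show "(\<Sum>v | near u v. (f u)\<^sup>2) \<le> 961 * (f u)\<^sup>2"
      by (simp add: mult_right_mono)
  qed
  have ext: "(\<Sum>v | near u v. h v) = (\<Sum>v\<in>level n. if near u v then h v else 0)"
    if "u \<in> level n" for u and h :: "bool list \<Rightarrow> real"
    using that by (subst sum.If_cases) (auto intro!: sum.cong simp: near_def)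
  have swap: "(\<Sum>u\<in>level n. \<Sum>v | near u v. (f v)\<^sup>2) = (\<Sum>u\<in>level n. \<Sum>v | near u v. (f u)\<^sup>2)"
  proof -
    have "(\<Sum>u\<in>level n. \<Sum>v | near u v. (f v)\<^sup>2) =
          (\<Sum>u\<in>level n. \<Sum>v\<in>level n. if near u v then (f v)\<^sup>2 else 0)"
      by (intro sum.cong refl ext)
    also have "\<dots> = (\<Sum>v\<in>level n. \<Sum>u\<in>level n. if near u v then (f v)\<^sup>2 else 0)"
      by (rule sum.swap)
    also have "\<dots> = (\<Sum>v\<in>level n. \<Sum>u\<in>level n. if near v u then (f v)\<^sup>2 else 0)"
      by (simp only: near_sym)
    also have "\<dots> = (\<Sum>u\<in>level n. \<Sum>v | near u v. (f u)\<^sup>2)"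
      by (intro sum.cong refl ext[symmetric])
    finally show ?thesis .
  qed
  have "(\<Sum>u\<in>level n. f u * (\<Sum>v | near u v. f v)) =
        (\<Sum>u\<in>level n. \<Sum>v | near u v. f u * f v)"
    by (simp add: sum_distrib_left)
  also have "\<dots> \<le> (\<Sum>u\<in>level n. \<Sum>v | near u v. ((f u)\<^sup>2 + (f v)\<^sup>2) / 2)"
  proof (intro sum_mono)
    fix u v
    have "0 \<le> (f u - f v)\<^sup>2" by simp
    then show "f u * f v \<le> ((f u)\<^sup>2 + (f v)\<^sup>2) / 2"
      by (simp add: power2_diff)
  qed
  also have "\<dots> = ((\<Sum>u\<in>level n. \<Sum>v | near u v. (f u)\<^sup>2) +
                  (\<Sum>u\<in>level n. \<Sum>v | near u v. (f v)\<^sup>2)) / 2"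
    by (simp only: sum.distrib flip: sum_divide_distrib)
  also have "\<dots> \<le> 961 * (\<Sum>u\<in>level n. (f u)\<^sup>2)"
    using sq swap by simp
  finally show ?thesis .
qed

subsection \<open>Flows on the binary tree\<close>

text \<open>Give every node unit resistance. Then \<open>e v\<close> is the conductance from \<open>v\<close> to the bottom of the
  tree, \<open>branch\<close> is the series-parallel law, and \<open>flow e\<close> is the unit current leaving the root.\<close>

fun flow :: "(bool list \<Rightarrow> real) \<Rightarrow> bool list \<Rightarrow> real" where
  "flow e [] = 1"
| "flow e (b # v) = flow e v * e (b # v) / (e (False # v) + e (True # v))"

definition branch :: "(bool list \<Rightarrow> real) \<Rightarrow> nat \<Rightarrow> bool" where
  "branch e k \<longleftrightarrow> (\<forall>v. 0 \<le> e v) \<and> 0 < e [] \<and>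
     (\<forall>v. length v < k \<longrightarrow>
        e v = (e (False # v) + e (True # v)) / (1 + (e (False # v) + e (True # v))))"

lemma branch_nonneg: "branch e k \<Longrightarrow> 0 \<le> e v"
  by (simp add: branch_def)

lemma branch_eq:
  "branch e k \<Longrightarrow> length v < k \<Longrightarrow>
     e v = (e (False # v) + e (True # v)) / (1 + (e (False # v) + e (True # v)))"
  by (simp add: branch_def)

lemma flow_nonneg: "branch e k \<Longrightarrow> 0 \<le> flow e v"
  by (induction v) (auto simp: branch_nonneg)

lemma flow_pos_imp: "branch e k \<Longrightarrow> flow e v \<noteq> 0 \<Longrightarrow> 0 < e v"
proof (induction v)
  case Nil then show ?case by (simp add: branch_def)
next
  case (Cons b v)
  then have "e (b # v) \<noteq> 0" by auto
  then show ?case using branch_nonneg[OF Cons.prems(1), of "b # v"] by simp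
qed

lemma branch_sum_pos:
  assumes "branch e k" "length v < k" "0 < e v"
  shows "0 < e (False # v) + e (True # v)"
proof -
  have "0 \<le> e (False # v) + e (True # v)"
    using branch_nonneg[OF assms(1)] by simp
  moreover have "e (False # v) + e (True # v) \<noteq> 0"
    using branch_eq[OF assms(1,2)] assms(3) by auto
  ultimately show ?thesis by simp
qed

lemma flow_split:
  assumes "branch e k" "length v < k"
  shows "flow e (False # v) + flow e (True # v) = flow e v"
proof (cases "flow e v = 0")
  case False
  have "0 < e (False # v) + e (True # v)"
    using branch_sum_pos[OF assms flow_pos_imp[OF assms(1) False]] .
  then show ?thesis
    by (simp add: add_divide_distrib[symmetric] distrib_left[symmetric])
qed simp

text \<open>The energy of the unit current equals the resistance \<open>1 / e []\<close>. At every
  node the energy \<open>(flow e v)^2 / e v\<close> of the whole subtree splits into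
  \<open>(flow e v)^2\<close> in the node's own resistor and the energies of the two child subtrees;
  the induction expands one level at a time. Dead nodes contribute \<open>0 / 0 = 0\<close>.\<close>

lemma flow_energy:
  assumes "branch e k" "n \<le> k"
  shows "(\<Sum>j<n. \<Sum>v\<in>level j. (flow e v)\<^sup>2) + (\<Sum>v\<in>level n. (flow e v)\<^sup>2 / e v) = 1 / e []"
  using assms(2)
proof (induction n)
  case (Suc n)
  have "(flow e (False # v))\<^sup>2 / e (False # v) + (flow e (True # v))\<^sup>2 / e (True # v) + (flow e v)\<^sup>2
        = (flow e v)\<^sup>2 / e v" if v: "v \<in> level n" for v
  proof (cases "flow e v = 0")
    case False
    let ?s = "e (False # v) + e (True # v)"
    have len: "length v < k" using v Suc.prems by simp
    have s: "0 < ?s"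
      using branch_sum_pos[OF assms(1) len flow_pos_imp[OF assms(1) False]] .
    have *: "(flow e (b # v))\<^sup>2 / e (b # v) = (flow e v)\<^sup>2 / ?s\<^sup>2 * e (b # v)" for b
      by (cases "e (b # v) = 0") (auto simp: power2_eq_square)
    have "(flow e (False # v))\<^sup>2 / e (False # v) + (flow e (True # v))\<^sup>2 / e (True # v)
          = (flow e v)\<^sup>2 / ?s\<^sup>2 * ?s"
      by (simp only: * distrib_left)
    also have "\<dots> = (flow e v)\<^sup>2 / ?s"
      using s by (simp add: power2_eq_square)
    finally have "(flow e (False # v))\<^sup>2 / e (False # v) + (flow e (True # v))\<^sup>2 / e (True # v)
        + (flow e v)\<^sup>2 = (flow e v)\<^sup>2 / ?s + (flow e v)\<^sup>2"
      by simp
    also have "\<dots> = (flow e v)\<^sup>2 / e v"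
      by (subst branch_eq[OF assms(1) len]) (use s in \<open>simp add: field_simps\<close>)
    finally show ?thesis .
  qed simp
  then have "(\<Sum>v\<in>level (Suc n). (flow e v)\<^sup>2 / e v) + (\<Sum>v\<in>level n. (flow e v)\<^sup>2)
      = (\<Sum>v\<in>level n. (flow e v)\<^sup>2 / e v)"
    unfolding sum_level_Suc sum.distrib[symmetric] by (intro sum.cong) auto
  then show ?case using Suc by simp
qed simp

text \<open>Ohm's law along a branch: \<open>flow e v / e v\<close> is the voltage still present at
  \<open>v\<close>, and stepping to a child uses up the flow of the parent. Positivity along the
  branch matters, since at a dead node the quotient \<open>0 / 0\<close> would drop the remaining
  voltage.\<close>

lemma flow_path:
  assumes "branch e k" "length v \<le> k" "\<And>j. j \<le> length v \<Longrightarrow> 0 < e (drop j v)"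
  shows "(\<Sum>j=1..length v. flow e (drop j v)) + flow e v / e v = 1 / e []"
  using assms(2,3)
proof (induction v)
  case (Cons b v)
  have ev: "0 < e (b # v)" "0 < e v"
    using Cons.prems(2)[of 0] Cons.prems(2)[of 1] by auto
  have len: "length v < k" using Cons.prems by simp
  let ?s = "e (False # v) + e (True # v)"
  have s: "0 < ?s"
    using branch_sum_pos[OF assms(1) len ev(2)] .
  have "flow e (b # v) / e (b # v) = flow e v / ?s"
    using ev by simp
  moreover have "flow e v / ?s + flow e v = flow e v / e v"
    by (subst branch_eq[OF assms(1) len]) (use s in \<open>simp add: field_simps\<close>)
  moreover have "(\<Sum>j=1..length (b # v). flow e (drop j (b # v))) =
      flow e v + (\<Sum>j=1..length v. flow e (drop j v))"
    by (simp only: list.size sum.shift_bounds_cl_Suc_ivl add_0_right add_Suc_right One_nat_def)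
       (simp add: sum.atLeast_Suc_atMost)
  moreover have "(\<Sum>j=1..length v. flow e (drop j v)) + flow e v / e v = 1 / e []"
  proof (rule Cons.IH)
    show "length v \<le> k" using len by simp
    show "0 < e (drop j v)" if "j \<le> length v" for j
      using Cons.prems(2)[of "Suc j"] that by simp
  qed
  ultimately show ?case by simp
qed simp

lemma flow_descendants:
  assumes "branch e k" "n + j \<le> k" "length u = n"
  shows "(\<Sum>v\<in>{v\<in>level (n + j). drop j v = u}. flow e v) = flow e u"
  using assms(2)
proof (induction j)
  case 0
  have "{v\<in>level (n + 0). drop 0 v = u} = {u}" using assms(3) by auto
  then show ?case by simp
next
  case (Suc j)
  have "(\<Sum>v\<in>{v\<in>level (n + Suc j). drop (Suc j) v = u}. flow e v) =
        (\<Sum>v\<in>level (Suc (n + j)). if drop (Suc j) v = u then flow e v else 0)"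
    by (subst sum.inter_filter) auto
  also have "\<dots> = (\<Sum>v\<in>level (n + j). if drop j v = u then flow e v else 0)"
    unfolding sum_level_Suc
    by (intro sum.cong) (use Suc.prems in \<open>auto simp: flow_split[OF assms(1)] simp del: flow.simps\<close>)
  also have "\<dots> = (\<Sum>v\<in>{v\<in>level (n + j). drop j v = u}. flow e v)"
    by (subst sum.inter_filter) auto
  finally show ?case using Suc by simp
qed

subsection \<open>Rectangles and conductances\<close>

text \<open>The bound \<open>1 \<le> S\<close> allows \<open>(1 / sqrt 2)^n\<close> to be compared
  with the cell size \<open>rad n\<close>. The root cell has half-sides \<open>2 * S\<close> and
  \<open>sqrt 2 * S\<close>, so it contains the disc of radius \<open>S\<close>.\<close>

locale cell_tree =
  fixes S :: real and E :: "complex set"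
  assumes S_ge: "1 \<le> S" and compact_E: "compact E" and E_subset: "E \<subseteq> cball 0 S"
begin

definition cen :: "bool list \<Rightarrow> complex" where
  "cen v = of_real S * tilt ^ length v * node_pt v"

definition cell :: "bool list \<Rightarrow> complex set" where
  "cell v = {z. \<bar>Re (z / (of_real S * tilt ^ length v) - node_pt v)\<bar> \<le> 2 \<and>
               \<bar>Im (z / (of_real S * tilt ^ length v) - node_pt v)\<bar> \<le> sqrt 2}"

abbreviation rad :: "nat \<Rightarrow> real" where
  "rad n \<equiv> S * (1 / sqrt 2) ^ n"

lemma S_pos: "0 < S" using S_ge by simp

lemma rad_pos: "0 < rad n" using S_pos by simp

lemma cen_in_cell: "cen v \<in> cell v"
  using S_pos by (simp add: cen_def cell_def)

lemma dist_cell_cen: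
  assumes "z \<in> cell v"
  shows "cmod (z - cen v) \<le> 5 / 2 * rad (length v)"
proof -
  define d where "d = z / (of_real S * tilt ^ length v) - node_pt v"
  have "(Re d)\<^sup>2 \<le> 2\<^sup>2" "(Im d)\<^sup>2 \<le> (sqrt 2)\<^sup>2"
    using assms unfolding cell_def mem_Collect_eq d_def[symmetric]
    by (auto simp only: abs_le_square_iff[symmetric] abs_numeral real_sqrt_abs2 abs_of_nonneg[OF real_sqrt_ge_zero] zero_le_numeral)
  \<comment> \<open>The half-diagonal is \<open>sqrt (4 + 2)\<close>, which is below 5/2.\<close>
  then have "(cmod d)\<^sup>2 \<le> (5 / 2)\<^sup>2"
    by (simp add: cmod_power2 power_divide)
  then have "cmod d \<le> 5 / 2"
    by (rule power2_le_imp_le) simp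
  moreover have "z - cen v = of_real S * tilt ^ length v * d"
    using S_pos by (simp add: d_def cen_def algebra_simps)
  ultimately show ?thesis
    using S_pos by (simp add: norm_mult norm_power mult_left_mono algebra_simps)
qed

text \<open>The long side is halved. Division by \<open>tilt\<close> makes a quarter turn and
  stretches by \<open>sqrt 2\<close>, so the short side of the parent becomes the long side of the
  child.\<close>

lemma cell_Cons_iff:
  "z \<in> cell (b # v) \<longleftrightarrow>
     \<bar>Im (z / (of_real S * tilt ^ length v) - node_pt v)\<bar> \<le> sqrt 2 \<and>
     \<bar>Re (z / (of_real S * tilt ^ length v) - node_pt v) + (if b then 1 else -1)\<bar> \<le> 1"
proof -
  define d where "d = z / (of_real S * tilt ^ length v) - node_pt v"
  have e: "z / (of_real S * tilt ^ length (b # v)) - node_pt (b # v)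
      = (d + (if b then 1 else -1)) / tilt"
  proof -
    have "z / (of_real S * tilt ^ length (b # v)) = z / (of_real S * tilt ^ length v) / tilt"
      by (simp add: mult.commute mult.left_commute)
    moreover have "x / tilt - y = (x - tilt * y) / tilt" for x y
      by (simp add: diff_divide_distrib)
    ultimately show ?thesis
      by (simp only: node_pt_Cons d_def) simp
  qed
  have "Re (x / tilt) = sqrt 2 * Im x" "Im (x / tilt) = - sqrt 2 * Re x" for x
    by (simp_all add: tilt_def)
  then have "z \<in> cell (b # v) \<longleftrightarrow>
     \<bar>sqrt 2 * Im d\<bar> \<le> 2 \<and> \<bar>sqrt 2 * (Re d + (if b then 1 else -1))\<bar> \<le> sqrt 2"
    unfolding cell_def mem_Collect_eq e by (simp only:) simp
  moreover have "\<bar>sqrt 2 * Im d\<bar> \<le> 2 \<longleftrightarrow> \<bar>Im d\<bar> \<le> sqrt 2"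
  proof -
    have "sqrt 2 * \<bar>Im d\<bar> \<le> sqrt 2 * sqrt 2 \<longleftrightarrow> \<bar>Im d\<bar> \<le> sqrt 2"
      by (rule mult_le_cancel_left_pos) simp
    then show ?thesis by (simp add: abs_mult)
  qed
  moreover have "\<bar>sqrt 2 * y\<bar> \<le> sqrt 2 \<longleftrightarrow> \<bar>y\<bar> \<le> 1" for y
    by (simp add: abs_mult)
  ultimately show ?thesis unfolding d_def by simp
qed

lemma cell_ConsD: "z \<in> cell (b # v) \<Longrightarrow> z \<in> cell v"
  unfolding cell_Cons_iff by (auto simp: cell_def split: if_splits)

lemma cell_split: "z \<in> cell v \<Longrightarrow> z \<in> cell (False # v) \<or> z \<in> cell (True # v)"
  unfolding cell_Cons_iff by (auto simp: cell_def abs_if split: if_splits)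

lemma cell_drop: "z \<in> cell v \<Longrightarrow> z \<in> cell (drop j v)"
proof (induction j arbitrary: v)
  case (Suc j)
  then show ?case by (cases v) (auto dest: cell_ConsD)
qed simp

lemma E_in_root: "x \<in> E \<Longrightarrow> x \<in> cell []"
proof -
  assume "x \<in> E"
  then have "cmod (x / of_real S) \<le> 1"
    using E_subset S_pos by (auto simp: norm_divide)
  then have "\<bar>Re (x / of_real S)\<bar> \<le> 1" "\<bar>Im (x / of_real S)\<bar> \<le> 1"
    using abs_Re_le_cmod abs_Im_le_cmod order_trans by blast+
  moreover have "1 \<le> sqrt (2::real)" by simp
  ultimately show "x \<in> cell []"
    unfolding cell_def by (auto simp: node_pt_def complex_eq_iff simp del: real_sqrt_ge_1_iff)
qed

lemma E_in_level:
  assumes "x \<in> E"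
  shows "\<exists>v. length v = n \<and> x \<in> cell v"
proof (induction n)
  case 0 then show ?case using E_in_root[OF assms] by auto
next
  case (Suc n)
  then show ?case using cell_split by (metis length_Cons)
qed

lemma near_if_dist:
  assumes "length u = length v" "cmod (cen u - cen v) \<le> 15 * rad (length v)"
  shows "near u v"
proof -
  have "cen u - cen v = of_real S * tilt ^ length v * (node_pt u - node_pt v)"
    using assms(1) by (simp add: cen_def algebra_simps)
  then have "cmod (cen u - cen v) = rad (length v) * cmod (node_pt u - node_pt v)"
    using S_pos by (simp add: norm_mult norm_power)
  then have "rad (length v) * cmod (node_pt u - node_pt v) \<le> rad (length v) * 15"
    using assms(2) by (simp only: mult.commute)
  then have "cmod (node_pt u - node_pt v) \<le> 15"
    using rad_pos mult_le_cancel_left_pos by blast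
  then show ?thesis using assms(1) by (simp add: near_def)
qed

section \<open>Conductance of the tree of cells that meet \<open>E\<close>\<close>

definition alive :: "bool list \<Rightarrow> bool" where
  "alive v \<longleftrightarrow> cell v \<inter> E \<noteq> {}"

text \<open>The tree is cut \<open>k\<close> levels below \<open>v\<close> and its live leaves are
  grounded there; a live leaf still counts its own unit resistor, a dead one conducts
  nothing.\<close>

primrec conduct :: "nat \<Rightarrow> bool list \<Rightarrow> real" where
  "conduct 0 v = (if alive v then 1 else 0)"
| "conduct (Suc k) v = (conduct k (False # v) + conduct k (True # v)) /
     (1 + (conduct k (False # v) + conduct k (True # v)))"

lemma conduct_nonneg: "0 \<le> conduct k v"
  by (induction k arbitrary: v) auto

lemma frac_mono:
  fixes s t :: real
  assumes "0 \<le> s" "s \<le> t"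
  shows "s / (1 + s) \<le> t / (1 + t)"
  using assms by (simp add: field_simps)

lemma conduct_dead: "\<not> alive v \<Longrightarrow> conduct k v = 0"
proof (induction k arbitrary: v)
  case (Suc k)
  then have "\<not> alive (b # v)" for b
    unfolding alive_def using cell_ConsD by blast
  then show ?case using Suc.IH by simp
qed simp

lemma conduct_alive: "alive v \<Longrightarrow> 0 < conduct k v"
proof (induction k arbitrary: v)
  case (Suc k)
  then have "alive (False # v) \<or> alive (True # v)"
    using cell_split unfolding alive_def by blast
  then have "0 < conduct k (False # v) + conduct k (True # v)"
    using Suc.IH conduct_nonneg by (metis add_nonneg_pos add_pos_nonneg)
  then show ?case by simp
qed simp

text \<open>Lengthening the tree adds resistance: a leaf of conductance 1 becomes a node of
  conductance \<open>s / (1 + s) \<le> 1\<close>, and the series-parallel law is monotone.\<close>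

lemma conduct_Suc_le: "conduct (Suc k) v \<le> conduct k v"
proof (induction k arbitrary: v)
  case 0
  show ?case
  proof (cases "alive v")
    case True
    have "0 \<le> conduct 0 (False # v) + conduct 0 (True # v)"
      using conduct_nonneg by (simp del: conduct.simps)
    then show ?thesis using True by (simp add: field_simps del: conduct.simps(1)) simp
  next
    case False
    then show ?thesis using conduct_dead by (metis order_refl)
  qed
next
  case (Suc k)
  show ?case
    by (subst (1 2) conduct.simps(2))
       (intro frac_mono add_mono add_nonneg_nonneg conduct_nonneg Suc.IH)
qed

lemma conduct_antimono: "decseq (\<lambda>k. conduct k v)"
  using conduct_Suc_le by (rule decseq_SucI)

definition conduct_lim :: "bool list \<Rightarrow> real" where
  "conduct_lim v = lim (\<lambda>k. conduct k v)"

lemma conduct_tendsto: "(\<lambda>k. conduct k v) \<longlonglongrightarrow> conduct_lim v"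
  using decseq_convergent[OF conduct_antimono, of 0 v] conduct_nonneg
  by (metis conduct_lim_def limI)

lemma conduct_lim_nonneg: "0 \<le> conduct_lim v"
  by (rule LIMSEQ_le_const[OF conduct_tendsto]) (auto simp: conduct_nonneg)

lemma conduct_lim_eq:
  "conduct_lim v = (conduct_lim (False # v) + conduct_lim (True # v)) /
     (1 + (conduct_lim (False # v) + conduct_lim (True # v)))"
proof (rule LIMSEQ_unique)
  show "(\<lambda>k. conduct (Suc k) v) \<longlonglongrightarrow> conduct_lim v"
    using conduct_tendsto by (rule LIMSEQ_Suc)
  have "1 + (conduct_lim (False # v) + conduct_lim (True # v)) \<noteq> 0"
    using conduct_lim_nonneg[of "False # v"] conduct_lim_nonneg[of "True # v"] by linarith
  then show "(\<lambda>k. conduct (Suc k) v) \<longlonglongrightarrow> (conduct_lim (False # v) + conduct_lim (True # v)) /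
     (1 + (conduct_lim (False # v) + conduct_lim (True # v)))"
    unfolding conduct.simps by (intro tendsto_intros conduct_tendsto)
qed

lemma branch_conduct_lim: "0 < conduct_lim [] \<Longrightarrow> branch conduct_lim k"
  unfolding branch_def using conduct_lim_nonneg conduct_lim_eq by blast

text \<open>Below a node \<open>v\<close> there remain \<open>k - length v\<close> levels. With this
  indexing the finite trees satisfy the same law as the limiting one, so the lemmas on flows serve
  both the measure and the cutoff.\<close>

lemma branch_conduct:
  assumes "alive []"
  shows "branch (\<lambda>v. conduct (k - length v) v) k"
  unfolding branch_def
proof (intro conjI allI impI)
  fix v :: "bool list" assume "length v < k"
  then have "k - length v = Suc (k - Suc (length v))" by simp
  then show "conduct (k - length v) v =
     (conduct (k - length (False # v)) (False # v) + conduct (k - length (True # v)) (True # v)) /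
     (1 + (conduct (k - length (False # v)) (False # v) + conduct (k - length (True # v)) (True # v)))"
    by simp
qed (use conduct_nonneg conduct_alive[OF assms] in auto)

lemma conduct_lim_pos_imp_alive: "0 < conduct_lim v \<Longrightarrow> alive v"
  using conduct_dead conduct_tendsto LIMSEQ_unique tendsto_const
  by (metis (no_types, lifting) ext less_irrefl)

end

subsection \<open>The measure carried by a flow\<close>

text \<open>The mass of each node is laid out as an interval in \<open>[0,1)\<close>, the children of a node
  subdividing its interval; \<open>tree_node m n t\<close> is the node of level \<open>n\<close> whose interval contains \<open>t\<close>.\<close>

fun left_end :: "(bool list \<Rightarrow> real) \<Rightarrow> bool list \<Rightarrow> real" where
  "left_end m [] = 0"
| "left_end m (b # v) = left_end m v + (if b then m (False # v) else 0)"

primrec tree_node :: "(bool list \<Rightarrow> real) \<Rightarrow> nat \<Rightarrow> real \<Rightarrow> bool list" where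
  "tree_node m 0 t = []"
| "tree_node m (Suc n) t =
     (\<not> t < left_end m (tree_node m n t) + m (False # tree_node m n t)) # tree_node m n t"

lemma length_tree_node [simp]: "length (tree_node m n t) = n"
  by (induction n) auto

lemma drop_tree_node: "drop j (tree_node m (j + n) t) = tree_node m n t"
  by (induction j) auto

lemma measurable_tree_node [measurable]: "tree_node m n \<in> measurable borel (count_space UNIV)"
proof (induction n)
  case (Suc n)
  have "(\<lambda>t. (\<lambda>v t. (\<not> t < left_end m v + m (False # v)) # v) (tree_node m n t) t)
      \<in> measurable borel (count_space UNIV)"
    by (rule measurable_compose_countable[OF _ Suc]) measurable
  then show ?case by simp
qed simp

locale tree_mass =
  fixes m :: "bool list \<Rightarrow> real"
  assumes m_nonneg: "\<And>v. 0 \<le> m v" and m_root: "m [] = 1"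
    and m_split: "\<And>v. m (False # v) + m (True # v) = m v"
begin

lemma in_interval_tree_node:
  assumes "0 \<le> t" "t < 1"
  shows "left_end m (tree_node m n t) \<le> t \<and>
         t < left_end m (tree_node m n t) + m (tree_node m n t)"
proof (induction n)
  case 0
  then show ?case using assms by (simp add: m_root)
next
  case (Suc n)
  then show ?case using m_split[of "tree_node m n t"] by auto
qed

lemma tree_node_unique:
  assumes "left_end m v \<le> t" "t < left_end m v + m v"
  shows "0 \<le> t \<and> t < 1 \<and> tree_node m (length v) t = v"
  using assms
proof (induction v)
  case Nil
  then show ?case by (simp add: m_root)
next
  case (Cons b v)
  have "left_end m v \<le> t" "t < left_end m v + m v"
    using Cons.prems m_split[of v] m_nonneg[of "True # v"] m_nonneg[of "False # v"]
    by (auto split: if_splits)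
  from Cons.IH[OF this] show ?case
    using Cons.prems by (auto split: if_splits)
qed

definition unit_M :: "real measure" where
  "unit_M = restrict_space lborel {0..<1}"

lemma space_unit_M: "space unit_M = {0..<1}"
  by (simp add: unit_M_def space_restrict_space)

lemma sets_unit_M [measurable_cong]: "sets unit_M = sets (restrict_space borel {0..<1})"
  unfolding unit_M_def by (rule sets_restrict_space_cong) simp

lemma emeasure_unit_M: "emeasure unit_M (space unit_M) = 1"
  by (simp add: unit_M_def emeasure_restrict_space space_restrict_space)

lemma measurable_unit_M: "f \<in> measurable borel N \<Longrightarrow> f \<in> measurable unit_M N"
  unfolding unit_M_def by (intro measurable_restrict_space1) (simp add: measurable_lborel1)

lemma emeasure_tree_node:
  assumes "length v = n"
  shows "emeasure unit_M {t \<in> space unit_M. tree_node m n t = v} = ennreal (m v)"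
proof -
  have eq: "{t \<in> space unit_M. tree_node m n t = v} = {left_end m v..<left_end m v + m v}"
  proof (intro set_eqI iffI)
    fix t assume "t \<in> {t \<in> space unit_M. tree_node m n t = v}"
    then show "t \<in> {left_end m v..<left_end m v + m v}"
      using in_interval_tree_node[of t n] by (auto simp: space_unit_M)
  next
    fix t assume "t \<in> {left_end m v..<left_end m v + m v}"
    then show "t \<in> {t \<in> space unit_M. tree_node m n t = v}"
      using tree_node_unique[of v t] assms by (auto simp: space_unit_M)
  qed
  have sub: "{left_end m v..<left_end m v + m v} \<subseteq> {0..<1}"
  proof
    fix t assume "t \<in> {left_end m v..<left_end m v + m v}"
    then show "t \<in> {0..<1}" using tree_node_unique[of v t] by auto
  qed
  show ?thesis
    unfolding eq unfolding unit_M_def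
    by (subst emeasure_restrict_space) (use sub m_nonneg[of v] in auto)
qed

lemma nn_integral_tree_node:
  fixes g :: "bool list \<Rightarrow> ennreal"
  shows "(\<integral>\<^sup>+ t. g (tree_node m n t) \<partial>unit_M) = (\<Sum>v\<in>level n. g v * ennreal (m v))"
proof -
  have [measurable]: "tree_node m n \<in> measurable unit_M (count_space UNIV)"
    by (intro measurable_unit_M) measurable
  have node_sets: "{t \<in> space unit_M. tree_node m n t = v} \<in> sets unit_M" for v
    by measurable
  have "(\<integral>\<^sup>+ t. g (tree_node m n t) \<partial>unit_M) =
        (\<integral>\<^sup>+ t. (\<Sum>v\<in>level n. g v * indicator {t \<in> space unit_M. tree_node m n t = v} t) \<partial>unit_M)"
  proof (rule nn_integral_cong)
    fix t assume "t \<in> space unit_M"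
    then have "(\<Sum>v\<in>level n. g v * indicator {t \<in> space unit_M. tree_node m n t = v} t)
        = (\<Sum>v\<in>level n. if v = tree_node m n t then g v else 0)"
      by (intro sum.cong) (auto simp: indicator_def)
    also have "\<dots> = g (tree_node m n t)"
      by (subst sum.delta) auto
    finally show "g (tree_node m n t) =
        (\<Sum>v\<in>level n. g v * indicator {t \<in> space unit_M. tree_node m n t = v} t)" ..
  qed
  also have "\<dots> = (\<Sum>v\<in>level n. \<integral>\<^sup>+ t. g v * indicator {t \<in> space unit_M. tree_node m n t = v} t \<partial>unit_M)"
    by (rule nn_integral_sum) (intro borel_measurable_times_ennreal borel_measurable_const borel_measurable_indicator node_sets)
  also have "\<dots> = (\<Sum>v\<in>level n. g v * emeasure unit_M {t \<in> space unit_M. tree_node m n t = v})"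
    by (intro sum.cong refl nn_integral_cmult_indicator node_sets)
  also have "\<dots> = (\<Sum>v\<in>level n. g v * ennreal (m v))"
    by (intro sum.cong) (simp_all add: emeasure_tree_node)
  finally show ?thesis .
qed

text \<open>The probability that two independent branches are neighbours at level \<open>n\<close>.
  Summed over \<open>n\<close>, it will dominate the logarithmic energy.\<close>

lemma nn_integral_near:
  "(\<integral>\<^sup>+ s. \<integral>\<^sup>+ t. (if near (tree_node m n s) (tree_node m n t) then 1 else 0) \<partial>unit_M \<partial>unit_M)
     \<le> ennreal (961 * (\<Sum>v\<in>level n. (m v)\<^sup>2))"
proof -
  have inner: "(\<integral>\<^sup>+ t. (if near u (tree_node m n t) then 1 else 0) \<partial>unit_M) = ennreal (\<Sum>v | near u v. m v)"
    if "length u = n" for u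
  proof -
    have "(\<integral>\<^sup>+ t. (if near u (tree_node m n t) then 1 else 0) \<partial>unit_M) =
          (\<Sum>v\<in>level n. (if near u v then 1 else 0) * ennreal (m v))"
      by (rule nn_integral_tree_node[of "\<lambda>v. if near u v then 1 else 0"])
    also have "\<dots> = (\<Sum>v\<in>level n. if near u v then ennreal (m v) else 0)"
      by (intro sum.cong) auto
    also have "\<dots> = (\<Sum>v | near u v. ennreal (m v))"
      using that by (subst sum.If_cases) (auto intro!: sum.cong simp: near_def)
    finally show ?thesis by (simp add: sum_ennreal m_nonneg)
  qed
  have "(\<integral>\<^sup>+ s. \<integral>\<^sup>+ t. (if near (tree_node m n s) (tree_node m n t) then 1 else 0) \<partial>unit_M \<partial>unit_M)
      = (\<Sum>u\<in>level n. ennreal (\<Sum>v | near u v. m v) * ennreal (m u))"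
    using nn_integral_tree_node[of "\<lambda>u. ennreal (\<Sum>v | near u v. m v)" n] by (simp add: inner)
  also have "\<dots> = ennreal (\<Sum>u\<in>level n. m u * (\<Sum>v | near u v. m v))"
    by (simp add: m_nonneg sum_nonneg mult.commute flip: ennreal_mult'')
  also have "\<dots> \<le> ennreal (961 * (\<Sum>v\<in>level n. (m v)\<^sup>2))"
    by (intro ennreal_leI sum_near_le)
  finally show ?thesis .
qed

end

subsection \<open>Conductance bounds capacity\<close>

text \<open>A layer-cake bound on the scale of the cell sizes: since
  \<open>sqrt 2 \<le> exp 1\<close>, every natural \<open>j < - ln d\<close> satisfies
  \<open>d \<le> exp (- j) \<le> (1 / sqrt 2)^j\<close>. For \<open>d = 0\<close> all layers
  count.\<close>

lemma neg_ln_le_count: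
  fixes d :: real
  assumes "0 \<le> d"
  shows "(if d = 0 then \<infinity> else ennreal (max 0 (- ln d))) \<le>
         (\<Sum>n. if d \<le> (1 / sqrt 2) ^ n then 1 else (0::ennreal))" (is "_ \<le> ?R")
proof -
  have count: "of_nat N \<le> ?R" if "\<And>j. j < N \<Longrightarrow> d \<le> (1 / sqrt 2) ^ j" for N
  proof -
    have "of_nat N = (\<Sum>n<N. if d \<le> (1 / sqrt 2) ^ n then 1 else (0::ennreal))"
      using that by simp
    also have "\<dots> \<le> ?R"
      by (rule sum_le_suminf) auto
    finally show ?thesis .
  qed
  show ?thesis
  proof (cases "d = 0")
    case True
    then have "of_nat N \<le> ?R" for N
      using count by simp
    then have "?R = \<infinity>"
      by (metis infinity_ennreal_def linorder_not_le top.not_eq_extremum ennreal_Ex_less_of_nat)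
    then show ?thesis by simp
  next
    case False
    then have d: "0 < d" using assms by simp
    define N where "N = nat \<lceil>- ln d\<rceil>"
    have "d \<le> (1 / sqrt 2) ^ j" if "j < N" for j
    proof -
      have "real j < - ln d"
        using that unfolding N_def by linarith
      then have "d < exp (- real j)"
        using d by (metis exp_less_cancel_iff exp_ln neg_less_iff_less add.inverse_inverse)
      also have "exp (- real j) = exp (-1) ^ j"
        by (simp add: exp_of_nat_mult[symmetric])
      also have "\<dots> \<le> (1 / sqrt 2) ^ j"
      proof (rule power_mono)
        have "sqrt 2 \<le> sqrt (2\<^sup>2)" by (rule real_sqrt_le_mono) simp
        also have "\<dots> \<le> exp (1::real)" using exp_ge_add_one_self[of 1] by simp
        finally show "exp (-1) \<le> 1 / sqrt (2::real)"
          by (simp add: exp_minus field_simps)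
      qed simp
      finally show ?thesis by simp
    qed
    then have "of_nat N \<le> ?R" by (rule count)
    moreover have "ennreal (max 0 (- ln d)) \<le> of_nat N"
      unfolding N_def ennreal_of_nat_eq_real_of_nat by (intro ennreal_leI) linarith
    ultimately have "ennreal (max 0 (- ln d)) \<le> ?R" by (rule order_trans[rotated])
    then show ?thesis using False by simp
  qed
qed

context cell_tree
begin

text \<open>A bound of Frostman type. Read as a mass distribution on cells, the unit current gives a
  probability measure on \<open>E\<close>. Its energy is at most 961 times the sum of all squared
  cell masses, and \<open>flow_energy\<close> bounds that sum by the resistance
  \<open>1 / conduct_lim []\<close>.\<close>

lemma exp_le_log_capacity:
  assumes pos: "0 < conduct_lim []"
  shows "ereal (exp (- 961 / conduct_lim [])) \<le> log_capacity E"
proof -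
  note br = branch_conduct_lim[OF pos]
  define m where "m = flow conduct_lim"
  interpret tree_mass m
    by unfold_locales
       (use flow_nonneg[OF br] flow_split[OF br lessI] in \<open>auto simp: m_def simp del: flow.simps(2)\<close>)
  define X where "X = tree_node m"
  \<comment> \<open>The point to which the nested cells along the branch of \<open>t\<close>
    shrink.\<close>
  define pt where "pt t = lim (\<lambda>n. cen (X n t))" for t
  have [measurable]: "X n \<in> measurable unit_M (count_space UNIV)" for n
    unfolding X_def by (intro measurable_unit_M) measurable
  have pt_meas [measurable]: "pt \<in> borel_measurable unit_M"
    unfolding pt_def by (intro borel_measurable_lim_metric) measurable
  have rad0: "(\<lambda>n. C * rad n) \<longlonglongrightarrow> 0" for C
  proof -
    have "(\<lambda>n. (1 / sqrt 2 :: real) ^ n) \<longlonglongrightarrow> 0"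
      by (intro LIMSEQ_power_zero) simp
    from tendsto_mult_left[OF this, of "C * S"] show ?thesis by (simp add: mult.assoc)
  qed
  have step: "cmod (cen (X (j + n) t) - cen (X n t)) \<le> 5 / 2 * rad n" for j n t
  proof -
    have "cen (X (j + n) t) \<in> cell (drop j (X (j + n) t))"
      by (intro cell_drop cen_in_cell)
    then show ?thesis
      using dist_cell_cen[of "cen (X (j + n) t)" "X n t"] unfolding X_def drop_tree_node by simp
  qed
  have lim: "(\<lambda>n. cen (X n t)) \<longlonglongrightarrow> pt t" for t
  proof -
    have "Cauchy (\<lambda>n. cen (X n t))"
    proof (rule CauchyI')
      fix e :: real assume "0 < e"
      then obtain N where N: "5 / 2 * rad N < e / 2"
        using order_tendstoD(2)[OF rad0[of "5/2"], of "e / 2"]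
        by (auto simp: eventually_sequentially)
      show "\<exists>M. \<forall>m\<ge>M. \<forall>n>m. dist (cen (X m t)) (cen (X n t)) < e"
      proof (intro exI[of _ N] allI impI)
        fix i j assume "N \<le> i" "i < j"
        then have "cmod (cen (X i t) - cen (X N t)) < e / 2" "cmod (cen (X j t) - cen (X N t)) < e / 2"
          using step[of "i - N" N t] step[of "j - N" N t] N by auto
        then show "dist (cen (X i t)) (cen (X j t)) < e"
          using norm_triangle_ineq4[of "cen (X i t) - cen (X N t)" "cen (X j t) - cen (X N t)"]
          by (simp add: dist_norm)
      qed
    qed
    then show ?thesis
      unfolding pt_def by (simp add: Cauchy_convergent_iff convergent_LIMSEQ_iff)
  qed
  have close: "cmod (pt t - cen (X n t)) \<le> 5 / 2 * rad n" for t n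
  proof (rule Lim_norm_ubound[OF sequentially_bot])
    show "((\<lambda>j. cen (X (j + n) t) - cen (X n t)) \<longlongrightarrow> pt t - cen (X n t)) sequentially"
      by (rule tendsto_diff[OF LIMSEQ_ignore_initial_segment[OF lim] tendsto_const])
  qed (use step in auto)
  have ptE: "pt t \<in> E" if t: "t \<in> {0..<1}" for t
  proof -
    have "\<exists>x. x \<in> E \<and> cmod (x - cen (X n t)) \<le> 5 / 2 * rad n" for n
    proof -
      \<comment> \<open>The intervals are half-open, so a node without mass has an empty interval
        and no \<open>t\<close> reaches it. Hence every branch runs through live cells and its limit
        point lies in \<open>E\<close>.\<close>
      have "m (X n t) \<noteq> 0"
        using in_interval_tree_node[of t n] t unfolding X_def by auto
      then have "alive (X n t)"
        using flow_pos_imp[OF br] conduct_lim_pos_imp_alive unfolding m_def by blast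
      then show ?thesis
        using dist_cell_cen[of _ "X n t"] unfolding alive_def X_def by auto
    qed
    then obtain x where x: "\<And>n. x n \<in> E" "\<And>n. cmod (x n - cen (X n t)) \<le> 5 / 2 * rad n"
      by metis
    have "(\<lambda>n. x n - cen (X n t)) \<longlonglongrightarrow> 0"
      by (rule Lim_null_comparison[OF always_eventually rad0]) (use x(2) in blast)
    from tendsto_add[OF this lim[of t]] have "x \<longlonglongrightarrow> pt t" by simp
    then show ?thesis
      using x(1) compact_imp_closed[OF compact_E] closed_sequentially by blast
  qed
  define \<mu> where "\<mu> = distr unit_M borel pt"
  have \<mu>1: "emeasure \<mu> (space \<mu>) = 1"
    unfolding \<mu>_def using emeasure_unit_M by (simp add: emeasure_distr)
  have "emeasure \<mu> (space \<mu> - E) = 0"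
  proof -
    have "emeasure \<mu> (space \<mu> - E) = emeasure unit_M (pt -` (UNIV - E) \<inter> space unit_M)"
      unfolding \<mu>_def using borel_closed[OF compact_imp_closed[OF compact_E]]
      by (subst emeasure_distr) auto
    also have "pt -` (UNIV - E) \<inter> space unit_M = {}"
      using ptE by (auto simp: space_unit_M)
    finally show ?thesis by simp
  qed
  then have mem: "\<mu> \<in> cpt_prob_measures E"
    unfolding cpt_prob_measures_def using \<mu>1 compact_E by (auto simp: \<mu>_def)
  interpret fm: finite_measure \<mu>
    by (rule finite_measureI) (simp add: \<mu>1)
  define F where "F p = (if fst p = snd p then \<infinity>
      else ennreal (max 0 (- ln (cmod (fst p - snd p)))))" for p :: "complex \<times> complex"
  have [measurable]: "F \<in> borel_measurable (borel \<Otimes>\<^sub>M borel)"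
    unfolding F_def by measurable
  have setsmu [measurable_cong]: "sets \<mu> = sets borel" by (simp add: \<mu>_def)
  have neg: "(\<integral>\<^sup>+ p. F p \<partial>(\<mu> \<Otimes>\<^sub>M \<mu>)) \<le> ennreal (961 / conduct_lim [])"
  proof -
    have "(\<integral>\<^sup>+ p. F p \<partial>(\<mu> \<Otimes>\<^sub>M \<mu>)) = (\<integral>\<^sup>+ x. \<integral>\<^sup>+ y. F (x, y) \<partial>\<mu> \<partial>\<mu>)"
      by (subst fm.nn_integral_fst) auto
    also have "\<dots> = (\<integral>\<^sup>+ s. \<integral>\<^sup>+ y. F (pt s, y) \<partial>\<mu> \<partial>unit_M)"
    proof -
      have "(\<lambda>x. \<integral>\<^sup>+ y. F (x, y) \<partial>\<mu>) \<in> borel_measurable borel"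
        by (rule fm.borel_measurable_nn_integral_fst) measurable
      then have "(\<integral>\<^sup>+ x. (\<lambda>x. \<integral>\<^sup>+ y. F (x, y) \<partial>\<mu>) x \<partial>distr unit_M borel pt) =
          (\<integral>\<^sup>+ s. (\<lambda>x. \<integral>\<^sup>+ y. F (x, y) \<partial>\<mu>) (pt s) \<partial>unit_M)"
        by (intro nn_integral_distr pt_meas) simp
      then show ?thesis by (simp flip: \<mu>_def)
    qed
    also have "\<dots> = (\<integral>\<^sup>+ s. \<integral>\<^sup>+ t. F (pt s, pt t) \<partial>unit_M \<partial>unit_M)"
    proof (rule nn_integral_cong)
      fix s
      have "(\<lambda>y. F (pt s, y)) \<in> borel_measurable borel" by measurable
      then show "(\<integral>\<^sup>+ y. F (pt s, y) \<partial>\<mu>) = (\<integral>\<^sup>+ t. F (pt s, pt t) \<partial>unit_M)"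
        unfolding \<mu>_def by (intro nn_integral_distr pt_meas) simp
    qed
    also have "\<dots> \<le> (\<integral>\<^sup>+ s. \<integral>\<^sup>+ t. (\<Sum>n. if near (X n s) (X n t) then 1 else 0) \<partial>unit_M \<partial>unit_M)"
    proof (intro nn_integral_mono)
      fix s t
      have "F (pt s, pt t) \<le> (\<Sum>n. if cmod (pt s - pt t) \<le> (1 / sqrt 2) ^ n then 1 else 0)"
        using neg_ln_le_count[of "cmod (pt s - pt t)"]
        by (simp only: F_def fst_conv snd_conv norm_ge_zero norm_eq_zero right_minus_eq)
      also have "\<dots> \<le> (\<Sum>n. if near (X n s) (X n t) then 1 else 0)"
      proof (intro suminf_le summableI)
        fix n
        have "near (X n s) (X n t)" if "cmod (pt s - pt t) \<le> (1 / sqrt 2) ^ n"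
        proof (rule near_if_dist)
          \<comment> \<open>This is where \<open>1 \<le> S\<close> enters. The three distances below
            add up to at most \<open>(1 + 5/2 + 5/2) * rad n\<close>, well within the radius
            15.\<close>
          have "(1 / sqrt 2) ^ n \<le> rad n"
            using S_ge by (simp add: mult_le_cancel_right1)
          moreover have "cen (X n s) - cen (X n t) =
              (pt s - pt t) - (pt s - cen (X n s)) + (pt t - cen (X n t))" by simp
          then have "cmod (cen (X n s) - cen (X n t)) \<le>
              cmod (pt s - pt t) + cmod (pt s - cen (X n s)) + cmod (pt t - cen (X n t))"
            using norm_triangle_ineq[of "(pt s - pt t) - (pt s - cen (X n s))" "pt t - cen (X n t)"]
              norm_triangle_ineq4[of "pt s - pt t" "pt s - cen (X n s)"] by (simp only: )
          ultimately show "cmod (cen (X n s) - cen (X n t)) \<le> 15 * rad (length (X n t))"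
            using that close[of s n] close[of t n] rad_pos[of n]
            unfolding X_def length_tree_node by linarith
        qed (simp add: X_def)
        then show "(if cmod (pt s - pt t) \<le> (1 / sqrt 2) ^ n then 1 else 0) \<le>
            (if near (X n s) (X n t) then 1 else (0::ennreal))" by auto
      qed
      finally show "F (pt s, pt t) \<le> (\<Sum>n. if near (X n s) (X n t) then 1 else 0)" .
    qed
    also have "\<dots> = (\<Sum>n. \<integral>\<^sup>+ s. \<integral>\<^sup>+ t. (if near (X n s) (X n t) then 1 else 0) \<partial>unit_M \<partial>unit_M)"
    proof -
      have "(\<integral>\<^sup>+ t. (\<Sum>n. if near (X n s) (X n t) then 1 else 0) \<partial>unit_M) =
            (\<Sum>n. \<integral>\<^sup>+ t. (if near (X n s) (X n t) then 1 else (0::ennreal)) \<partial>unit_M)" for s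
        by (rule nn_integral_suminf) measurable
      moreover have "(\<lambda>s. \<integral>\<^sup>+ t. (if near (X n s) (X n t) then 1 else (0::ennreal)) \<partial>unit_M)
          \<in> borel_measurable unit_M" for n
        by (rule measurable_compose[of "X n" _ "count_space UNIV"
              "\<lambda>u. \<integral>\<^sup>+ t. (if near u (X n t) then 1 else (0::ennreal)) \<partial>unit_M"]) auto
      ultimately show ?thesis by (simp add: nn_integral_suminf)
    qed
    also have "\<dots> \<le> (\<Sum>n. ennreal (961 * (\<Sum>v\<in>level n. (m v)\<^sup>2)))"
      unfolding X_def by (intro suminf_le summableI nn_integral_near)
    also have "\<dots> \<le> ennreal (961 / conduct_lim [])"
    proof (rule suminf_le_const[OF summableI])
      fix n
      have "(\<Sum>j<n. \<Sum>v\<in>level j. (m v)\<^sup>2) \<le> 1 / conduct_lim []"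
        using flow_energy[OF br order_refl, of n]
          sum_nonneg[of "level n" "\<lambda>v. (m v)\<^sup>2 / conduct_lim v"] conduct_lim_nonneg
        by (auto simp: m_def)
      then have "(\<Sum>j<n. 961 * (\<Sum>v\<in>level j. (m v)\<^sup>2)) \<le> 961 / conduct_lim []"
        by (simp flip: sum_distrib_left)
      then show "(\<Sum>j<n. ennreal (961 * (\<Sum>v\<in>level j. (m v)\<^sup>2))) \<le> ennreal (961 / conduct_lim [])"
        by (subst sum_ennreal) (auto intro!: sum_nonneg ennreal_leI)
    qed
    finally show ?thesis .
  qed
  have "ereal (- 961 / conduct_lim []) \<le> log_energy \<mu>"
  proof -
    have "enn2ereal (\<integral>\<^sup>+ p. F p \<partial>(\<mu> \<Otimes>\<^sub>M \<mu>)) \<le> enn2ereal (ennreal (961 / conduct_lim []))"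
      using neg by (simp add: less_eq_ennreal.rep_eq)
    also have "\<dots> = ereal (961 / conduct_lim [])"
      using pos by (simp add: enn2ereal_ennreal)
    \<comment> \<open>The part of the energy with positive logarithm is nonnegative and is bounded
      below by 0.\<close>
    finally have "0 - ereal (961 / conduct_lim []) \<le>
        enn2ereal (\<integral>\<^sup>+ p. ennreal (max 0 (ln (cmod (fst p - snd p)))) \<partial>(\<mu> \<Otimes>\<^sub>M \<mu>))
        - enn2ereal (\<integral>\<^sup>+ p. F p \<partial>(\<mu> \<Otimes>\<^sub>M \<mu>))"
      by (intro ereal_minus_mono) auto
    then show ?thesis
      unfolding log_energy_def F_def by (simp add: zero_ereal_def)
  qed
  then have "ereal (exp (- 961 / conduct_lim [])) \<le> exp_ereal (log_energy \<mu>)"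
    by (cases "log_energy \<mu>") (auto simp: exp_ereal_def)
  also have "\<dots> \<le> log_capacity E"
    unfolding log_capacity_def using mem by (intro Sup_upper) auto
  finally show ?thesis .
qed

lemma conduct_small:
  assumes "log_capacity E < ereal (exp (- 961 / \<eta>))" "0 < \<eta>"
  shows "\<exists>k. conduct k [] < \<eta>"
proof (rule ccontr)
  assume "\<nexists>k. conduct k [] < \<eta>"
  then have le: "\<eta> \<le> conduct_lim []"
    by (intro LIMSEQ_le_const[OF conduct_tendsto]) (auto simp: not_less)
  then have "ereal (exp (- 961 / conduct_lim [])) \<le> log_capacity E"
    using assms(2) by (intro exp_le_log_capacity) simp
  moreover have "- 961 / \<eta> \<le> - 961 / conduct_lim []"
    using le assms(2) by (simp add: frac_le)
  ultimately have "ereal (exp (- 961 / \<eta>)) \<le> log_capacity E"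
    by (meson ereal_less_eq(3) exp_le_cancel_iff order_trans)
  with assms(1) show False by simp
qed

end

subsection \<open>Cutoff functions\<close>

text \<open>Squaring makes the positive part \<open>C^1\<close>, and all cutoffs and mollifiers
  below are built this way. At 0 the difference quotient is at most
  \<open>|h|^(p - 1)\<close>.\<close>

lemma DERIV_pos_part_power:
  assumes "2 \<le> p"
  shows "((\<lambda>t. (max 0 t) ^ p) has_real_derivative (real p * (max 0 t) ^ (p - 1))) (at t)"
proof -
  consider "t < 0" | "t = 0" | "0 < t" by linarith
  then show ?thesis
  proof cases
    case 1
    have "((\<lambda>t. 0::real) has_real_derivative 0) (at t)" by simp
    then have "((\<lambda>t. (max 0 t) ^ p) has_real_derivative 0) (at t)"
      by (rule has_field_derivative_transform_within_open[where S = "{..<0}"])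
         (use 1 assms in \<open>auto simp: max_def\<close>)
    moreover have "max 0 t = 0" using 1 by simp
    ultimately show ?thesis using assms by (simp add: power_0_left)
  next
    case 3
    have "((\<lambda>t. t ^ p) has_real_derivative (real p * t ^ (p - 1))) (at t)"
      by (auto intro!: derivative_eq_intros)
    then have "((\<lambda>t. (max 0 t) ^ p) has_real_derivative (real p * t ^ (p - 1))) (at t)"
      by (rule has_field_derivative_transform_within_open[where S = "{0<..}"])
         (use 3 in \<open>auto simp: max_def\<close>)
    then show ?thesis using 3 by (simp add: max_def)
  next
    case 2
    have lim: "(\<lambda>h::real. \<bar>h\<bar> ^ (p - 1)) \<midarrow>0\<rightarrow> 0"
      by (rule tendsto_null_power[OF tendsto_rabs_zero[OF tendsto_ident_at]]) (use assms in simp)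
    have "norm (((max 0 (0 + h)) ^ p - (max 0 0) ^ p) / h) \<le> \<bar>h\<bar> ^ (p - 1)" for h :: real
    proof (cases "h = 0")
      case False
      have p: "p = Suc (p - 1)" using assms by simp
      have "\<bar>max 0 h\<bar> ^ p \<le> \<bar>h\<bar> ^ p"
        by (rule power_mono) auto
      also have "\<dots> = \<bar>h\<bar> * \<bar>h\<bar> ^ (p - 1)"
        by (subst p) simp
      finally show ?thesis
        using False assms by (simp add: power_abs field_simps power_0_left)
    qed (use assms in simp)
    then have "(\<lambda>h. ((max 0 (0 + h)) ^ p - (max 0 0) ^ p) / h) \<midarrow>0\<rightarrow> (0::real)"
      by (intro Lim_null_comparison[OF always_eventually lim]) blast
    then show ?thesis using 2 assms by (simp add: DERIV_def power_0_left)
  qed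
qed

lemma has_derivative_cmod_power2:
  "((\<lambda>z. (cmod (z - c))\<^sup>2) has_derivative (\<lambda>h. (2 *\<^sub>R (z - c)) \<bullet> h)) (at z)"
  unfolding power2_norm_eq_inner
  by (auto intro!: derivative_eq_intros simp: inner_commute)

text \<open>The 4 makes the support the disc of radius \<open>2 * \<delta>\<close>, and the division
  by 9 = (4 - 1)^2 gives the value 1 on the circle of radius \<delta>.\<close>

definition bump :: "complex \<Rightarrow> real \<Rightarrow> complex \<Rightarrow> real" where
  "bump c \<delta> z = (max 0 (4 - (cmod (z - c))\<^sup>2 / \<delta>\<^sup>2))\<^sup>2 / 9"

definition bump_grad :: "complex \<Rightarrow> real \<Rightarrow> complex \<Rightarrow> complex" where
  "bump_grad c \<delta> z = (- (4 / (9 * \<delta>\<^sup>2)) * max 0 (4 - (cmod (z - c))\<^sup>2 / \<delta>\<^sup>2)) *\<^sub>R (z - c)"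

lemma bump_has_derivative: "(bump c \<delta> has_derivative (\<lambda>h. bump_grad c \<delta> z \<bullet> h)) (at z)"
proof -
  have "((\<lambda>z. 4 - (cmod (z - c))\<^sup>2 / \<delta>\<^sup>2) has_derivative (\<lambda>h. - ((2 *\<^sub>R (z - c)) \<bullet> h) / \<delta>\<^sup>2)) (at z)"
    using has_derivative_diff[OF has_derivative_const
        has_derivative_mult_left[OF has_derivative_cmod_power2, of _ "1 / \<delta>\<^sup>2"]]
    by simp
  from DERIV_compose_FDERIV[OF DERIV_pos_part_power[of 2] this]
  have "((\<lambda>z. (max 0 (4 - (cmod (z - c))\<^sup>2 / \<delta>\<^sup>2))\<^sup>2 / 9) has_derivative
      (\<lambda>h. (- ((2 *\<^sub>R (z - c)) \<bullet> h) / \<delta>\<^sup>2 * (2 * max 0 (4 - (cmod (z - c))\<^sup>2 / \<delta>\<^sup>2))) / 9)) (at z)"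
    using has_derivative_mult_left[of _ _ _ "1 / 9"] by fastforce
  then show ?thesis
    unfolding bump_def[abs_def] bump_grad_def by (simp add: algebra_simps diff_divide_distrib)
qed

lemma continuous_bump [continuous_intros]: "continuous_on A (bump c \<delta>)"
  unfolding bump_def[abs_def] by (cases "\<delta> = 0") (auto intro!: continuous_intros)

lemma continuous_bump_grad [continuous_intros]: "continuous_on A (bump_grad c \<delta>)"
  unfolding bump_grad_def[abs_def] by (cases "\<delta> = 0") (auto intro!: continuous_intros)

lemma bump_nonneg: "0 \<le> bump c \<delta> z"
  by (simp add: bump_def)

lemma bump_outside:
  assumes "0 < \<delta>" "2 * \<delta> \<le> cmod (z - c)"
  shows "bump c \<delta> z = 0" "bump_grad c \<delta> z = 0"
proof -
  have "(2 * \<delta>)\<^sup>2 \<le> (cmod (z - c))\<^sup>2"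
    using assms by (intro power_mono) auto
  then have "4 \<le> (cmod (z - c))\<^sup>2 / \<delta>\<^sup>2"
    using assms by (simp add: field_simps)
  then have "max 0 (4 - (cmod (z - c))\<^sup>2 / \<delta>\<^sup>2) = 0" by simp
  then show "bump c \<delta> z = 0" "bump_grad c \<delta> z = 0"
    unfolding bump_def bump_grad_def by simp_all
qed

lemma bump_ge_1:
  assumes "0 < \<delta>" "cmod (z - c) \<le> \<delta>"
  shows "1 \<le> bump c \<delta> z"
proof -
  have "(cmod (z - c))\<^sup>2 \<le> \<delta>\<^sup>2"
    using assms by (intro power_mono) auto
  then have "(cmod (z - c))\<^sup>2 / \<delta>\<^sup>2 \<le> 1"
    using assms by (simp add: field_simps)
  then have "3 \<le> max 0 (4 - (cmod (z - c))\<^sup>2 / \<delta>\<^sup>2)" by simp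
  then have "3\<^sup>2 \<le> (max 0 (4 - (cmod (z - c))\<^sup>2 / \<delta>\<^sup>2))\<^sup>2"
    by (rule power_mono) simp
  then show ?thesis unfolding bump_def by simp
qed

lemma bump_le:
  assumes "0 < \<delta>"
  shows "bump c \<delta> z \<le> 16 / 9 * indicator (cball c (2 * \<delta>)) z"
proof (cases "z \<in> cball c (2 * \<delta>)")
  case True
  have "(max 0 (4 - (cmod (z - c))\<^sup>2 / \<delta>\<^sup>2))\<^sup>2 \<le> 4\<^sup>2"
    by (rule power_mono) auto
  then show ?thesis using True by (simp add: bump_def)
next
  case False
  then show ?thesis using bump_outside(1)[OF assms, of z c] by (simp add: dist_norm norm_minus_commute)
qed

lemma norm_bump_grad_le:
  assumes "0 < \<delta>"
  shows "cmod (bump_grad c \<delta> z) \<le> 4 / \<delta> * indicator (cball c (2 * \<delta>)) z"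
proof (cases "z \<in> cball c (2 * \<delta>)")
  case True
  then have z: "cmod (z - c) \<le> 2 * \<delta>" by (simp add: dist_norm norm_minus_commute)
  have "cmod (bump_grad c \<delta> z) = 4 / (9 * \<delta>\<^sup>2) * max 0 (4 - (cmod (z - c))\<^sup>2 / \<delta>\<^sup>2) * cmod (z - c)"
    by (simp add: bump_grad_def abs_mult)
  also have "\<dots> \<le> 4 / (9 * \<delta>\<^sup>2) * 4 * (2 * \<delta>)"
    using z assms by (intro mult_mono) auto
  also have "\<dots> \<le> 4 / \<delta>"
    using assms by (simp add: power2_eq_square divide_simps)
  finally show ?thesis using True by simp
next
  case False
  then show ?thesis using bump_outside(2)[OF assms, of z c] by (simp add: dist_norm norm_minus_commute)
qed

text \<open>\<open>smooth_cap t\<close> is a \<open>C\<^sup>1\<close> substitute for \<open>min 1 t\<close>.\<close>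

definition smooth_cap :: "real \<Rightarrow> real" where
  "smooth_cap t = 1 - (max 0 (1 - t))\<^sup>2"

lemma DERIV_smooth_cap: "(smooth_cap has_real_derivative 2 * max 0 (1 - t)) (at t)"
proof -
  have "((\<lambda>t. 1 - t) has_real_derivative - 1) (at t)"
    by (auto intro!: derivative_eq_intros)
  from DERIV_chain2[OF DERIV_pos_part_power[of 2] this]
  have "((\<lambda>t. (max 0 (1 - t))\<^sup>2) has_real_derivative - (2 * max 0 (1 - t))) (at t)" by simp
  from DERIV_diff[OF DERIV_const[of 1] this] show ?thesis
    unfolding smooth_cap_def[abs_def] by simp
qed

lemma smooth_cap_has_derivative:
  assumes "(u has_derivative (\<lambda>h. g \<bullet> h)) (at z)"
  shows "((\<lambda>z. smooth_cap (u z)) has_derivative (\<lambda>h. ((2 * max 0 (1 - u z)) *\<^sub>R g) \<bullet> h)) (at z)"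
  using DERIV_compose_FDERIV[OF DERIV_smooth_cap assms] by (simp add: mult.commute)

lemma smooth_cap_bounds:
  assumes "0 \<le> t"
  shows "0 \<le> smooth_cap t" "smooth_cap t \<le> 2 * t"
proof -
  have "(max 0 (1 - t))\<^sup>2 \<le> 1\<^sup>2"
    using assms by (intro power_mono) auto
  then show "0 \<le> smooth_cap t" by (simp add: smooth_cap_def)
  show "smooth_cap t \<le> 2 * t"
  proof (cases "t \<le> 1")
    case True
    then have "smooth_cap t = 2 * t - t\<^sup>2"
      by (simp add: smooth_cap_def power2_diff)
    then show ?thesis by simp
  qed (simp add: smooth_cap_def)
qed

lemma smooth_cap_ge_1: "1 \<le> t \<Longrightarrow> smooth_cap t = 1"
  by (simp add: smooth_cap_def)

lemma measure_cball_complex: "0 \<le> r \<Longrightarrow> measure lborel (cball (c::complex) r) = pi * r\<^sup>2"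
  by (simp add: content_cball unit_ball_vol_2)

lemma integrable_indicator_cball: "integrable lborel (indicator (cball (c::complex) r) :: complex \<Rightarrow> real)"
  using emeasure_lborel_cball_finite[of c r] by (simp add: integrable_indicator_iff)

section \<open>The potential of the current and its Sobolev norm\<close>

context cell_tree
begin

lemma rad_mono: "n \<le> k \<Longrightarrow> rad k \<le> rad n"
  using S_pos by (intro mult_left_mono power_decreasing) auto

lemma sum_rad_ratio: "(\<Sum>j\<le>n. (1 / sqrt 2) ^ j) \<le> (4::real)"
proof -
  have "(\<Sum>j\<le>n. (1 / sqrt 2) ^ j) \<le> (\<Sum>j. (1 / sqrt 2 :: real) ^ j)"
    by (rule sum_le_suminf) (auto intro!: summable_geometric)
  also have "\<dots> = 1 / (1 - 1 / sqrt 2)"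
    by (rule suminf_geometric) simp
  also have "\<dots> \<le> 4"
  proof -
    have "4 / 3 \<le> sqrt (2::real)"
      by (rule real_le_rsqrt) (simp add: power_divide)
    then have "1 / sqrt 2 \<le> (3 / 4 :: real)" by (simp add: field_simps)
    then show ?thesis by (simp add: field_simps)
  qed
  finally show ?thesis .
qed

context
  fixes k :: nat
  assumes root_alive: "alive []"
begin

definition sub_conduct :: "bool list \<Rightarrow> real" where "sub_conduct v = conduct (k - length v) v"

text \<open>The current under unit voltage. With this scaling the weights along a path to
  \<open>E\<close> sum to 1, and their total energy is at most the conductance instead of the
  resistance.\<close>

definition weight :: "bool list \<Rightarrow> real" where "weight v = conduct k [] * flow sub_conduct v"

lemma branch_sub_conduct: "branch sub_conduct k"
  unfolding sub_conduct_def[abs_def] using branch_conduct[OF root_alive] .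

lemma weight_nonneg: "0 \<le> weight v"
  by (simp add: weight_def conduct_nonneg flow_nonneg[OF branch_sub_conduct])

lemma weight_energy: "(\<Sum>n\<le>k. \<Sum>v\<in>level n. (weight v)\<^sup>2) \<le> conduct k []"
proof -
  have c: "0 < conduct k []" using conduct_alive[OF root_alive] .
  \<comment> \<open>Leaves have conductance 1 or 0, so the remainder term of
    \<open>flow_energy\<close> dominates the energy of the last level itself.\<close>
  have "(\<Sum>v\<in>level k. (flow sub_conduct v)\<^sup>2) \<le> (\<Sum>v\<in>level k. (flow sub_conduct v)\<^sup>2 / sub_conduct v)"
  proof (rule sum_mono)
    fix v :: "bool list" assume "v \<in> level k"
    then have "sub_conduct v = 1 \<or> sub_conduct v = 0" by (simp add: sub_conduct_def)
    moreover have "sub_conduct v = 0 \<Longrightarrow> flow sub_conduct v = 0"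
      using flow_pos_imp[OF branch_sub_conduct, of v] by linarith
    ultimately show "(flow sub_conduct v)\<^sup>2 \<le> (flow sub_conduct v)\<^sup>2 / sub_conduct v" by auto
  qed
  then have "(\<Sum>n\<le>k. \<Sum>v\<in>level n. (flow sub_conduct v)\<^sup>2) \<le> 1 / sub_conduct []"
    using flow_energy[OF branch_sub_conduct order_refl] by (simp add: lessThan_Suc_atMost[symmetric])
  then have "(conduct k [])\<^sup>2 * (\<Sum>n\<le>k. \<Sum>v\<in>level n. (flow sub_conduct v)\<^sup>2) \<le> (conduct k [])\<^sup>2 * (1 / sub_conduct [])"
    by (rule mult_left_mono) simp
  also have "\<dots> = conduct k []"
    using c by (simp add: sub_conduct_def power2_eq_square)
  finally show ?thesis
    by (simp add: weight_def power_mult_distrib sum_distrib_left)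
qed

text \<open>At a live leaf the conductance is 1, so the last term of \<open>flow_path\<close> is the
  flow of the leaf and completes the sum down to level \<open>k\<close>.\<close>

lemma weight_path:
  assumes "x \<in> E" "x \<in> cell v" "length v = k"
  shows "(\<Sum>n\<le>k. weight (drop (k - n) v)) = 1"
proof -
  have c: "0 < conduct k []" using conduct_alive[OF root_alive] .
  have al: "alive (drop j v)" for j
    using assms cell_drop unfolding alive_def by blast
  have "(\<Sum>j=1..k. flow sub_conduct (drop j v)) + flow sub_conduct v / sub_conduct v = 1 / sub_conduct []"
    using flow_path[OF branch_sub_conduct, of v] al conduct_alive assms(3) by (simp add: sub_conduct_def)
  moreover have "sub_conduct v = 1" using al[of 0] assms(3) by (simp add: sub_conduct_def)
  ultimately have "(\<Sum>j\<le>k. flow sub_conduct (drop j v)) = 1 / conduct k []"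
    by (simp add: atMost_atLeast0 sum.atLeast_Suc_atMost sub_conduct_def)
  moreover have "(\<Sum>n\<le>k. flow sub_conduct (drop (k - n) v)) = (\<Sum>j\<le>k. flow sub_conduct (drop j v))"
    by (rule sum.nat_diff_reindex[of "\<lambda>j. flow sub_conduct (drop j v)" "Suc k", unfolded lessThan_Suc_atMost, simplified])
  ultimately show ?thesis
    using c by (simp add: weight_def flip: sum_distrib_left)
qed

lemma weight_descendants:
  assumes "n \<le> m" "m \<le> k" "u \<in> level n"
  shows "(\<Sum>v\<in>{v\<in>level m. drop (m - n) v = u}. weight v) = weight u"
  using flow_descendants[OF branch_sub_conduct, of n "m - n" u] assms
  by (simp add: weight_def flip: sum_distrib_left)

text \<open>The factor 3 is 1/2 + 5/2: a point within \<open>rad k / 2\<close> of a point of a level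
  \<open>n\<close> cell, for \<open>n \<le> k\<close>, is at most that far from the centre of the
  cell in units of \<open>rad n\<close>.\<close>

abbreviation (input) \<delta> :: "nat \<Rightarrow> real" where "\<delta> n \<equiv> 3 * rad n"

text \<open>One function dominates the level \<open>n\<close> part of the gradient and, up to a
  multiple of \<open>S\<close>, of the potential as well; \<open>4 / \<delta> n\<close> is the
  gradient bound of a bump.\<close>

definition majorant :: "nat \<Rightarrow> complex \<Rightarrow> real" where
  "majorant n z = (\<Sum>v\<in>level n. weight v * (4 / \<delta> n) * indicator (cball (cen v) (2 * \<delta> n)) z)"

lemma majorant_nonneg: "0 \<le> majorant n z"
  unfolding majorant_def using weight_nonneg rad_pos[of n]
  by (intro sum_nonneg mult_nonneg_nonneg) auto

text \<open>On a disc of level \<open>m\<close> the coarser majorant sees only the neighbours of one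
  node, the ancestor of \<open>v\<close>: the ancestor's centre is 5/2 away and the two disc radii
  are at most 6, in units of \<open>rad n\<close>, together less than 15.\<close>

lemma majorant_le_near:
  assumes "n \<le> m" "v \<in> level m" "z \<in> cball (cen v) (2 * \<delta> m)"
  shows "majorant n z \<le> 4 / \<delta> n * (\<Sum>u | near (drop (m - n) v) u. weight u)"
proof -
  let ?w = "drop (m - n) v"
  have lw: "length ?w = n" using assms by auto
  have "near ?w u" if u: "u \<in> level n" and z: "z \<in> cball (cen u) (2 * \<delta> n)" for u
  proof (rule near_if_dist)
    have "cmod (cen v - cen ?w) \<le> 5 / 2 * rad n"
      using dist_cell_cen[OF cell_drop[OF cen_in_cell]] lw by metis
    moreover have "cmod (cen v - z) \<le> 6 * rad n"
      using assms rad_mono[OF assms(1)] by (simp add: dist_norm)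
    moreover have "cmod (cen u - z) \<le> 6 * rad n"
      using z by (simp add: dist_norm)
    moreover have split: "cen ?w - cen u = (cen v - z) - (cen v - cen ?w) - (cen u - z)" by simp
    have "cmod (cen ?w - cen u) \<le> cmod (cen v - z) + cmod (cen v - cen ?w) + cmod (cen u - z)"
      unfolding split using norm_triangle_ineq4[of "(cen v - z) - (cen v - cen ?w)" "cen u - z"]
        norm_triangle_ineq4[of "cen v - z" "cen v - cen ?w"] by linarith
    ultimately show "cmod (cen ?w - cen u) \<le> 15 * rad (length u)"
      using u rad_pos[of n] by simp
  qed (use lw u in auto)
  then have "majorant n z \<le> (\<Sum>u\<in>level n. 4 / \<delta> n * (if near ?w u then weight u else 0))"
    unfolding majorant_def using weight_nonneg rad_pos[of n]
    by (intro sum_mono) (auto simp: indicator_def simp del: mem_cball)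
  also have "\<dots> = 4 / \<delta> n * (\<Sum>u\<in>level n. if near ?w u then weight u else 0)"
    by (simp only: sum_distrib_left)
  also have "(\<Sum>u\<in>level n. if near ?w u then weight u else 0) = (\<Sum>u | near ?w u. weight u)"
    using lw by (subst sum.If_cases) (auto intro!: sum.cong simp: near_def)
  finally show ?thesis .
qed

lemma majorant_prod_integrable: "integrable lborel (\<lambda>z. majorant n z * majorant m z)"
proof -
  have "integrable lborel (\<lambda>z. (weight u * (4 / \<delta> n) * indicator (cball (cen u) (2 * \<delta> n)) z) *
      (weight v * (4 / \<delta> m) * indicator (cball (cen v) (2 * \<delta> m)) z))" for u v
  proof -
    have "integrable lborel (\<lambda>z. (weight u * (4 / \<delta> n) * (weight v * (4 / \<delta> m))) *
        (indicator (cball (cen v) (2 * \<delta> m)) z * indicator (cball (cen u) (2 * \<delta> n)) z :: real))"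
      by (intro integrable_mult_right integrable_real_mult_indicator integrable_indicator_cball) auto
    then show ?thesis by (simp add: mult_ac)
  qed
  then show ?thesis unfolding majorant_def sum_product by (intro Bochner_Integration.integrable_sum)
qed

text \<open>The decay in \<open>m - n\<close> is the point, since treating the levels separately
  would cost a factor \<open>k\<close>. The heights \<open>4 / \<delta> m\<close> and
  \<open>4 / \<delta> n\<close> times the area \<open>pi * (2 * \<delta> m)^2\<close> give
  \<open>64 * pi * \<delta> m / \<delta> n\<close>, and the fine weights below an ancestor add up to
  the weight of that ancestor.\<close>

lemma majorant_prod_integral_le:
  assumes nm: "n \<le> m" "m \<le> k"
  shows "(\<integral>z. majorant n z * majorant m z \<partial>lborel) \<le> 64 * pi * 961 * (1 / sqrt 2) ^ (m - n) * (\<Sum>u\<in>level n. (weight u)\<^sup>2)"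
proof -
  let ?N = "\<lambda>w. \<Sum>u | near w u. weight u"
  let ?a = "\<lambda>v. weight v * (4 / \<delta> m) * (4 / \<delta> n * ?N (drop (m - n) v))"
  have "(\<integral>z. majorant n z * majorant m z \<partial>lborel) \<le>
        (\<integral>z. (\<Sum>v\<in>level m. ?a v * indicator (cball (cen v) (2 * \<delta> m)) z) \<partial>lborel)"
  proof (rule integral_mono[OF majorant_prod_integrable])
    show "integrable lborel (\<lambda>z. \<Sum>v\<in>level m. ?a v * indicator (cball (cen v) (2 * \<delta> m)) z)"
      by (intro Bochner_Integration.integrable_sum integrable_mult_right integrable_indicator_cball)
    fix z
    have "majorant n z * majorant m z = (\<Sum>v\<in>level m. weight v * (4 / \<delta> m) * (majorant n z * indicator (cball (cen v) (2 * \<delta> m)) z))"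
      unfolding majorant_def[of m] sum_distrib_left by (intro sum.cong) auto
    also have "\<dots> \<le> (\<Sum>v\<in>level m. weight v * (4 / \<delta> m) * ((4 / \<delta> n * ?N (drop (m - n) v)) * indicator (cball (cen v) (2 * \<delta> m)) z))"
      using majorant_le_near[OF nm(1)] weight_nonneg rad_pos[of m]
      by (intro sum_mono mult_left_mono) (auto simp: indicator_def simp del: mem_cball)
    finally show "majorant n z * majorant m z \<le> (\<Sum>v\<in>level m. ?a v * indicator (cball (cen v) (2 * \<delta> m)) z)"
      by (simp only: mult.assoc)
  qed
  also have "\<dots> = (\<Sum>v\<in>level m. ?a v * (pi * (2 * \<delta> m)\<^sup>2))"
    using rad_pos[of m]
    by (subst Bochner_Integration.integral_sum)
       (auto intro!: integrable_mult_right integrable_indicator_cball sum.cong simp: measure_cball_complex)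
  also have "\<dots> = (\<Sum>v\<in>level m. 64 * pi * (1 / sqrt 2) ^ (m - n) * (weight v * ?N (drop (m - n) v)))"
  proof (rule sum.cong[OF refl])
    fix v :: "bool list"
    have r: "rad m = rad n * (1 / sqrt 2) ^ (m - n)"
      using nm by (simp add: power_add[symmetric])
    have "x * (4 / (3 * (a * q))) * (4 / (3 * a) * y) * (pi * (2 * (3 * (a * q)))\<^sup>2) =
        64 * pi * q * (x * y)" if "0 < a" "0 < q" for a q x y :: real
      using that by (simp add: power2_eq_square field_simps)
    from this[OF rad_pos[of n], of "(1 / sqrt 2) ^ (m - n)" "weight v" "?N (drop (m - n) v)"]
    show "?a v * (pi * (2 * \<delta> m)\<^sup>2) =
        64 * pi * (1 / sqrt 2) ^ (m - n) * (weight v * ?N (drop (m - n) v))"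
      unfolding r by simp
  qed
  also have "\<dots> = 64 * pi * (1 / sqrt 2) ^ (m - n) * (\<Sum>v\<in>level m. weight v * ?N (drop (m - n) v))"
    by (simp only: sum_distrib_left)
  also have "(\<Sum>v\<in>level m. weight v * ?N (drop (m - n) v)) =
      (\<Sum>u\<in>level n. \<Sum>v\<in>{v\<in>level m. drop (m - n) v = u}. weight v * ?N (drop (m - n) v))"
    by (rule sum.group[symmetric]) (use nm in auto)
  also have "\<dots> = (\<Sum>u\<in>level n. weight u * ?N u)"
  proof (rule sum.cong[OF refl])
    fix u assume u: "u \<in> level n"
    have "(\<Sum>v\<in>{v\<in>level m. drop (m - n) v = u}. weight v * ?N (drop (m - n) v)) =
        (\<Sum>v\<in>{v\<in>level m. drop (m - n) v = u}. weight v) * ?N u"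
      unfolding sum_distrib_right by (intro sum.cong) auto
    then show "(\<Sum>v\<in>{v\<in>level m. drop (m - n) v = u}. weight v * ?N (drop (m - n) v)) = weight u * ?N u"
      using weight_descendants[OF nm u] by simp
  qed
  also have "64 * pi * (1 / sqrt 2) ^ (m - n) * \<dots> \<le>
      64 * pi * (1 / sqrt 2) ^ (m - n) * (961 * (\<Sum>u\<in>level n. (weight u)\<^sup>2))"
    by (intro mult_left_mono sum_near_le) auto
  finally show ?thesis by (simp add: mult_ac)
qed

text \<open>When the square is expanded, the two orders of a pair of levels give a factor 2 and the
  geometric series a factor 4, so 512 = 2 * 4 * 64.\<close>

lemma majorant_integral_le:
  "integrable lborel (\<lambda>z. (\<Sum>n\<le>k. majorant n z)\<^sup>2)"
  "(\<integral>z. (\<Sum>n\<le>k. majorant n z)\<^sup>2 \<partial>lborel) \<le> 512 * pi * 961 * conduct k []"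
proof -
  define C where "C = 64 * pi * (961 :: real)"
  define En where "En n = (\<Sum>u\<in>level n. (weight u)\<^sup>2)" for n
  define A where "A n m = (\<integral>z. majorant n z * majorant m z \<partial>lborel)" for n m
  \<comment> \<open>\<open>B\<close> charges a pair of levels to the coarser one and is 0 otherwise,
    so that \<open>B n m + B m n\<close> bounds \<open>A n m\<close> in either order.\<close>
  define B where "B n m = (if n \<le> m then C * (1 / sqrt 2) ^ (m - n) * En n else 0)" for n m :: nat
  have C: "0 \<le> C" by (simp add: C_def)
  have En: "0 \<le> En n" for n unfolding En_def by (intro sum_nonneg) auto
  have B0: "0 \<le> B n m" for n m using C En by (simp add: B_def)
  have AB: "A n m \<le> B n m" if "n \<le> m" "m \<le> k" for n m
    using majorant_prod_integral_le[OF that] that by (simp add: A_def B_def C_def En_def)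
  have Asym: "A n m = A m n" for n m by (simp add: A_def mult.commute)
  have sq: "(\<Sum>n\<le>k. majorant n z)\<^sup>2 = (\<Sum>n\<le>k. \<Sum>m\<le>k. majorant n z * majorant m z)" for z
    by (simp add: power2_eq_square sum_product)
  show "integrable lborel (\<lambda>z. (\<Sum>n\<le>k. majorant n z)\<^sup>2)"
    unfolding sq by (intro Bochner_Integration.integrable_sum majorant_prod_integrable)
  have "(\<integral>z. (\<Sum>n\<le>k. majorant n z)\<^sup>2 \<partial>lborel) = (\<Sum>n\<le>k. \<Sum>m\<le>k. A n m)"
    unfolding sq A_def
    by (subst Bochner_Integration.integral_sum, (intro Bochner_Integration.integrable_sum majorant_prod_integrable)[1],
        subst Bochner_Integration.integral_sum, (intro Bochner_Integration.integrable_sum majorant_prod_integrable)[1]) (rule refl)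
  also have "\<dots> \<le> (\<Sum>n\<le>k. \<Sum>m\<le>k. B n m + B m n)"
  proof (intro sum_mono)
    fix n m assume "n \<in> {..k}" "m \<in> {..k}"
    then show "A n m \<le> B n m + B m n"
      using AB[of n m] AB[of m n] B0[of n m] B0[of m n] Asym[of n m] by (cases "n \<le> m") auto
  qed
  also have "\<dots> = 2 * (\<Sum>n\<le>k. \<Sum>m\<le>k. B n m)"
    using sum.swap[of "\<lambda>n m. B m n" "{..k}" "{..k}"] by (simp add: sum.distrib)
  also have "(\<Sum>n\<le>k. \<Sum>m\<le>k. B n m) \<le> (\<Sum>n\<le>k. C * En n * 4)"
  proof (rule sum_mono)
    fix n assume n: "n \<in> {..k}"
    have "(\<Sum>m\<le>k. B n m) = (\<Sum>m\<in>{n..k}. C * (1 / sqrt 2) ^ (m - n) * En n)"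
      unfolding B_def by (subst sum.If_cases) (auto intro!: sum.cong)
    also have "\<dots> = C * En n * (\<Sum>m\<in>{n..k}. (1 / sqrt 2) ^ (m - n))"
      by (simp add: sum_distrib_left mult_ac)
    also have "(\<Sum>m\<in>{n..k}. (1 / sqrt 2 :: real) ^ (m - n)) = (\<Sum>j\<le>k - n. (1 / sqrt 2) ^ j)"
      by (rule sum.reindex_bij_witness[of _ "\<lambda>j. j + n" "\<lambda>m. m - n"]) (use n in auto)
    also have "C * En n * \<dots> \<le> C * En n * 4"
      by (intro mult_left_mono sum_rad_ratio mult_nonneg_nonneg C En)
    finally show "(\<Sum>m\<le>k. B n m) \<le> C * En n * 4" .
  qed
  also have "(\<Sum>n\<le>k. C * En n * 4) = 4 * C * (\<Sum>n\<le>k. En n)"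
    unfolding sum_distrib_left by (rule sum.cong) simp_all
  also have "\<dots> \<le> 4 * C * conduct k []"
    using weight_energy C by (intro mult_left_mono) (auto simp: En_def)
  finally show "(\<integral>z. (\<Sum>n\<le>k. majorant n z)\<^sup>2 \<partial>lborel) \<le> 512 * pi * 961 * conduct k []"
    by (simp add: C_def)
qed

definition pot :: "complex \<Rightarrow> real" where
  "pot z = (\<Sum>n\<le>k. \<Sum>v\<in>level n. weight v * bump (cen v) (\<delta> n) z)"

definition pot_grad :: "complex \<Rightarrow> complex" where
  "pot_grad z = (\<Sum>n\<le>k. \<Sum>v\<in>level n. weight v *\<^sub>R bump_grad (cen v) (\<delta> n) z)"

lemma pot_has_derivative: "(pot has_derivative (\<lambda>h. pot_grad z \<bullet> h)) (at z)"
  unfolding pot_def[abs_def] pot_grad_def inner_sum_left inner_scaleR_left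
  by (intro has_derivative_sum has_derivative_mult_right bump_has_derivative)

lemma pot_nonneg: "0 \<le> pot z"
  unfolding pot_def by (intro sum_nonneg mult_nonneg_nonneg weight_nonneg bump_nonneg)

lemma pot_le: "pot z \<le> 4 / 3 * S * (\<Sum>n\<le>k. majorant n z)"
  unfolding pot_def sum_distrib_left[of _ "\<lambda>n. majorant n z"]
proof (rule sum_mono)
  fix n
  have d: "0 < \<delta> n" using rad_pos[of n] by simp
  have "weight v * bump (cen v) (\<delta> n) z \<le> 4 / 3 * S * (weight v * (4 / \<delta> n) * indicator (cball (cen v) (2 * \<delta> n)) z)" for v
  proof -
    have "bump (cen v) (\<delta> n) z \<le> 16 / 9 * indicator (cball (cen v) (2 * \<delta> n)) z"
      by (rule bump_le[OF d])
    also have "\<dots> \<le> (4 / 3 * S * (4 / \<delta> n)) * indicator (cball (cen v) (2 * \<delta> n)) z"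
      using rad_mono[of 0 n] rad_pos[of n] S_pos by (intro mult_right_mono) (auto simp: field_simps)
    finally have "weight v * bump (cen v) (\<delta> n) z \<le> weight v * ((4 / 3 * S * (4 / \<delta> n)) * indicator (cball (cen v) (2 * \<delta> n)) z)"
      by (rule mult_left_mono[OF _ weight_nonneg])
    then show ?thesis by (simp only: mult_ac)
  qed
  then show "(\<Sum>v\<in>level n. weight v * bump (cen v) (\<delta> n) z) \<le> 4 / 3 * S * majorant n z"
    unfolding majorant_def sum_distrib_left[of "4 / 3 * S"] by (rule sum_mono)
qed

lemma norm_pot_grad_le: "cmod (pot_grad z) \<le> (\<Sum>n\<le>k. majorant n z)"
  unfolding pot_grad_def
proof (rule sum_norm_le)
  fix n
  have d: "0 < \<delta> n" using rad_pos[of n] by simp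
  show "cmod (\<Sum>v\<in>level n. weight v *\<^sub>R bump_grad (cen v) (\<delta> n) z) \<le> majorant n z"
    unfolding majorant_def
  proof (rule sum_norm_le)
    fix v
    show "cmod (weight v *\<^sub>R bump_grad (cen v) (\<delta> n) z) \<le> weight v * (4 / \<delta> n) * indicator (cball (cen v) (2 * \<delta> n)) z"
      using mult_left_mono[OF norm_bump_grad_le[OF d, of "cen v" z] weight_nonneg[of v]] weight_nonneg[of v]
      by (simp add: mult.assoc)
  qed
qed

text \<open>At each level the bump of the cell containing \<open>x\<close> is at least 1 at
  \<open>z\<close>, so \<open>pot z\<close> is at least the sum of the weights along one branch,
  which is 1 by \<open>weight_path\<close>.\<close>

lemma pot_ge_1:
  assumes x: "x \<in> E" and z: "cmod (z - x) \<le> rad k / 2"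
  shows "1 \<le> pot z"
proof -
  obtain v where v: "length v = k" "x \<in> cell v"
    using E_in_level[OF x] by blast
  have "weight (drop (k - n) v) \<le> (\<Sum>u\<in>level n. weight u * bump (cen u) (\<delta> n) z)" if n: "n \<le> k" for n
  proof -
    let ?u = "drop (k - n) v"
    have lu: "length ?u = n" using v n by simp
    have "cmod (x - cen ?u) \<le> 5 / 2 * rad n"
      using dist_cell_cen[OF cell_drop[OF v(2)], of "k - n"] lu by simp
    moreover have "cmod (z - cen ?u) \<le> cmod (z - x) + cmod (x - cen ?u)"
      using norm_triangle_ineq[of "z - x" "x - cen ?u"] by simp
    ultimately have "cmod (z - cen ?u) \<le> \<delta> n"
      using z rad_mono[OF n] by linarith
    then have "1 \<le> bump (cen ?u) (\<delta> n) z"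
      using rad_pos[of n] by (intro bump_ge_1) auto
    then have "weight ?u * 1 \<le> weight ?u * bump (cen ?u) (\<delta> n) z"
      by (rule mult_left_mono[OF _ weight_nonneg])
    also have "\<dots> \<le> (\<Sum>u\<in>level n. weight u * bump (cen u) (\<delta> n) z)"
      using lu by (intro member_le_sum) (auto simp: weight_nonneg bump_nonneg)
    finally show ?thesis by simp
  qed
  then have "(\<Sum>n\<le>k. weight (drop (k - n) v)) \<le> pot z"
    unfolding pot_def by (intro sum_mono) auto
  then show ?thesis using weight_path[OF x v(2,1)] by simp
qed

end

end

text \<open>Being 1 on a neighbourhood of \<open>K\<close> keeps the support of
  \<open>(1 - \<theta>) \<phi>\<close> away from \<open>K\<close>. Compactness of that support is
  supplied by the test function that \<theta> multiplies.\<close>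

definition C1_cutoff :: "complex set \<Rightarrow> real \<Rightarrow> (complex \<Rightarrow> real) \<Rightarrow> (complex \<Rightarrow> complex) \<Rightarrow> bool" where
  "C1_cutoff K \<eta> \<theta> g \<longleftrightarrow>
     (\<exists>V. open V \<and> K \<subseteq> V \<and> (\<forall>z\<in>V. \<theta> z = 1)) \<and>
     (\<forall>z. (\<theta> has_derivative (\<lambda>h. g z \<bullet> h)) (at z)) \<and> continuous_on UNIV g \<and>
     integrable lborel (\<lambda>z. (\<theta> z)\<^sup>2) \<and> (\<integral>z. (\<theta> z)\<^sup>2 \<partial>lborel) \<le> \<eta> \<and>
     integrable lborel (\<lambda>z. (cmod (g z))\<^sup>2) \<and> (\<integral>z. (cmod (g z))\<^sup>2 \<partial>lborel) \<le> \<eta>"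

lemma C1_cutoff_mono:
  assumes "C1_cutoff K \<eta> \<theta> g" "\<eta> \<le> \<eta>'"
  shows "C1_cutoff K \<eta>' \<theta> g"
  using assms(1) order_trans[OF _ assms(2)] unfolding C1_cutoff_def by auto

lemma (in cell_tree) C1_cutoff_conduct:
  "\<exists>\<theta> g. C1_cutoff E (9 * S\<^sup>2 * (512 * pi * 961) * conduct k []) \<theta> g"
proof (cases "alive []")
  case False
  then have "E = {}" using E_in_root by (auto simp: alive_def)
  then have "C1_cutoff E (9 * S\<^sup>2 * (512 * pi * 961) * conduct k []) (\<lambda>_. 0) (\<lambda>_. 0)"
    unfolding C1_cutoff_def conduct_dead[OF False] inner_zero_left by auto
  then show ?thesis by blast
next
  case True
  note [simp] = True
  let ?p = "pot k" and ?q = "pot_grad k" and ?G = "\<lambda>z. \<Sum>n\<le>k. majorant k n z"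
  define \<theta> where "\<theta> z = smooth_cap (?p z)" for z
  define g where "g z = (2 * max 0 (1 - ?p z)) *\<^sub>R ?q z" for z
  note p0 = pot_nonneg[OF True, of k]
  have der: "(\<theta> has_derivative (\<lambda>h. g z \<bullet> h)) (at z)" for z
    unfolding \<theta>_def[abs_def] g_def
    by (rule smooth_cap_has_derivative[OF pot_has_derivative[OF True]])
  have cont_p: "continuous_on UNIV ?p"
    using pot_has_derivative[OF True] by (auto simp: continuous_on_eq_continuous_at intro: has_derivative_continuous)
  have cont_q: "continuous_on UNIV ?q"
    unfolding pot_grad_def[OF True, abs_def] by (intro continuous_intros)
  have cont_g: "continuous_on UNIV g"
    unfolding g_def[abs_def] by (intro continuous_intros cont_p cont_q)
  have cont_\<theta>: "continuous_on UNIV \<theta>"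
    using der by (auto simp: continuous_on_eq_continuous_at intro: has_derivative_continuous)
  have [measurable]: "\<theta> \<in> borel_measurable borel" "g \<in> borel_measurable borel"
    using cont_\<theta> cont_g by (auto intro: borel_measurable_continuous_onI)
  have G0: "0 \<le> ?G z" for z by (intro sum_nonneg majorant_nonneg[OF True])
  have \<theta>_le: "(\<theta> z)\<^sup>2 \<le> 9 * S\<^sup>2 * (?G z)\<^sup>2" for z
  proof -
    have "\<theta> z \<le> 2 * ?p z" unfolding \<theta>_def by (rule smooth_cap_bounds(2)[OF p0])
    also have "\<dots> \<le> 2 * (4 / 3 * S * ?G z)" using pot_le[OF True, of k z] by simp
    \<comment> \<open>Rounding 8/3 up to 3 lets the same constant \<open>9 * S^2\<close> serve the
      gradient, whose factor is 2.\<close>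
    also have "\<dots> \<le> 3 * S * ?G z" using G0[of z] S_pos by simp
    finally have "(\<theta> z)\<^sup>2 \<le> (3 * S * ?G z)\<^sup>2"
      by (rule power_mono) (simp add: \<theta>_def smooth_cap_bounds(1)[OF p0])
    then show ?thesis by (simp add: power_mult_distrib)
  qed
  have g_le: "(cmod (g z))\<^sup>2 \<le> 9 * S\<^sup>2 * (?G z)\<^sup>2" for z
  proof -
    have "cmod (g z) = 2 * max 0 (1 - ?p z) * cmod (?q z)" by (simp add: g_def)
    also have "\<dots> \<le> 2 * 1 * ?G z"
      using p0[of z] norm_pot_grad_le[OF True, of k z] by (intro mult_mono) auto
    also have "\<dots> \<le> 3 * S * ?G z"
      using G0[of z] S_ge by (intro mult_right_mono) auto
    finally have "(cmod (g z))\<^sup>2 \<le> (3 * S * ?G z)\<^sup>2"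
      by (rule power_mono) simp
    then show ?thesis by (simp add: power_mult_distrib)
  qed
  have int: "integrable lborel (\<lambda>z. 9 * S\<^sup>2 * (?G z)\<^sup>2)"
    by (intro integrable_mult_right majorant_integral_le(1)[OF True])
  have bound: "integrable lborel u \<and> (\<integral>z. u z \<partial>lborel) \<le> 9 * S\<^sup>2 * (512 * pi * 961) * conduct k []"
    if [measurable]: "u \<in> borel_measurable borel" and u: "\<And>z. 0 \<le> u z" "\<And>z. u z \<le> 9 * S\<^sup>2 * (?G z)\<^sup>2" for u
  proof
    show i: "integrable lborel u"
      by (rule Bochner_Integration.integrable_bound[OF int]) (use u in \<open>auto simp: abs_of_nonneg\<close>)
    have "(\<integral>z. u z \<partial>lborel) \<le> (\<integral>z. 9 * S\<^sup>2 * (?G z)\<^sup>2 \<partial>lborel)"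
      by (rule integral_mono[OF i int]) (rule u)
    also have "\<dots> = 9 * S\<^sup>2 * (\<integral>z. (?G z)\<^sup>2 \<partial>lborel)" by simp
    also have "\<dots> \<le> 9 * S\<^sup>2 * (512 * pi * 961 * conduct k [])"
      by (intro mult_left_mono majorant_integral_le(2)[OF True]) auto
    finally show "(\<integral>z. u z \<partial>lborel) \<le> 9 * S\<^sup>2 * (512 * pi * 961) * conduct k []"
      by (simp add: mult.assoc)
  qed
  have "\<exists>V. open V \<and> E \<subseteq> V \<and> (\<forall>z\<in>V. \<theta> z = 1)"
  proof (intro exI conjI ballI)
    show "open (\<Union>x\<in>E. ball x (rad k / 2))" by auto
    show "E \<subseteq> (\<Union>x\<in>E. ball x (rad k / 2))" using rad_pos[of k] by force
    fix z assume "z \<in> (\<Union>x\<in>E. ball x (rad k / 2))"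
    then obtain x where "x \<in> E" "cmod (z - x) \<le> rad k / 2"
      by (auto simp: dist_norm norm_minus_commute)
    from pot_ge_1[OF True this] show "\<theta> z = 1"
      unfolding \<theta>_def by (rule smooth_cap_ge_1)
  qed
  then have "C1_cutoff E (9 * S\<^sup>2 * (512 * pi * 961) * conduct k []) \<theta> g"
    unfolding C1_cutoff_def
    using der cont_g bound[of "\<lambda>z. (\<theta> z)\<^sup>2"] \<theta>_le bound[of "\<lambda>z. (cmod (g z))\<^sup>2"] g_le by auto
  then show ?thesis by blast
qed

text \<open>Intersecting with a disc makes the set compact and does not increase its capacity. The
  depth \<open>k\<close> at which the conductance is small depends on \<open>E\<close>, but the
  threshold \<gamma> depends only on \<eta> and \<open>A\<close>.\<close>

lemma small_capacity_cutoff: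
  assumes "0 < \<eta>"
  shows "\<exists>\<gamma>>0. \<forall>E. closed E \<and> log_capacity E < ereal \<gamma> \<longrightarrow>
           (\<exists>\<theta> g. C1_cutoff (E \<inter> cball 0 A) \<eta> \<theta> g)"
proof -
  define S where "S = max 1 A"
  define C where "C = 9 * S\<^sup>2 * (512 * pi * 961)"
  have C: "0 < C" by (simp add: C_def S_def)
  show ?thesis
  proof (intro exI[of _ "exp (- 961 / (\<eta> / C))"] conjI allI impI)
    show "0 < exp (- 961 / (\<eta> / C))" by simp
    fix E :: "complex set"
    assume E: "closed E \<and> log_capacity E < ereal (exp (- 961 / (\<eta> / C)))"
    interpret cell_tree S "E \<inter> cball 0 A"
      by unfold_locales (use E in \<open>auto simp: S_def intro: closed_Int_compact\<close>)
    have "log_capacity (E \<inter> cball 0 A) \<le> log_capacity E"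
      unfolding log_capacity_def cpt_prob_measures_def
      by (intro Sup_subset_mono insert_mono image_mono) auto
    then obtain k where k: "conduct k [] < \<eta> / C"
      using conduct_small[of "\<eta> / C"] E C assms by fastforce
    then have "C * conduct k [] \<le> \<eta>"
      using C by (simp add: field_simps)
    then show "\<exists>\<theta> g. C1_cutoff (E \<inter> cball 0 A) \<eta> \<theta> g"
      using C1_cutoff_conduct[of k] C1_cutoff_mono unfolding C_def by blast
  qed
qed

subsection \<open>Wirtinger derivatives and test functions\<close>

text \<open>\<open>a\<close> and \<open>d\<close> are the derivatives of \<open>\<phi>\<close> with respect to \<open>z\<close> and to the conjugate of \<open>z\<close>.\<close>

definition wirtinger :: "(complex \<Rightarrow> complex) \<Rightarrow> (complex \<Rightarrow> complex) \<Rightarrow> (complex \<Rightarrow> complex) \<Rightarrow> bool" where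
  "wirtinger \<phi> a d \<longleftrightarrow> (\<forall>z. (\<phi> has_derivative (\<lambda>h. a z * h + d z * cnj h)) (at z)) \<and>
     continuous_on UNIV a \<and> continuous_on UNIV d"

definition test_fun ::
  "complex set \<Rightarrow> (complex \<Rightarrow> complex) \<Rightarrow> (complex \<Rightarrow> complex) \<Rightarrow> (complex \<Rightarrow> complex) \<Rightarrow> bool" where
  "test_fun U \<phi> a d \<longleftrightarrow> wirtinger \<phi> a d \<and> (\<exists>K. compact K \<and> K \<subseteq> U \<and> (\<forall>z. z \<notin> K \<longrightarrow> \<phi> z = 0))"

lemma wirtinger_continuous: "wirtinger \<phi> a d \<Longrightarrow> continuous_on UNIV \<phi>"
  unfolding wirtinger_def
  by (auto simp: continuous_on_eq_continuous_at intro: has_derivative_continuous)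

lemma wirtinger_add:
  assumes "wirtinger \<phi> a d" "wirtinger \<phi>' a' d'"
  shows "wirtinger (\<lambda>z. \<phi> z + \<phi>' z) (\<lambda>z. a z + a' z) (\<lambda>z. d z + d' z)"
proof -
  have "((\<lambda>z. \<phi> z + \<phi>' z) has_derivative (\<lambda>h. (a z + a' z) * h + (d z + d' z) * cnj h)) (at z)" for z
    using has_derivative_add[of \<phi> "\<lambda>h. a z * h + d z * cnj h" "at z" \<phi>' "\<lambda>h. a' z * h + d' z * cnj h"] assms
    unfolding wirtinger_def by (simp add: algebra_simps)
  then show ?thesis using assms unfolding wirtinger_def by (auto intro!: continuous_intros)
qed

lemma wirtinger_mult:
  assumes "wirtinger \<phi> a d" "wirtinger \<phi>' a' d'"
  shows "wirtinger (\<lambda>z. \<phi> z * \<phi>' z) (\<lambda>z. \<phi> z * a' z + a z * \<phi>' z) (\<lambda>z. \<phi> z * d' z + d z * \<phi>' z)"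
proof -
  have "((\<lambda>z. \<phi> z * \<phi>' z) has_derivative
      (\<lambda>h. (\<phi> z * a' z + a z * \<phi>' z) * h + (\<phi> z * d' z + d z * \<phi>' z) * cnj h)) (at z)" for z
    using has_derivative_mult[of \<phi> "\<lambda>h. a z * h + d z * cnj h" z UNIV \<phi>' "\<lambda>h. a' z * h + d' z * cnj h"] assms
    unfolding wirtinger_def by (simp add: algebra_simps)
  then show ?thesis
    using assms wirtinger_continuous[OF assms(1)] wirtinger_continuous[OF assms(2)]
    unfolding wirtinger_def by (auto intro!: continuous_intros)
qed

lemma wirtinger_const: "wirtinger (\<lambda>z. c) (\<lambda>z. 0) (\<lambda>z. 0)"
  by (simp add: wirtinger_def)

lemma wirtinger_cnj: "wirtinger (\<lambda>z. cnj (z - \<zeta>)) (\<lambda>z. 0) (\<lambda>z. 1)"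
  unfolding wirtinger_def by (auto intro!: derivative_eq_intros)

lemma wirtinger_of_real:
  assumes "\<And>z. (u has_derivative (\<lambda>h. g z \<bullet> h)) (at z)" "continuous_on UNIV g"
  shows "wirtinger (\<lambda>z. of_real (u z)) (\<lambda>z. cnj (g z) / 2) (\<lambda>z. g z / 2)"
proof -
  have "of_real (w \<bullet> h) = cnj w / 2 * h + w / 2 * cnj h" for w h :: complex
    by (simp add: complex_eq_iff inner_complex_def field_simps)
  moreover have "((\<lambda>z. of_real (u z) :: complex) has_derivative (\<lambda>h. of_real (g z \<bullet> h))) (at z)" for z
    using assms(1) by (intro derivative_intros)
  ultimately show ?thesis
    using assms(2) unfolding wirtinger_def by (auto intro!: continuous_intros)
qed

lemma zero_derivative_outside:
  assumes "wirtinger \<phi> a d" "closed K" "\<And>z. z \<notin> K \<Longrightarrow> \<phi> z = 0" "z \<notin> K"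
  shows "a z = 0" "d z = 0"
proof -
  have "((\<lambda>z. 0) has_derivative (\<lambda>h. 0::complex)) (at z)" by simp
  then have "(\<phi> has_derivative (\<lambda>h. 0)) (at z)"
    by (rule has_derivative_transform_within_open[where s = "- K"]) (use assms in auto)
  moreover have "(\<phi> has_derivative (\<lambda>h. a z * h + d z * cnj h)) (at z)"
    using assms(1) by (simp add: wirtinger_def)
  ultimately have e: "(\<lambda>h. a z * h + d z * cnj h) = (\<lambda>h. 0)"
    by (rule has_derivative_unique[symmetric])
  have "a z + d z = 0" using fun_cong[OF e, of 1] by simp
  moreover have "\<i> * (a z - d z) = 0" using fun_cong[OF e, of \<i>] by (simp add: algebra_simps)
  ultimately show "a z = 0" "d z = 0" by auto
qed

lemma test_funE:
  assumes "test_fun U \<phi> a d"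
  obtains K where "compact K" "K \<subseteq> U" "\<And>z. z \<notin> K \<Longrightarrow> \<phi> z = 0"
    "\<And>z. z \<notin> K \<Longrightarrow> a z = 0" "\<And>z. z \<notin> K \<Longrightarrow> d z = 0"
  using assms zero_derivative_outside compact_imp_closed unfolding test_fun_def by metis

lemma test_fun_continuous:
  assumes "test_fun U \<phi> a d"
  shows "continuous_on UNIV \<phi>" "continuous_on UNIV a" "continuous_on UNIV d"
  using assms wirtinger_continuous unfolding test_fun_def wirtinger_def by blast+

lemma test_fun_mult:
  assumes "test_fun U \<phi> a d" "wirtinger \<phi>' a' d'"
  shows "test_fun U (\<lambda>z. \<phi> z * \<phi>' z) (\<lambda>z. \<phi> z * a' z + a z * \<phi>' z) (\<lambda>z. \<phi> z * d' z + d z * \<phi>' z)"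
  using assms wirtinger_mult[of \<phi> a d \<phi>' a' d'] unfolding test_fun_def by (metis mult_zero_left)

lemma test_fun_add:
  assumes "test_fun U \<phi> a d" "test_fun U \<phi>' a' d'"
  shows "test_fun U (\<lambda>z. \<phi> z + \<phi>' z) (\<lambda>z. a z + a' z) (\<lambda>z. d z + d' z)"
proof -
  obtain K K' where "compact K" "K \<subseteq> U" "\<forall>z. z \<notin> K \<longrightarrow> \<phi> z = 0"
    "compact K'" "K' \<subseteq> U" "\<forall>z. z \<notin> K' \<longrightarrow> \<phi>' z = 0"
    using assms unfolding test_fun_def by blast
  then have "compact (K \<union> K') \<and> K \<union> K' \<subseteq> U \<and> (\<forall>z. z \<notin> K \<union> K' \<longrightarrow> \<phi> z + \<phi>' z = 0)"
    by auto
  then show ?thesis using assms wirtinger_add unfolding test_fun_def by blast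
qed

lemma test_fun_cmult:
  assumes "test_fun U \<phi> a d"
  shows "test_fun U (\<lambda>z. c * \<phi> z) (\<lambda>z. c * a z) (\<lambda>z. c * d z)"
  using test_fun_mult[OF assms wirtinger_const[of c]] by (simp add: mult.commute)

lemma test_fun_zero: "test_fun U (\<lambda>z. 0) (\<lambda>z. 0) (\<lambda>z. 0)"
  using wirtinger_const[of 0] unfolding test_fun_def by auto

section \<open>Integration by parts for test functions\<close>

lemma continuous_compact_support_integrable:
  fixes f :: "complex \<Rightarrow> 'b::{banach, second_countable_topology}"
  assumes "continuous_on UNIV f" "compact K" "\<And>z. z \<notin> K \<Longrightarrow> f z = 0"
  shows "integrable lborel f"
proof -
  have "integrable lborel (\<lambda>z. indicator K z *\<^sub>R f z)"
    using assms by (intro borel_integrable_compact) (auto intro: continuous_on_subset)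
  moreover have "(\<lambda>z. indicator K z *\<^sub>R f z) = f"
    using assms(3) by (auto simp: indicator_def)
  ultimately show ?thesis by simp
qed

lemma continuous_compact_support_bounded:
  fixes f :: "complex \<Rightarrow> 'b::real_normed_vector"
  assumes "continuous_on UNIV f" "compact K" "\<And>z. z \<notin> K \<Longrightarrow> f z = 0"
  obtains B where "0 < B" "\<And>z. norm (f z) \<le> B"
proof -
  have "compact (f ` K)"
    using assms by (intro compact_continuous_image) (auto intro: continuous_on_subset)
  then obtain B where "0 < B" "\<forall>y\<in>f ` K. norm y \<le> B"
    using compact_imp_bounded bounded_pos by metis
  then have "norm (f z) \<le> B" for z
    by (cases "z \<in> K") (use assms(3) in auto)
  then show thesis using that \<open>0 < B\<close> by blast
qed

lemma integral_lborel_translate: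
  fixes f :: "complex \<Rightarrow> 'b::{banach, second_countable_topology}"
  assumes "integrable lborel f"
  shows "integrable lborel (\<lambda>z. f (c + z))" "(\<integral>z. f (c + z) \<partial>lborel) = (\<integral>z. f z \<partial>lborel)"
proof -
  have eq: "distr lborel borel ((+) c) = (lborel :: complex measure)"
    by (rule lborel_distr_plus)
  have [measurable]: "f \<in> borel_measurable borel" using assms by simp
  show "integrable lborel (\<lambda>z. f (c + z))"
    using assms by (subst (asm) eq[symmetric]) (simp add: integrable_distr_eq)
  show "(\<integral>z. f (c + z) \<partial>lborel) = (\<integral>z. f z \<partial>lborel)"
    by (subst (2) eq[symmetric]) (simp add: integral_distr)
qed

text \<open>By translation invariance the difference quotients of \<phi> in direction
  \<open>e\<close> have integral 0. They are dominated by a Lipschitz constant on a fixed disc, so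
  the limit may be taken under the integral.\<close>

lemma integral_directional_derivative_zero:
  assumes T: "test_fun U \<phi> a d"
  shows "(\<integral>z. a z * e + d z * cnj e \<partial>lborel) = 0"
proof -
  obtain K where K: "compact K" "\<And>z. z \<notin> K \<Longrightarrow> \<phi> z = 0" "\<And>z. z \<notin> K \<Longrightarrow> a z = 0" "\<And>z. z \<notin> K \<Longrightarrow> d z = 0"
    using test_funE[OF T] by metis
  note cont = test_fun_continuous[OF T]
  obtain Ba where Ba: "\<And>z. cmod (a z) \<le> Ba" "0 < Ba" using continuous_compact_support_bounded[OF cont(2) K(1,3)] by metis
  obtain Bd where Bd: "\<And>z. cmod (d z) \<le> Bd" "0 < Bd" using continuous_compact_support_bounded[OF cont(3) K(1,4)] by metis
  obtain R where R: "\<And>z. z \<in> K \<Longrightarrow> cmod z \<le> R" using compact_imp_bounded[OF K(1)] bounded_iff by metis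
  define t where "t n = 1 / (real n + 1)" for n
  have t: "0 < t n" "t n \<le> 1" for n by (auto simp: t_def)
  have t0: "t \<longlonglongrightarrow> 0"
    using LIMSEQ_inverse_real_of_nat unfolding t_def[abs_def] by (simp add: inverse_eq_divide add.commute)
  define F where "F n z = (\<phi> (t n * e + z) - \<phi> z) / t n" for n z
  have int\<phi>: "integrable lborel \<phi>"
    by (rule continuous_compact_support_integrable[OF cont(1) K(1,2)])
  have intF: "(\<integral>z. F n z \<partial>lborel) = 0" for n
    unfolding F_def using integral_lborel_translate[OF int\<phi>, of "t n * e"] int\<phi> by simp
  have lip: "cmod (\<phi> (t n * e + z) - \<phi> z) \<le> (Ba + Bd) * (t n * cmod e)" for n z
  proof -
    have "cmod (\<phi> (t n * e + z) - \<phi> z) \<le> (Ba + Bd) * cmod ((t n * e + z) - z)"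
    proof (rule differentiable_bound[where S = UNIV and f' = "\<lambda>z h. a z * h + d z * cnj h"])
      show "(\<phi> has_derivative (\<lambda>h. a z * h + d z * cnj h)) (at z within UNIV)" for z
        using T by (simp add: test_fun_def wirtinger_def)
      show "onorm (\<lambda>h. a z * h + d z * cnj h) \<le> Ba + Bd" for z
      proof (rule onorm_le)
        fix h
        have "cmod (a z * h + d z * cnj h) \<le> cmod (a z) * cmod h + cmod (d z) * cmod h"
          using norm_triangle_ineq[of "a z * h" "d z * cnj h"] by (simp add: norm_mult)
        also have "\<dots> \<le> (Ba + Bd) * cmod h"
          unfolding distrib_right by (intro add_mono mult_right_mono Ba Bd) auto
        finally show "cmod (a z * h + d z * cnj h) \<le> (Ba + Bd) * cmod h" .
      qed
    qed auto
    then show ?thesis using t[of n] by (simp add: norm_mult)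
  qed
  have "(\<lambda>n. \<integral>z. F n z \<partial>lborel) \<longlonglongrightarrow> (\<integral>z. a z * e + d z * cnj e \<partial>lborel)"
  proof (rule integral_dominated_convergence[where w = "\<lambda>z. (Ba + Bd) * cmod e * indicator (cball 0 (R + cmod e)) z"])
    show "(\<lambda>z. a z * e + d z * cnj e) \<in> borel_measurable lborel"
      using cont by (auto intro!: borel_measurable_continuous_onI continuous_intros)
    show "F n \<in> borel_measurable lborel" for n
      unfolding F_def[abs_def] using cont(1)
      by (auto intro!: borel_measurable_continuous_onI continuous_intros
          continuous_on_compose2[of UNIV \<phi>] simp: t(1)[THEN less_imp_neq, symmetric])
    show "integrable lborel (\<lambda>z. (Ba + Bd) * cmod e * indicator (cball (0::complex) (R + cmod e)) z)"
      by (intro integrable_mult_right integrable_indicator_cball)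
    show "AE z in lborel. (\<lambda>n. F n z) \<longlonglongrightarrow> a z * e + d z * cnj e"
    proof (rule AE_I2)
      fix z
      have 1: "(\<phi> has_derivative (\<lambda>h. a z * h + d z * cnj h)) (at z)"
        using T by (simp add: test_fun_def wirtinger_def)
      have 2: "((\<lambda>x. of_real x * e + z) has_derivative (\<lambda>x. of_real x * e)) (at 0)"
        by (auto intro!: derivative_eq_intros)
      have "((\<lambda>x. \<phi> (of_real x * e + z)) has_derivative (\<lambda>x. a z * (of_real x * e) + d z * cnj (of_real x * e))) (at 0)"
        using has_derivative_compose[OF 2, of \<phi> "\<lambda>h. a z * h + d z * cnj h"] 1 by simp
      then have lim: "(\<lambda>x::real. norm (\<phi> (of_real x * e + z) - \<phi> z - of_real x * (a z * e + d z * cnj e)) / norm x) \<midarrow>0\<rightarrow> 0"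
        by (simp add: has_derivative_at algebra_simps)
      have "(\<lambda>x::real. (\<phi> (of_real x * e + z) - \<phi> z) / of_real x - (a z * e + d z * cnj e)) \<midarrow>0\<rightarrow> 0"
      proof (rule Lim_null_comparison[OF _ lim])
        have "norm ((\<phi> (of_real x * e + z) - \<phi> z) / of_real x - (a z * e + d z * cnj e))
            = norm (\<phi> (of_real x * e + z) - \<phi> z - of_real x * (a z * e + d z * cnj e)) / norm x"
          if "x \<noteq> 0" for x :: real
        proof -
          have "(\<phi> (of_real x * e + z) - \<phi> z) / of_real x - (a z * e + d z * cnj e)
              = (\<phi> (of_real x * e + z) - \<phi> z - of_real x * (a z * e + d z * cnj e)) / of_real x"
            using that by (simp add: diff_divide_distrib)
          then show ?thesis by (simp only: norm_divide norm_of_real real_norm_def)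
        qed
        then show "\<forall>\<^sub>F x in at 0. norm ((\<phi> (complex_of_real x * e + z) - \<phi> z) / of_real x - (a z * e + d z * cnj e))
            \<le> norm (\<phi> (of_real x * e + z) - \<phi> z - of_real x * (a z * e + d z * cnj e)) / norm x"
          unfolding eventually_at by (intro exI[of _ 1]) auto
      qed
      then have "(\<lambda>x::real. (\<phi> (of_real x * e + z) - \<phi> z) / of_real x) \<midarrow>0\<rightarrow> a z * e + d z * cnj e"
        by (simp only: LIM_zero_iff)
      moreover have "filterlim t (at 0) sequentially"
        using t0 t by (auto simp: filterlim_at less_imp_neq[symmetric])
      ultimately show "(\<lambda>n. F n z) \<longlonglongrightarrow> a z * e + d z * cnj e"
        unfolding F_def by (rule filterlim_compose)
    qed
    show "AE z in lborel. norm (F n z) \<le> (Ba + Bd) * cmod e * indicator (cball 0 (R + cmod e)) z" for n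
    proof (rule AE_I2)
      fix z
      have F: "norm (F n z) = cmod (\<phi> (t n * e + z) - \<phi> z) / t n"
        using t[of n] by (simp add: F_def norm_divide)
      show "norm (F n z) \<le> (Ba + Bd) * cmod e * indicator (cball 0 (R + cmod e)) z"
      proof (cases "cmod z \<le> R + cmod e")
        case True
        then show ?thesis using lip[of n z] t(1)[of n] unfolding F by (simp add: field_simps)
      next
        case False
        then have "z \<notin> K" using R[of z] norm_ge_zero[of e] by auto
        moreover have "t n * e + z \<notin> K"
        proof
          assume "t n * e + z \<in> K"
          then have "cmod (t n * e + z) \<le> R" by (rule R)
          moreover have "cmod z \<le> cmod (t n * e + z) + cmod (t n * e)"
            using norm_triangle_ineq4[of "t n * e + z" "t n * e"] by simp
          moreover have "cmod (t n * e) \<le> cmod e"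
            using t[of n] by (simp add: norm_mult mult_left_le_one_le)
          ultimately show False using False by linarith
        qed
        ultimately show ?thesis using K(2) unfolding F by (simp add: False)
      qed
    qed
  qed
  then show ?thesis unfolding intF using LIMSEQ_unique tendsto_const by blast
qed

text \<open>The directions 1 and \<i> show that the integrals of \<open>a\<close> and
  \<open>d\<close> have both sum and difference 0.\<close>

lemma integral_dbar_zero:
  assumes "test_fun U \<phi> a d"
  shows "(\<integral>z. d z \<partial>lborel) = 0"
proof -
  obtain K where K: "compact K" "\<And>z. z \<notin> K \<Longrightarrow> a z = 0" "\<And>z. z \<notin> K \<Longrightarrow> d z = 0"
    using test_funE[OF assms] by metis
  note cont = test_fun_continuous[OF assms]
  have ia: "integrable lborel a" by (rule continuous_compact_support_integrable[OF cont(2) K(1,2)])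
  have id: "integrable lborel d" by (rule continuous_compact_support_integrable[OF cont(3) K(1,3)])
  have "(\<integral>z. a z \<partial>lborel) + (\<integral>z. d z \<partial>lborel) = 0"
    using integral_directional_derivative_zero[OF assms, of 1] ia id by simp
  moreover have "(\<integral>z. a z \<partial>lborel) * \<i> - (\<integral>z. d z \<partial>lborel) * \<i> = 0"
    using integral_directional_derivative_zero[OF assms, of \<i>] ia id by simp
  then have "(\<integral>z. a z \<partial>lborel) = (\<integral>z. d z \<partial>lborel)"
    by (simp flip: left_diff_distrib)
  ultimately show ?thesis by simp
qed

lemma continuous_extend_zero:
  fixes u :: "complex \<Rightarrow> 'b::real_normed_vector"
  assumes "open D" "compact K" "K \<subseteq> D" "continuous_on D u" "\<And>z. z \<in> D \<Longrightarrow> z \<notin> K \<Longrightarrow> u z = 0"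
  shows "continuous_on UNIV (\<lambda>z. if z \<in> D then u z else 0)"
proof -
  have "continuous_on (D \<union> - K) (\<lambda>z. if z \<in> D then u z else 0)"
  proof (rule continuous_on_open_Un)
    show "continuous_on D (\<lambda>z. if z \<in> D then u z else 0)"
      using assms(4) by (rule continuous_on_eq) simp
    have "continuous_on (- K) (\<lambda>z. 0 :: 'b)" by simp
    then show "continuous_on (- K) (\<lambda>z. if z \<in> D then u z else 0)"
      by (rule continuous_on_eq) (use assms(5) in auto)
  qed (use assms compact_imp_closed in auto)
  moreover have "D \<union> - K = UNIV" using assms(3) by auto
  ultimately show ?thesis by simp
qed

text \<open>The product \<open>f \<phi>\<close>, extended by 0, is again a test function; its
  \<open>dbar\<close> derivative is \<open>f d\<close> because \<open>f\<close> is
  holomorphic.\<close>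

lemma integral_holomorphic_dbar_zero:
  assumes D: "open D" and f: "f holomorphic_on D" and T: "test_fun D \<phi> a d"
  shows "(LINT z:D|lborel. f z * d z) = 0"
proof -
  obtain K where K: "compact K" "K \<subseteq> D" "\<And>z. z \<notin> K \<Longrightarrow> \<phi> z = 0" "\<And>z. z \<notin> K \<Longrightarrow> a z = 0" "\<And>z. z \<notin> K \<Longrightarrow> d z = 0"
    using test_funE[OF T] by metis
  note cont = test_fun_continuous[OF T]
  have cf: "continuous_on D f" "continuous_on D (deriv f)"
    using f D holomorphic_on_imp_continuous_on holomorphic_deriv by blast+
  have cD: "continuous_on D \<phi>" "continuous_on D a" "continuous_on D d"
    using cont by (auto intro: continuous_on_subset)
  define g where "g z = (if z \<in> D then f z * \<phi> z else 0)" for z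
  define a' where "a' z = (if z \<in> D then f z * a z + deriv f z * \<phi> z else 0)" for z
  define d' where "d' z = (if z \<in> D then f z * d z else 0)" for z
  have "(g has_derivative (\<lambda>h. a' z * h + d' z * cnj h)) (at z)" for z
  proof (cases "z \<in> D")
    case True
    have "(f has_derivative (\<lambda>h. deriv f z * h)) (at z)"
      using holomorphic_derivI[OF f D True] by (simp add: has_field_derivative_def)
    from has_derivative_mult[OF this, of \<phi> "\<lambda>h. a z * h + d z * cnj h"]
    have "((\<lambda>z. f z * \<phi> z) has_derivative (\<lambda>h. a' z * h + d' z * cnj h)) (at z)"
      using T True by (simp add: test_fun_def wirtinger_def a'_def d'_def algebra_simps)
    then show ?thesis
      by (rule has_derivative_transform_within_open[OF _ D True]) (simp add: g_def)
  next
    case False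
    then have "z \<in> - K" using K(2) by auto
    have "((\<lambda>z. 0) has_derivative (\<lambda>h. 0::complex)) (at z)" by simp
    then have "(g has_derivative (\<lambda>h. 0)) (at z)"
      by (rule has_derivative_transform_within_open[OF _ _ \<open>z \<in> - K\<close>])
         (use K(1,3) compact_imp_closed in \<open>auto simp: g_def\<close>)
    then show ?thesis using False by (simp add: a'_def d'_def)
  qed
  moreover have "continuous_on UNIV a'" "continuous_on UNIV d'"
    unfolding a'_def[abs_def] d'_def[abs_def] using K cf cD
    by (auto intro!: continuous_extend_zero[OF D K(1,2)] continuous_intros)
  ultimately have "wirtinger g a' d'" by (simp add: wirtinger_def)
  moreover have "\<forall>z. z \<notin> K \<longrightarrow> g z = 0" using K(3) by (simp add: g_def)
  ultimately have "test_fun D g a' d'" using K(1,2) unfolding test_fun_def by blast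
  then have "(\<integral>z. d' z \<partial>lborel) = 0" by (rule integral_dbar_zero)
  moreover have "(LINT z:D|lborel. f z * d z) = (\<integral>z. d' z \<partial>lborel)"
    unfolding set_lebesgue_integral_def by (rule Bochner_Integration.integral_cong) (auto simp: d'_def)
  ultimately show ?thesis by simp
qed

subsection \<open>The regularised Cauchy kernel\<close>

text \<open>With \<open>x = |z|^2\<close> and \<open>t = x / s^2\<close> this is the derivative in
  \<open>x\<close> of \<open>1 - (1 - t)^3\<close>, continued by 0 for \<open>t > 1\<close>. The
  choice makes a \<open>dbar\<close> primitive explicit.\<close>

definition moll :: "real \<Rightarrow> complex \<Rightarrow> real" where
  "moll s z = 3 / s\<^sup>2 * (max 0 (1 - (cmod z)\<^sup>2 / s\<^sup>2))\<^sup>2"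

text \<open>\<open>cnj z * cauchy_prof s |z|\<^sup>2\<close> equals \<open>1/z\<close> for \<open>|z| \<ge> s\<close> and is continued into the disc
  so that its derivative with respect to the conjugate variable is the mollifier \<open>moll s\<close>.\<close>

definition cauchy_prof :: "real \<Rightarrow> real \<Rightarrow> real" where
  "cauchy_prof s x = (if x \<le> s\<^sup>2 then (3 - 3 * (x / s\<^sup>2) + (x / s\<^sup>2)\<^sup>2) / s\<^sup>2 else 1 / x)"

definition cauchy_prof' :: "real \<Rightarrow> real \<Rightarrow> real" where
  "cauchy_prof' s x = (if x \<le> s\<^sup>2 then (2 * (x / s\<^sup>2) - 3) / (s\<^sup>2)\<^sup>2 else - 1 / x\<^sup>2)"

lemma DERIV_cauchy_prof:
  assumes "0 < s"
  shows "(cauchy_prof s has_real_derivative cauchy_prof' s x) (at x)"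
proof (cases "x < s\<^sup>2")
  case True
  have "((\<lambda>x. (3 - 3 * (x / s\<^sup>2) + (x / s\<^sup>2)\<^sup>2) / s\<^sup>2) has_real_derivative cauchy_prof' s x) (at x)"
    using True assms
    by (auto intro!: derivative_eq_intros simp: cauchy_prof'_def field_simps power2_eq_square)
  then show ?thesis
    by (rule has_field_derivative_transform_within_open[where S = "{..<s\<^sup>2}"])
       (use True in \<open>auto simp: cauchy_prof_def\<close>)
next
  case False
  then have x: "0 < x" "s\<^sup>2 \<le> x" using assms zero_less_power[of s 2] by linarith+
  have m: "max 0 (1 - x / s\<^sup>2) = 0" using x assms by simp
  \<comment> \<open>The formula with \<open>max 0\<close> agrees with the profile for all positive
    \<open>y\<close>, so it also differentiates across the junction \<open>y = s^2\<close>.\<close>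
  have "((\<lambda>y. 1 - y / s\<^sup>2) has_real_derivative - (1 / s\<^sup>2)) (at x)"
    using assms by (auto intro!: derivative_eq_intros simp: power2_eq_square power4_eq_xxxx)
  from DERIV_chain2[OF DERIV_pos_part_power[of 3] this]
  have "((\<lambda>y. (max 0 (1 - y / s\<^sup>2)) ^ 3) has_real_derivative 0) (at x)"
    using m by simp
  from DERIV_divide[OF DERIV_diff[OF DERIV_const[of 1] this] DERIV_ident]
  have "((\<lambda>y. (1 - (max 0 (1 - y / s\<^sup>2)) ^ 3) / y) has_real_derivative cauchy_prof' s x) (at x)"
    using x m by (auto simp: cauchy_prof'_def power2_eq_square field_simps)
  then show ?thesis
  proof (rule has_field_derivative_transform_within_open[where S = "{0<..}"])
    fix y :: real assume y: "y \<in> {0<..}"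
    show "(1 - (max 0 (1 - y / s\<^sup>2)) ^ 3) / y = cauchy_prof s y"
    proof (cases "y \<le> s\<^sup>2")
      case True
      then have "max 0 (1 - y / s\<^sup>2) = 1 - y / s\<^sup>2" using assms by (simp add: field_simps)
      moreover have "(1 - (1 - t) ^ 3) / (t * p) = (3 - 3 * t + t\<^sup>2) / p" if "0 < t" "0 < p" for t p :: real
        using that by (simp add: field_simps power2_eq_square power3_eq_cube)
      from this[of "y / s\<^sup>2" "s\<^sup>2"] have "(1 - (1 - y / s\<^sup>2) ^ 3) / y = (3 - 3 * (y / s\<^sup>2) + (y / s\<^sup>2)\<^sup>2) / s\<^sup>2"
        using y assms by simp
      ultimately show ?thesis using True by (simp add: cauchy_prof_def)
    next
      case False
      then have "max 0 (1 - y / s\<^sup>2) = 0" using assms by (simp add: field_simps)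
      then show ?thesis using False by (simp add: cauchy_prof_def)
    qed
  qed (use x in auto)
qed

lemma continuous_cauchy_prof':
  assumes "0 < s"
  shows "continuous_on UNIV (cauchy_prof' s)"
proof -
  have "continuous_on ({..s\<^sup>2} \<union> {s\<^sup>2..})
     (\<lambda>x. if x \<le> s\<^sup>2 then (2 * (x / s\<^sup>2) - 3) / (s\<^sup>2)\<^sup>2 else - 1 / x\<^sup>2)"
  proof (intro continuous_on_cases)
    show "continuous_on {s\<^sup>2..} (\<lambda>x. - 1 / x\<^sup>2)"
      using assms zero_less_power[of s 2] by (intro continuous_intros) auto
    show "\<forall>x. x \<in> {..s\<^sup>2} \<and> \<not> x \<le> s\<^sup>2 \<or> x \<in> {s\<^sup>2..} \<and> x \<le> s\<^sup>2 \<longrightarrow>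
        (2 * (x / s\<^sup>2) - 3) / (s\<^sup>2)\<^sup>2 = - 1 / x\<^sup>2"
      using assms by auto
  qed (use assms in \<open>auto intro!: continuous_intros\<close>)
  moreover have "{..s\<^sup>2} \<union> {s\<^sup>2..} = UNIV" by auto
  ultimately show ?thesis unfolding cauchy_prof'_def[abs_def] by simp
qed

text \<open>Let \<open>p\<close> be the profile and \<open>x = |z|^2\<close>. The left side is the
  derivative of \<open>x * p\<close>, which equals \<open>1 - (1 - x / s^2)^3\<close> inside the
  disc and 1 outside; it is also the \<open>dbar\<close> derivative of
  \<open>cnj z * p\<close>.\<close>

lemma moll_eq:
  assumes "0 < s"
  shows "cauchy_prof s ((cmod z)\<^sup>2) + (cmod z)\<^sup>2 * cauchy_prof' s ((cmod z)\<^sup>2) = moll s z"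
proof (cases "(cmod z)\<^sup>2 \<le> s\<^sup>2")
  case True
  then have "max 0 (1 - (cmod z)\<^sup>2 / s\<^sup>2) = 1 - (cmod z)\<^sup>2 / s\<^sup>2"
    using assms by (simp add: field_simps)
  moreover have "(3 - 3 * t + t\<^sup>2) / p + (t * p) * ((2 * t - 3) / p\<^sup>2) = 3 / p * (1 - t)\<^sup>2" if "0 < p" for t p :: real
    using that by (simp add: field_simps power2_eq_square)
  from this[of "s\<^sup>2" "(cmod z)\<^sup>2 / s\<^sup>2"] have
    "(3 - 3 * ((cmod z)\<^sup>2 / s\<^sup>2) + ((cmod z)\<^sup>2 / s\<^sup>2)\<^sup>2) / s\<^sup>2 + (cmod z)\<^sup>2 * ((2 * ((cmod z)\<^sup>2 / s\<^sup>2) - 3) / (s\<^sup>2)\<^sup>2)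
      = 3 / s\<^sup>2 * (1 - (cmod z)\<^sup>2 / s\<^sup>2)\<^sup>2"
    using assms by simp
  ultimately show ?thesis using True by (simp add: moll_def cauchy_prof_def cauchy_prof'_def)
next
  case False
  then have "max 0 (1 - (cmod z)\<^sup>2 / s\<^sup>2) = 0" "(cmod z)\<^sup>2 \<noteq> 0"
    using assms zero_less_power[of s 2] by (auto simp: field_simps)
  then show ?thesis using False by (simp add: moll_def cauchy_prof_def cauchy_prof'_def power2_eq_square)
qed

definition reg_cauchy :: "real \<Rightarrow> complex \<Rightarrow> complex" where
  "reg_cauchy s z = cnj z * of_real (cauchy_prof s ((cmod z)\<^sup>2))"

lemma wirtinger_reg_cauchy:
  assumes "0 < s"
  shows "\<exists>a. wirtinger (\<lambda>z. reg_cauchy s (z - \<zeta>)) a (\<lambda>z. of_real (moll s (z - \<zeta>)))"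
proof -
  define g where "g z = (2 * cauchy_prof' s ((cmod (z - \<zeta>))\<^sup>2)) *\<^sub>R (z - \<zeta>)" for z
  have "((\<lambda>z. cauchy_prof s ((cmod (z - \<zeta>))\<^sup>2)) has_derivative (\<lambda>h. g z \<bullet> h)) (at z)" for z
    using DERIV_compose_FDERIV[OF DERIV_cauchy_prof[OF assms] has_derivative_cmod_power2[of \<zeta> z]]
    by (simp add: g_def mult_ac)
  moreover have "continuous_on UNIV g"
    unfolding g_def[abs_def]
    by (intro continuous_intros continuous_on_compose2[OF continuous_cauchy_prof'[OF assms]]) auto
  ultimately have w: "wirtinger (\<lambda>z. of_real (cauchy_prof s ((cmod (z - \<zeta>))\<^sup>2))) (\<lambda>z. cnj (g z) / 2) (\<lambda>z. g z / 2)"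
    by (rule wirtinger_of_real)
  have "cnj (z - \<zeta>) * (g z / 2) + 1 * of_real (cauchy_prof s ((cmod (z - \<zeta>))\<^sup>2)) = of_real (moll s (z - \<zeta>))" for z
  proof -
    have "cnj (z - \<zeta>) * (g z / 2) = of_real (cauchy_prof' s ((cmod (z - \<zeta>))\<^sup>2)) * ((z - \<zeta>) * cnj (z - \<zeta>))"
      by (simp add: g_def scaleR_conv_of_real mult_ac)
    also have "(z - \<zeta>) * cnj (z - \<zeta>) = of_real ((cmod (z - \<zeta>))\<^sup>2)"
      by (rule complex_norm_square[symmetric])
    finally show ?thesis
      by (simp add: moll_eq[OF assms, symmetric] add.commute mult.commute)
  qed
  then have "(\<lambda>z. cnj (z - \<zeta>) * (g z / 2) + 1 * of_real (cauchy_prof s ((cmod (z - \<zeta>))\<^sup>2)))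
      = (\<lambda>z. of_real (moll s (z - \<zeta>)))" by (rule ext)
  with wirtinger_mult[OF wirtinger_cnj[of \<zeta>] w] show ?thesis
    unfolding reg_cauchy_def by auto
qed

lemma reg_cauchy_outside:
  assumes "0 < s" "s \<le> cmod z"
  shows "reg_cauchy s z = 1 / z"
proof -
  have z: "0 < cmod z" using assms by linarith
  have "s\<^sup>2 \<le> (cmod z)\<^sup>2" using assms by (intro power_mono) auto
  then have "cauchy_prof s ((cmod z)\<^sup>2) = 1 / (cmod z)\<^sup>2"
    using assms by (auto simp: cauchy_prof_def)
  then have "reg_cauchy s z = cnj z / of_real ((cmod z)\<^sup>2)"
    by (simp add: reg_cauchy_def)
  also have "\<dots> = 1 / z"
    unfolding complex_norm_square using z by simp
  finally show ?thesis .
qed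

lemma moll_nonneg: "0 \<le> moll s z"
  by (simp add: moll_def)

lemma moll_outside:
  assumes "0 < s" "s \<le> cmod z"
  shows "moll s z = 0"
proof -
  have "s\<^sup>2 \<le> (cmod z)\<^sup>2" using assms by (intro power_mono) auto
  then show ?thesis using assms by (simp add: moll_def)
qed

lemma continuous_moll [continuous_intros]:
  "continuous_on A u \<Longrightarrow> continuous_on A (\<lambda>z. moll s (u z))"
  unfolding moll_def by (cases "s = 0") (auto intro!: continuous_intros)

lemma moll_measurable [measurable]: "moll s \<in> borel_measurable borel"
  by (intro borel_measurable_continuous_onI continuous_intros)

lemma moll_minus: "moll s (- z) = moll s z"
  by (simp add: moll_def)

text \<open>The \<open>dbar\<close> derivative of the plateau
  \<open>smooth_cap (bump a \<rho>)\<close>, supported between the radii \<rho> and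
  \<open>2 * \<rho>\<close>.\<close>

definition plateau_dbar :: "complex \<Rightarrow> real \<Rightarrow> complex \<Rightarrow> complex" where
  "plateau_dbar a \<rho> z = ((2 * max 0 (1 - bump a \<rho> z)) *\<^sub>R bump_grad a \<rho> z) / 2"

lemma test_fun_plateau:
  assumes "0 < \<rho>" "cball a (2 * \<rho>) \<subseteq> U"
  shows "test_fun U (\<lambda>z. of_real (smooth_cap (bump a \<rho> z))) (\<lambda>z. cnj (plateau_dbar a \<rho> z)) (plateau_dbar a \<rho>)"
proof -
  have "wirtinger (\<lambda>z. of_real (smooth_cap (bump a \<rho> z)))
      (\<lambda>z. cnj ((2 * max 0 (1 - bump a \<rho> z)) *\<^sub>R bump_grad a \<rho> z) / 2)
      (\<lambda>z. ((2 * max 0 (1 - bump a \<rho> z)) *\<^sub>R bump_grad a \<rho> z) / 2)"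
    by (intro wirtinger_of_real smooth_cap_has_derivative bump_has_derivative)
       (auto intro!: continuous_intros)
  then have "wirtinger (\<lambda>z. of_real (smooth_cap (bump a \<rho> z))) (\<lambda>z. cnj (plateau_dbar a \<rho> z)) (plateau_dbar a \<rho>)"
    unfolding plateau_dbar_def[abs_def] by simp
  moreover have "of_real (smooth_cap (bump a \<rho> z)) = (0::complex)" if "z \<notin> cball a (2 * \<rho>)" for z
    using bump_outside(1)[OF assms(1), of z a] that
    by (simp add: dist_norm norm_minus_commute smooth_cap_def)
  ultimately show ?thesis
    unfolding test_fun_def using assms(2) compact_cball by blast
qed

lemma plateau_dbar_inside:
  assumes "0 < \<rho>" "cmod (z - a) \<le> \<rho>"
  shows "plateau_dbar a \<rho> z = 0"
  using bump_ge_1[OF assms] by (simp add: plateau_dbar_def)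

text \<open>The second term does not depend on \<open>s\<close> and is holomorphic in \<open>\<zeta>\<close>; this is why the same test function
  yields the mean value property and the holomorphy of weak limits.\<close>

lemma cauchy_test_fun:
  assumes "0 < s" "s \<le> \<rho> / 2" "cmod (\<zeta> - a) \<le> \<rho> / 2" "cball a (2 * \<rho>) \<subseteq> U"
  shows "\<exists>\<phi> a'. test_fun U \<phi> a' (\<lambda>z. of_real (moll s (z - \<zeta>)) + plateau_dbar a \<rho> z / (z - \<zeta>))"
proof -
  have \<rho>: "0 < \<rho>" using assms by linarith
  obtain a' where w: "wirtinger (\<lambda>z. reg_cauchy s (z - \<zeta>)) a' (\<lambda>z. of_real (moll s (z - \<zeta>)))"
    using wirtinger_reg_cauchy[OF assms(1)] by blast
  have "of_real (smooth_cap (bump a \<rho> z)) * of_real (moll s (z - \<zeta>)) + plateau_dbar a \<rho> z * reg_cauchy s (z - \<zeta>)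
      = of_real (moll s (z - \<zeta>)) + plateau_dbar a \<rho> z / (z - \<zeta>)" for z
  proof (cases "cmod (z - a) \<le> \<rho>")
    case True
    then show ?thesis
      using plateau_dbar_inside[OF \<rho> True] smooth_cap_ge_1[OF bump_ge_1[OF \<rho> True]] by simp
  next
    case False
    have "cmod (z - a) \<le> cmod (z - \<zeta>) + cmod (\<zeta> - a)"
      using norm_triangle_ineq[of "z - \<zeta>" "\<zeta> - a"] by simp
    then have "s \<le> cmod (z - \<zeta>)" using False assms by linarith
    then show ?thesis
      using moll_outside[OF assms(1)] reg_cauchy_outside[OF assms(1)] by simp
  qed
  then have "(\<lambda>z. of_real (smooth_cap (bump a \<rho> z)) * of_real (moll s (z - \<zeta>)) + plateau_dbar a \<rho> z * reg_cauchy s (z - \<zeta>))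
      = (\<lambda>z. of_real (moll s (z - \<zeta>)) + plateau_dbar a \<rho> z / (z - \<zeta>))" by (rule ext)
  with test_fun_mult[OF test_fun_plateau[OF \<rho> assms(4)] w] show ?thesis by metis
qed

section \<open>Mean values against the mollifier\<close>

lemma set_integrable_compact_support:
  fixes u :: "complex \<Rightarrow> 'b::{banach, second_countable_topology}"
  assumes "open D" "compact K" "K \<subseteq> D" "continuous_on D u" "\<And>z. z \<in> D \<Longrightarrow> z \<notin> K \<Longrightarrow> u z = 0"
  shows "set_integrable lborel D u"
proof -
  have "integrable lborel (\<lambda>z. if z \<in> D then u z else 0)"
    using continuous_extend_zero[OF assms] assms(2)
    by (rule continuous_compact_support_integrable) (use assms(5) in auto)
  moreover have "(\<lambda>z. if z \<in> D then u z else 0) = (\<lambda>z. indicator D z *\<^sub>R u z)"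
    by (auto simp: indicator_def)
  ultimately show ?thesis by (simp add: set_integrable_def)
qed

text \<open>The common integral of all \<open>moll s\<close>; its value is pi.\<close>

definition moll_mass :: real where
  "moll_mass = (\<integral>z. moll 1 z \<partial>lborel)"

lemma moll_support: "0 < s \<Longrightarrow> z \<notin> cball \<zeta> s \<Longrightarrow> moll s (z - \<zeta>) = 0"
  by (intro moll_outside) (auto simp: dist_norm norm_minus_commute)

lemma integrable_moll: "0 < s \<Longrightarrow> integrable lborel (\<lambda>z. moll s (z - \<zeta>))"
  by (rule continuous_compact_support_integrable[of _ "cball \<zeta> s"])
     (auto intro!: continuous_intros moll_support)

lemma set_integrable_holomorphic_moll:
  assumes "open D" "f holomorphic_on D" "0 < s" "cball \<zeta> s \<subseteq> D"
  shows "set_integrable lborel D (\<lambda>z. f z * of_real (moll s (z - \<zeta>)))"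
  using assms(1) compact_cball assms(4)
proof (rule set_integrable_compact_support)
  show "continuous_on D (\<lambda>z. f z * of_real (moll s (z - \<zeta>)))"
    by (intro continuous_intros holomorphic_on_imp_continuous_on assms)
qed (use moll_support[OF assms(3)] in auto)

text \<open>Both sides are minus the integral of \<open>f\<close> against one plateau term that does
  not contain the radius. The disc of radius \<open>4 * s\<close>, here and in later lemmas, is the
  disc of radius \<open>2 * \<rho>\<close> of \<open>cauchy_test_fun\<close> with
  \<open>\<rho> = 2 * s\<close>.\<close>

lemma integral_moll_radius:
  assumes D: "open D" and f: "f holomorphic_on D" and s: "0 < s'" "s' \<le> s" "cball z (4 * s) \<subseteq> D"
  shows "(LINT \<xi>:D|lborel. f \<xi> * of_real (moll s' (\<xi> - z))) = (LINT \<xi>:D|lborel. f \<xi> * of_real (moll s (\<xi> - z)))"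
proof -
  let ?k = "\<lambda>\<xi>. plateau_dbar z (2 * s) \<xi> / (\<xi> - z)"
  have "(LINT \<xi>:D|lborel. f \<xi> * of_real (moll t (\<xi> - z))) = - (LINT \<xi>:D|lborel. f \<xi> * ?k \<xi>)"
    if t: "0 < t" "t \<le> s" for t
  proof -
    obtain \<phi> a where T: "test_fun D \<phi> a (\<lambda>\<xi>. of_real (moll t (\<xi> - z)) + ?k \<xi>)"
      using cauchy_test_fun[of t "2 * s" z z D] t s by auto
    have sub: "cball z t \<subseteq> D" using s t subset_cball[of t "4 * s" z] by auto
    note i1 = set_integrable_holomorphic_moll[OF D f t(1) sub]
    have i2: "set_integrable lborel D (\<lambda>\<xi>. f \<xi> * (of_real (moll t (\<xi> - z)) + ?k \<xi>))"
    proof -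
      obtain K where "compact K" "K \<subseteq> D" "\<And>\<xi>. \<xi> \<notin> K \<Longrightarrow> of_real (moll t (\<xi> - z)) + ?k \<xi> = 0"
        using test_funE[OF T] by metis
      then show ?thesis
        using test_fun_continuous(3)[OF T]
        by (intro set_integrable_compact_support[OF D, of K] continuous_on_mult
            holomorphic_on_imp_continuous_on[OF f]) (auto intro: continuous_on_subset)
    qed
    have "(LINT \<xi>:D|lborel. f \<xi> * ?k \<xi>) =
        (LINT \<xi>:D|lborel. f \<xi> * (of_real (moll t (\<xi> - z)) + ?k \<xi>) - f \<xi> * of_real (moll t (\<xi> - z)))"
      by (simp add: algebra_simps)
    also have "\<dots> = (LINT \<xi>:D|lborel. f \<xi> * (of_real (moll t (\<xi> - z)) + ?k \<xi>)) -
        (LINT \<xi>:D|lborel. f \<xi> * of_real (moll t (\<xi> - z)))"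
      by (rule set_integral_diff(2)[OF i2 i1])
    finally show ?thesis
      using integral_holomorphic_dbar_zero[OF D f T] by simp
  qed
  from this[OF s(1,2)] this[of s] show ?thesis using s by simp
qed

text \<open>Radius independence for the constant function 1 on the whole plane;
  \<open>max s 1\<close> is a common upper radius for \<open>s\<close> and 1.\<close>

lemma integral_moll:
  assumes "0 < s"
  shows "(\<integral>\<xi>. moll s (\<xi> - z) \<partial>lborel) = moll_mass"
proof -
  have shift: "(\<integral>\<xi>. moll t (\<xi> - z) \<partial>lborel) = (\<integral>\<xi>. moll t \<xi> \<partial>lborel)" if "0 < t" for t
    using integral_lborel_translate(2)[OF integrable_moll[OF that, of z], of z] by simp
  have real: "(\<integral>\<xi>. of_real (moll t \<xi>) \<partial>lborel) = (of_real (\<integral>\<xi>. moll t \<xi> \<partial>lborel) :: complex)" for t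
    by simp
  have "(\<integral>\<xi>. of_real (moll t \<xi>) \<partial>lborel :: complex) = (\<integral>\<xi>. of_real (moll (max s 1) \<xi>) \<partial>lborel)"
    if "0 < t" "t \<le> max s 1" for t
    using integral_moll_radius[of UNIV "\<lambda>_. 1" t "max s 1" 0] that
    by (simp add: set_lebesgue_integral_def)
  from this[of s] this[of 1] have "(\<integral>\<xi>. moll s \<xi> \<partial>lborel) = (\<integral>\<xi>. moll 1 \<xi> \<partial>lborel)"
    using assms by simp
  then show ?thesis using shift[OF assms] by (simp add: moll_mass_def)
qed

lemma moll_mass_pos: "0 < moll_mass"
proof -
  have "(\<integral>z. indicator (cball (0::complex) (1/2)) z \<partial>lborel) \<le> (\<integral>z. moll 1 z \<partial>lborel)"
  proof (rule integral_mono[OF integrable_indicator_cball])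
    show "integrable lborel (moll 1)" using integrable_moll[of 1 0] by simp
    show "indicator (cball 0 (1/2)) z \<le> moll 1 z" for z
    proof (cases "z \<in> cball 0 (1/2)")
      case True
      then have "(cmod z)\<^sup>2 \<le> (1/2)\<^sup>2" by (intro power_mono) auto
      then have "3/4 \<le> max 0 (1 - (cmod z)\<^sup>2)" by (simp add: power_divide)
      then have "(3/4)\<^sup>2 \<le> (max 0 (1 - (cmod z)\<^sup>2))\<^sup>2" by (rule power_mono) simp
      then show ?thesis using True by (simp add: moll_def power_divide)
    qed (simp add: moll_nonneg)
  qed
  moreover have "(\<integral>z. indicator (cball (0::complex) (1/2)) z \<partial>lborel) = pi * (1/2)\<^sup>2"
    by (simp add: measure_cball_complex)
  ultimately have "pi * (1/2)\<^sup>2 \<le> moll_mass" unfolding moll_mass_def by linarith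
  moreover have "0 < pi * (1/2)\<^sup>2" by simp
  ultimately show ?thesis by linarith
qed

text \<open>Since the integral does not change with the radius, the radius may shrink until
  continuity of \<open>f\<close> at \<open>z\<close> decides.\<close>

lemma moll_mean_value:
  assumes D: "open D" and f: "f holomorphic_on D" and s: "0 < s" "cball z (4 * s) \<subseteq> D"
  shows "(LINT \<xi>:D|lborel. f \<xi> * of_real (moll s (\<xi> - z))) = of_real moll_mass * f z"
proof -
  let ?I = "LINT \<xi>:D|lborel. f \<xi> * of_real (moll s (\<xi> - z))"
  have "cmod (?I - of_real moll_mass * f z) \<le> 0 + e" if e: "0 < e" for e
  proof -
    define e' where "e' = e / moll_mass"
    have e': "0 < e'" using e moll_mass_pos by (simp add: e'_def)
    have zD: "z \<in> D" using s by auto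
    have "continuous (at z) f"
      using holomorphic_on_imp_continuous_on[OF f] D zD continuous_on_eq_continuous_at by blast
    then obtain r where r: "0 < r" "\<And>\<xi>. dist \<xi> z < r \<Longrightarrow> dist (f \<xi>) (f z) < e'"
      using e' unfolding continuous_at_eps_delta by blast
    define t where "t = min s r"
    have t: "0 < t" "t \<le> s" "t \<le> r" using s r by (auto simp: t_def)
    have sub: "cball z t \<subseteq> D" using s t subset_cball[of t "4 * s" z] by auto
    note i1 = set_integrable_holomorphic_moll[OF D f t(1) sub]
    note i2 = set_integrable_holomorphic_moll[OF D holomorphic_on_const[of "f z"] t(1) sub]
    have "(LINT \<xi>:D|lborel. f z * of_real (moll t (\<xi> - z))) = (\<integral>\<xi>. f z * of_real (moll t (\<xi> - z)) \<partial>lborel)"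
      unfolding set_lebesgue_integral_def
    proof (rule Bochner_Integration.integral_cong[OF refl])
      fix \<xi>
      show "indicator D \<xi> *\<^sub>R (f z * of_real (moll t (\<xi> - z))) = f z * of_real (moll t (\<xi> - z))"
      proof -
        have "\<xi> \<in> D \<or> moll t (\<xi> - z) = 0"
          using moll_support[OF t(1), of \<xi> z] sub by blast
        then show ?thesis by auto
      qed
    qed
    also have "\<dots> = of_real moll_mass * f z"
      using integral_moll[OF t(1), of z] by simp
    finally have "?I - of_real moll_mass * f z =
        (LINT \<xi>:D|lborel. f \<xi> * of_real (moll t (\<xi> - z)) - f z * of_real (moll t (\<xi> - z)))"
      unfolding set_integral_diff(2)[OF i1 i2] integral_moll_radius[OF D f t(1,2) s(2)] by (simp only:)
    also have "cmod \<dots> \<le> (\<integral>\<xi>. e' * moll t (\<xi> - z) \<partial>lborel)"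
      unfolding set_lebesgue_integral_def
    proof (rule Bochner_Integration.integral_norm_bound_integral)
      show "integrable lborel (\<lambda>\<xi>. indicator D \<xi> *\<^sub>R (f \<xi> * of_real (moll t (\<xi> - z)) - f z * of_real (moll t (\<xi> - z))))"
        using set_integral_diff(1)[OF i1 i2] by (simp add: set_integrable_def)
      show "integrable lborel (\<lambda>\<xi>. e' * moll t (\<xi> - z))"
        by (intro integrable_mult_right integrable_moll t)
      fix \<xi>
      show "norm (indicator D \<xi> *\<^sub>R (f \<xi> * of_real (moll t (\<xi> - z)) - f z * of_real (moll t (\<xi> - z)))) \<le> e' * moll t (\<xi> - z)"
      proof (cases "dist \<xi> z < t")
        case True
        then have "cmod (f \<xi> - f z) \<le> e'"
          using r(2)[of \<xi>] t by (simp add: dist_norm)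
        moreover have "norm (indicator D \<xi> *\<^sub>R (f \<xi> * of_real (moll t (\<xi> - z)) - f z * of_real (moll t (\<xi> - z))))
            \<le> cmod (f \<xi> - f z) * moll t (\<xi> - z)"
          by (cases "\<xi> \<in> D") (simp_all add: moll_nonneg norm_mult flip: left_diff_distrib)
        ultimately show ?thesis
          using mult_right_mono[OF _ moll_nonneg] order_trans by blast
      next
        case False
        then have "moll t (\<xi> - z) = 0"
          using moll_outside[OF t(1), of "\<xi> - z"] by (simp add: dist_norm)
        then show ?thesis by simp
      qed
    qed
    also have "\<dots> = e"
      using integral_moll[OF t(1), of z] moll_mass_pos by (simp add: e'_def)
    finally show ?thesis by simp
  qed
  then have "cmod (?I - of_real moll_mass * f z) \<le> 0" by (rule field_le_epsilon)
  then show ?thesis by simp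
qed

subsection \<open>Square integrable functions\<close>

definition L2 :: "(complex \<Rightarrow> complex) \<Rightarrow> bool" where
  "L2 f \<longleftrightarrow> f \<in> borel_measurable borel \<and> integrable lborel (\<lambda>z. (cmod (f z))\<^sup>2)"

text \<open>The square of the norm, on functions and not on classes modulo null sets.\<close>

definition nrm2 :: "(complex \<Rightarrow> complex) \<Rightarrow> real" where
  "nrm2 f = (\<integral>z. (cmod (f z))\<^sup>2 \<partial>lborel)"

lemma nrm2_nonneg: "0 \<le> nrm2 f"
  by (simp add: nrm2_def)

lemma L2_bound:
  assumes "L2 g" "f \<in> borel_measurable borel" "\<And>z. cmod (f z) \<le> C * cmod (g z)"
  shows "L2 f" "nrm2 f \<le> C\<^sup>2 * nrm2 g"
proof -
  have le: "(cmod (f z))\<^sup>2 \<le> C\<^sup>2 * (cmod (g z))\<^sup>2" for z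
    using power_mono[OF assms(3)[of z], of 2] by (simp add: power_mult_distrib)
  have i: "integrable lborel (\<lambda>z. C\<^sup>2 * (cmod (g z))\<^sup>2)"
    using assms(1) by (simp add: L2_def)
  have i': "integrable lborel (\<lambda>z. (cmod (f z))\<^sup>2)"
    by (rule Bochner_Integration.integrable_bound[OF i]) (use assms(2) le in \<open>auto simp: abs_mult\<close>)
  then show "L2 f" using assms(2) by (simp add: L2_def)
  show "nrm2 f \<le> C\<^sup>2 * nrm2 g"
    unfolding nrm2_def using integral_mono[OF i' i le] by simp
qed

lemma L2_add:
  assumes "L2 f" "L2 g"
  shows "L2 (\<lambda>z. f z + g z)"
proof -
  have [measurable]: "f \<in> borel_measurable borel" "g \<in> borel_measurable borel"
    using assms by (auto simp: L2_def)
  have i: "integrable lborel (\<lambda>z. 2 * (cmod (f z))\<^sup>2 + 2 * (cmod (g z))\<^sup>2)"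
    using assms by (auto simp: L2_def)
  have "(cmod (f z + g z))\<^sup>2 \<le> 2 * (cmod (f z))\<^sup>2 + 2 * (cmod (g z))\<^sup>2" for z
  proof -
    have "(cmod (f z + g z))\<^sup>2 \<le> (cmod (f z) + cmod (g z))\<^sup>2"
      by (intro power_mono norm_triangle_ineq) auto
    also have "\<dots> \<le> 2 * (cmod (f z))\<^sup>2 + 2 * (cmod (g z))\<^sup>2"
      using zero_le_power2[of "cmod (f z) - cmod (g z)"] by (simp add: power2_eq_square algebra_simps)
    finally show ?thesis .
  qed
  then have "integrable lborel (\<lambda>z. (cmod (f z + g z))\<^sup>2)"
    by (intro Bochner_Integration.integrable_bound[OF i]) auto
  then show ?thesis by (simp add: L2_def)
qed

lemma L2_cmult: "L2 f \<Longrightarrow> L2 (\<lambda>z. c * f z)"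
  by (auto simp: L2_def norm_mult power_mult_distrib)

lemma L2_cnj: "L2 f \<Longrightarrow> L2 (\<lambda>z. cnj (f z))"
  unfolding L2_def
  by (auto intro!: borel_measurable_continuous_on[of cnj] continuous_intros)

lemma L2_diff:
  assumes "L2 f" "L2 g"
  shows "L2 (\<lambda>z. f z - g z)"
  using L2_add[OF assms(1) L2_cmult[OF assms(2), of "-1"]] by simp

lemma L2_integrable_mult:
  assumes "L2 f" "L2 g"
  shows "integrable lborel (\<lambda>z. f z * g z)"
proof -
  have [measurable]: "f \<in> borel_measurable borel" "g \<in> borel_measurable borel"
    using assms by (auto simp: L2_def)
  have i: "integrable lborel (\<lambda>z. (cmod (f z))\<^sup>2 + (cmod (g z))\<^sup>2)"
    using assms by (auto simp: L2_def)
  have "cmod (f z * g z) \<le> (cmod (f z))\<^sup>2 + (cmod (g z))\<^sup>2" for z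
    using sum_squares_bound[of "cmod (f z)" "cmod (g z)"]
      mult_nonneg_nonneg[OF norm_ge_zero[of "f z"] norm_ge_zero[of "g z"]]
    by (simp only: norm_mult)
  then show ?thesis
    by (intro Bochner_Integration.integrable_bound[OF i]) auto
qed

lemma L2_Cauchy_Schwarz:
  assumes "L2 f" "L2 g"
  shows "cmod (\<integral>z. f z * g z \<partial>lborel) \<le> sqrt (nrm2 f) * sqrt (nrm2 g)"
proof -
  have [measurable]: "f \<in> borel_measurable borel" "g \<in> borel_measurable borel"
    using assms by (auto simp: L2_def)
  have i: "integrable lborel (\<lambda>z. cmod (f z) * cmod (g z))"
    using integrable_norm[OF L2_integrable_mult[OF assms]] by (simp add: norm_mult)
  define I where "I = (\<integral>z. cmod (f z) * cmod (g z) \<partial>lborel)"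
  have I0: "0 \<le> I" unfolding I_def by simp
  have sq: "(\<integral>\<^sup>+ z. (ennreal (cmod (h z)))\<^sup>2 \<partial>lborel) = ennreal (nrm2 h)" if "L2 h" for h
    using that unfolding nrm2_def L2_def
    by (subst nn_integral_eq_integral[symmetric]) (auto simp: ennreal_power)
  have "(ennreal I)\<^sup>2 = (\<integral>\<^sup>+ z. ennreal (cmod (f z)) * ennreal (cmod (g z)) \<partial>lborel)\<^sup>2"
    unfolding I_def using i by (subst nn_integral_eq_integral[symmetric]) (auto simp: ennreal_mult)
  also have "\<dots> \<le> (\<integral>\<^sup>+ z. (ennreal (cmod (f z)))\<^sup>2 \<partial>lborel) * (\<integral>\<^sup>+ z. (ennreal (cmod (g z)))\<^sup>2 \<partial>lborel)"
    by (rule Cauchy_Schwarz_nn_integral) auto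
  also have "\<dots> = ennreal (nrm2 f * nrm2 g)"
    using assms by (simp add: sq ennreal_mult nrm2_nonneg)
  finally have "I\<^sup>2 \<le> nrm2 f * nrm2 g"
    using I0 by (simp add: ennreal_power nrm2_nonneg)
  then have "I \<le> sqrt (nrm2 f * nrm2 g)"
    by (rule real_le_rsqrt)
  moreover have "cmod (\<integral>z. f z * g z \<partial>lborel) \<le> I"
    unfolding I_def using integral_norm_bound[of lborel "\<lambda>z. f z * g z"] by (simp add: norm_mult)
  ultimately show ?thesis by (simp add: real_sqrt_mult)
qed

lemma L2_continuous_compact:
  assumes "continuous_on UNIV f" "compact K" "\<And>z. z \<notin> K \<Longrightarrow> f z = 0"
  shows "L2 f"
  unfolding L2_def
proof
  show "f \<in> borel_measurable borel" using assms(1) by (rule borel_measurable_continuous_onI)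
  show "integrable lborel (\<lambda>z. (cmod (f z))\<^sup>2)"
    by (rule continuous_compact_support_integrable[OF _ assms(2)])
       (use assms in \<open>auto intro!: continuous_intros\<close>)
qed

lemma L2_test_fun: "test_fun U \<phi> a d \<Longrightarrow> L2 d"
  using test_funE[of U \<phi> a d] test_fun_continuous(3) L2_continuous_compact by metis

lemma L2_moll: "0 < s \<Longrightarrow> L2 (\<lambda>z. of_real (moll s (z - \<zeta>)))"
  by (rule L2_continuous_compact[of _ "cball \<zeta> s"]) (auto intro!: continuous_intros moll_support)

subsection \<open>Convolution with the mollifier\<close>

text \<open>Not normalised: as the radius tends to 0 the limit is \<open>moll_mass\<close> times the
  function.\<close>

definition mollify :: "real \<Rightarrow> (complex \<Rightarrow> complex) \<Rightarrow> complex \<Rightarrow> complex" where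
  "mollify s u \<zeta> = (\<integral>\<xi>. u \<xi> * of_real (moll s (\<xi> - \<zeta>)) \<partial>lborel)"

lemma mollify_diff:
  assumes "L2 u" "L2 v" "0 < s"
  shows "mollify s (\<lambda>\<xi>. u \<xi> - v \<xi>) \<zeta> = mollify s u \<zeta> - mollify s v \<zeta>"
  unfolding mollify_def left_diff_distrib
  by (intro Bochner_Integration.integral_diff L2_integrable_mult assms L2_moll)

lemma mollify_measurable [measurable]:
  assumes "L2 u"
  shows "mollify s u \<in> borel_measurable borel"
proof -
  have [measurable]: "u \<in> borel_measurable borel" using assms by (simp add: L2_def)
  have "(\<lambda>(\<zeta>, \<xi>). u \<xi> * of_real (moll s (\<xi> - \<zeta>))) \<in> borel_measurable (borel \<Otimes>\<^sub>M lborel)"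
    by measurable
  then have "(\<lambda>\<zeta>. \<integral>\<xi>. u \<xi> * of_real (moll s (\<xi> - \<zeta>)) \<partial>lborel) \<in> borel_measurable borel"
    by (rule lborel.borel_measurable_lebesgue_integral)
  then show ?thesis unfolding mollify_def[abs_def] .
qed

lemma nn_integral_moll: "0 < s \<Longrightarrow> (\<integral>\<^sup>+ \<xi>. ennreal (moll s (\<xi> - \<zeta>)) \<partial>lborel) = ennreal moll_mass"
  using nn_integral_eq_integral[OF integrable_moll, of s \<zeta>] integral_moll[of s \<zeta>] by (simp add: moll_nonneg)

text \<open>Young's inequality: write the kernel as a product of square roots, apply Cauchy-Schwarz,
  and exchange the integrals. The kernel has mass \<open>moll_mass\<close> in either
  variable.\<close>

lemma nn_integral_mollify_le:
  assumes "L2 u" "0 < s"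
  shows "(\<integral>\<^sup>+ \<zeta>. ennreal ((cmod (mollify s u \<zeta>))\<^sup>2) \<partial>lborel) \<le> ennreal (moll_mass\<^sup>2 * nrm2 u)"
proof -
  have [measurable]: "u \<in> borel_measurable borel" using assms by (simp add: L2_def)
  define m where "m \<xi> \<zeta> = moll s (\<xi> - \<zeta>)" for \<xi> \<zeta>
  have m0: "0 \<le> m \<xi> \<zeta>" for \<xi> \<zeta> by (simp add: m_def moll_nonneg)
  have pt: "ennreal ((cmod (mollify s u \<zeta>))\<^sup>2) \<le>
      ennreal moll_mass * (\<integral>\<^sup>+ \<xi>. ennreal ((cmod (u \<xi>))\<^sup>2 * m \<xi> \<zeta>) \<partial>lborel)" for \<zeta>
  proof -
    have [measurable]: "(\<lambda>\<xi>. m \<xi> \<zeta>) \<in> borel_measurable borel" unfolding m_def by measurable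
    have "ennreal (cmod (mollify s u \<zeta>)) \<le> (\<integral>\<^sup>+ \<xi>. norm (u \<xi> * of_real (m \<xi> \<zeta>)) \<partial>lborel)"
      unfolding mollify_def m_def
      by (rule integral_norm_bound_ennreal) (intro L2_integrable_mult assms L2_moll)
    also have "\<dots> = (\<integral>\<^sup>+ \<xi>. ennreal (cmod (u \<xi>) * sqrt (m \<xi> \<zeta>)) * ennreal (sqrt (m \<xi> \<zeta>)) \<partial>lborel)"
      by (intro nn_integral_cong) (simp add: norm_mult m0 mult.assoc flip: ennreal_mult)
    finally have "(ennreal (cmod (mollify s u \<zeta>)))\<^sup>2 \<le>
        (\<integral>\<^sup>+ \<xi>. ennreal (cmod (u \<xi>) * sqrt (m \<xi> \<zeta>)) * ennreal (sqrt (m \<xi> \<zeta>)) \<partial>lborel)\<^sup>2"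
      by (intro power_mono) auto
    also have "\<dots> \<le> (\<integral>\<^sup>+ \<xi>. (ennreal (cmod (u \<xi>) * sqrt (m \<xi> \<zeta>)))\<^sup>2 \<partial>lborel) * (\<integral>\<^sup>+ \<xi>. (ennreal (sqrt (m \<xi> \<zeta>)))\<^sup>2 \<partial>lborel)"
      by (rule Cauchy_Schwarz_nn_integral) auto
    also have "\<dots> = (\<integral>\<^sup>+ \<xi>. ennreal ((cmod (u \<xi>))\<^sup>2 * m \<xi> \<zeta>) \<partial>lborel) * ennreal moll_mass"
      using nn_integral_moll[OF assms(2), of \<zeta>]
      by (simp add: ennreal_power power_mult_distrib m0) (simp add: m_def)
    finally show ?thesis by (simp add: ennreal_power mult.commute)
  qed
  have [measurable]: "(\<lambda>(\<zeta>, \<xi>). ennreal ((cmod (u \<xi>))\<^sup>2 * m \<xi> \<zeta>)) \<in> borel_measurable (lborel \<Otimes>\<^sub>M lborel)"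
    unfolding m_def by measurable
  have "(\<integral>\<^sup>+ \<zeta>. ennreal ((cmod (mollify s u \<zeta>))\<^sup>2) \<partial>lborel) \<le>
      (\<integral>\<^sup>+ \<zeta>. ennreal moll_mass * (\<integral>\<^sup>+ \<xi>. ennreal ((cmod (u \<xi>))\<^sup>2 * m \<xi> \<zeta>) \<partial>lborel) \<partial>lborel)"
    by (intro nn_integral_mono pt)
  also have "\<dots> = ennreal moll_mass * (\<integral>\<^sup>+ \<zeta>. \<integral>\<^sup>+ \<xi>. ennreal ((cmod (u \<xi>))\<^sup>2 * m \<xi> \<zeta>) \<partial>lborel \<partial>lborel)"
    by (rule nn_integral_cmult) measurable
  also have "(\<integral>\<^sup>+ \<zeta>. \<integral>\<^sup>+ \<xi>. ennreal ((cmod (u \<xi>))\<^sup>2 * m \<xi> \<zeta>) \<partial>lborel \<partial>lborel) =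
      (\<integral>\<^sup>+ \<xi>. \<integral>\<^sup>+ \<zeta>. ennreal ((cmod (u \<xi>))\<^sup>2 * m \<xi> \<zeta>) \<partial>lborel \<partial>lborel)"
    by (rule lborel_pair.Fubini') measurable
  also have "\<dots> = (\<integral>\<^sup>+ \<xi>. ennreal ((cmod (u \<xi>))\<^sup>2) * ennreal moll_mass \<partial>lborel)"
  proof (rule nn_integral_cong)
    fix \<xi>
    have "(\<integral>\<^sup>+ \<zeta>. ennreal ((cmod (u \<xi>))\<^sup>2 * m \<xi> \<zeta>) \<partial>lborel) = ennreal ((cmod (u \<xi>))\<^sup>2) * (\<integral>\<^sup>+ \<zeta>. ennreal (m \<xi> \<zeta>) \<partial>lborel)"
      unfolding m_def by (subst nn_integral_cmult[symmetric]) (auto simp: ennreal_mult moll_nonneg)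
    also have "(\<integral>\<^sup>+ \<zeta>. ennreal (m \<xi> \<zeta>) \<partial>lborel) = ennreal moll_mass"
    proof -
      have "m \<xi> \<zeta> = moll s (\<zeta> - \<xi>)" for \<zeta>
        unfolding m_def using moll_minus[of s "\<zeta> - \<xi>"] by simp
      then show ?thesis using nn_integral_moll[OF assms(2), of \<xi>] by simp
    qed
    finally show "(\<integral>\<^sup>+ \<zeta>. ennreal ((cmod (u \<xi>))\<^sup>2 * m \<xi> \<zeta>) \<partial>lborel) = ennreal ((cmod (u \<xi>))\<^sup>2) * ennreal moll_mass" .
  qed
  also have "\<dots> = (\<integral>\<^sup>+ \<xi>. ennreal ((cmod (u \<xi>))\<^sup>2) \<partial>lborel) * ennreal moll_mass"
    by (rule nn_integral_multc) measurable
  also have "(\<integral>\<^sup>+ \<xi>. ennreal ((cmod (u \<xi>))\<^sup>2) \<partial>lborel) = ennreal (nrm2 u)"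
    unfolding nrm2_def by (rule nn_integral_eq_integral) (use assms in \<open>auto simp: L2_def\<close>)
  finally show ?thesis
    using moll_mass_pos by (simp add: ennreal_mult[symmetric] nrm2_nonneg power2_eq_square mult_ac)
qed

lemma mollify_tendsto:
  assumes "continuous_on UNIV u" "L2 u" "\<And>n. 0 < s n" "s \<longlonglongrightarrow> 0"
  shows "(\<lambda>n. mollify (s n) u \<zeta>) \<longlonglongrightarrow> of_real moll_mass * u \<zeta>"
proof (rule metric_LIMSEQ_I)
  fix e :: real assume e: "0 < e"
  define e' where "e' = e / (2 * moll_mass)"
  have e': "0 < e'" using e moll_mass_pos by (simp add: e'_def)
  have "continuous (at \<zeta>) u" using assms(1) by (simp add: continuous_on_eq_continuous_at)
  then obtain r where r: "0 < r" "\<And>\<xi>. dist \<xi> \<zeta> < r \<Longrightarrow> dist (u \<xi>) (u \<zeta>) < e'"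
    using e' unfolding continuous_at_eps_delta by blast
  obtain N where N: "\<And>n. N \<le> n \<Longrightarrow> s n < r"
    using order_tendstoD(2)[OF assms(4) r(1)] unfolding eventually_sequentially by blast
  show "\<exists>N. \<forall>n\<ge>N. dist (mollify (s n) u \<zeta>) (of_real moll_mass * u \<zeta>) < e"
  proof (intro exI[of _ N] allI impI)
    fix n assume n: "N \<le> n"
    have i1: "integrable lborel (\<lambda>\<xi>. u \<xi> * of_real (moll (s n) (\<xi> - \<zeta>)))"
      by (intro L2_integrable_mult assms L2_moll)
    have i2: "integrable lborel (\<lambda>\<xi>. u \<zeta> * of_real (moll (s n) (\<xi> - \<zeta>)))"
      by (intro integrable_mult_right integrable_of_real integrable_moll assms)
    have "of_real moll_mass * u \<zeta> = (\<integral>\<xi>. u \<zeta> * of_real (moll (s n) (\<xi> - \<zeta>)) \<partial>lborel)"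
      using integral_moll[OF assms(3), of n \<zeta>] by simp
    then have "mollify (s n) u \<zeta> - of_real moll_mass * u \<zeta> =
        (\<integral>\<xi>. u \<xi> * of_real (moll (s n) (\<xi> - \<zeta>)) - u \<zeta> * of_real (moll (s n) (\<xi> - \<zeta>)) \<partial>lborel)"
      unfolding mollify_def Bochner_Integration.integral_diff[OF i1 i2] by (simp only:)
    also have "cmod \<dots> \<le> (\<integral>\<xi>. e' * moll (s n) (\<xi> - \<zeta>) \<partial>lborel)"
    proof (rule Bochner_Integration.integral_norm_bound_integral)
      show "integrable lborel (\<lambda>\<xi>. u \<xi> * of_real (moll (s n) (\<xi> - \<zeta>)) - u \<zeta> * of_real (moll (s n) (\<xi> - \<zeta>)))"
        by (intro Bochner_Integration.integrable_diff i1 i2)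
      show "integrable lborel (\<lambda>\<xi>. e' * moll (s n) (\<xi> - \<zeta>))"
        by (intro integrable_mult_right integrable_moll assms)
      fix \<xi>
      show "norm (u \<xi> * of_real (moll (s n) (\<xi> - \<zeta>)) - u \<zeta> * of_real (moll (s n) (\<xi> - \<zeta>))) \<le> e' * moll (s n) (\<xi> - \<zeta>)"
      proof (cases "dist \<xi> \<zeta> < s n")
        case True
        then have "cmod (u \<xi> - u \<zeta>) \<le> e'"
          using r(2)[of \<xi>] N[OF n] by (simp add: dist_norm)
        then have "cmod (u \<xi> - u \<zeta>) * moll (s n) (\<xi> - \<zeta>) \<le> e' * moll (s n) (\<xi> - \<zeta>)"
          by (intro mult_right_mono moll_nonneg)
        then show ?thesis by (simp add: moll_nonneg norm_mult flip: left_diff_distrib)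
      next
        case False
        then have "moll (s n) (\<xi> - \<zeta>) = 0"
          using moll_outside[OF assms(3), of n "\<xi> - \<zeta>"] by (simp add: dist_norm)
        then show ?thesis by simp
      qed
    qed
    also have "\<dots> = e / 2"
      using integral_moll[OF assms(3), of n \<zeta>] moll_mass_pos by (simp add: e'_def)
    finally show "dist (mollify (s n) u \<zeta>) (of_real moll_mass * u \<zeta>) < e"
      using e by (simp add: dist_norm)
  qed
qed

subsection \<open>Holomorphic limits\<close>

text \<open>For \<zeta> in the small disc and \<open>m \<xi> \<noteq> 0\<close> the distance from
  \<xi> to \<zeta> is at least \<open>\<rho> / 2\<close>. There the Cauchy kernel coincides with
  \<open>reg_cauchy (\<rho> / 2)\<close>, which is continuous everywhere and so allows
  differentiation under the integral.\<close>

lemma holomorphic_cauchy_integral: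
  assumes m: "continuous_on UNIV m" "compact K" "\<And>z. z \<notin> K \<Longrightarrow> m z = 0"
    and \<rho>: "0 < \<rho>" and inside: "\<And>z. cmod (z - a) \<le> \<rho> \<Longrightarrow> m z = 0"
  shows "(\<lambda>\<zeta>. \<integral>\<xi>. m \<xi> / (\<xi> - \<zeta>) \<partial>lborel) holomorphic_on ball a (\<rho> / 2)"
proof -
  let ?r = "reg_cauchy (\<rho> / 2)"
  obtain l u where K: "K \<subseteq> cbox l u"
    using bounded_subset_cbox_symmetric[OF compact_imp_bounded[OF m(2)]] by blast
  have reg: "m \<xi> * (1 / (\<xi> - \<zeta>)) = m \<xi> * ?r (\<xi> - \<zeta>)" "m \<xi> * (1 / (\<xi> - \<zeta>))\<^sup>2 = m \<xi> * (?r (\<xi> - \<zeta>))\<^sup>2"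
    if "\<zeta> \<in> ball a (\<rho> / 2)" for \<xi> \<zeta>
  proof -
    have "m \<xi> = 0 \<or> ?r (\<xi> - \<zeta>) = 1 / (\<xi> - \<zeta>)"
    proof (cases "cmod (\<xi> - a) \<le> \<rho>")
      case False
      have "cmod (\<xi> - a) \<le> cmod (\<xi> - \<zeta>) + cmod (\<zeta> - a)"
        using norm_triangle_ineq[of "\<xi> - \<zeta>" "\<zeta> - a"] by simp
      then have "\<rho> / 2 \<le> cmod (\<xi> - \<zeta>)"
        using False that by (simp add: dist_norm norm_minus_commute)
      then show ?thesis using reg_cauchy_outside[of "\<rho> / 2"] \<rho> by simp
    qed (use inside in auto)
    then show "m \<xi> * (1 / (\<xi> - \<zeta>)) = m \<xi> * ?r (\<xi> - \<zeta>)" "m \<xi> * (1 / (\<xi> - \<zeta>))\<^sup>2 = m \<xi> * (?r (\<xi> - \<zeta>))\<^sup>2"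
      by auto
  qed
  have cr: "continuous_on UNIV ?r"
    using wirtinger_reg_cauchy[of "\<rho> / 2" 0] \<rho> wirtinger_continuous by auto
  have "(\<lambda>\<zeta>. integral (cbox l u) (\<lambda>\<xi>. m \<xi> * ?r (\<xi> - \<zeta>))) holomorphic_on ball a (\<rho> / 2)"
  proof (rule leibniz_rule_holomorphic[where fx = "\<lambda>\<zeta> \<xi>. m \<xi> * (?r (\<xi> - \<zeta>))\<^sup>2"])
    fix \<zeta> \<xi> assume \<zeta>: "\<zeta> \<in> ball a (\<rho> / 2)"
    have "((\<lambda>\<zeta>. m \<xi> * (1 / (\<xi> - \<zeta>))) has_field_derivative m \<xi> * (1 / (\<xi> - \<zeta>))\<^sup>2) (at \<zeta>)"
    proof (cases "m \<xi> = 0")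
      case False
      then have "\<not> cmod (\<xi> - a) \<le> \<rho>" using inside by auto
      then have "\<xi> \<noteq> \<zeta>" using \<zeta> \<rho> by (auto simp: dist_norm norm_minus_commute)
      then show ?thesis
        by (auto intro!: derivative_eq_intros simp: power2_eq_square)
    qed simp
    then have "((\<lambda>\<zeta>. m \<xi> * ?r (\<xi> - \<zeta>)) has_field_derivative m \<xi> * (1 / (\<xi> - \<zeta>))\<^sup>2) (at \<zeta>)"
      by (rule has_field_derivative_transform_within_open[where S = "ball a (\<rho> / 2)"])
         (use \<zeta> reg(1) in auto)
    then show "((\<lambda>\<zeta>. m \<xi> * ?r (\<xi> - \<zeta>)) has_field_derivative m \<xi> * (?r (\<xi> - \<zeta>))\<^sup>2) (at \<zeta> within ball a (\<rho> / 2))"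
      unfolding reg(2)[OF \<zeta>] by (rule has_field_derivative_at_within)
  next
    fix \<zeta>
    show "(\<lambda>\<xi>. m \<xi> * ?r (\<xi> - \<zeta>)) integrable_on cbox l u"
      by (intro integrable_continuous continuous_intros continuous_on_subset[OF m(1)]
          continuous_on_compose2[OF cr]) auto
    show "continuous_on (ball a (\<rho> / 2) \<times> cbox l u) (\<lambda>(\<zeta>, \<xi>). m \<xi> * (?r (\<xi> - \<zeta>))\<^sup>2)"
      unfolding case_prod_beta
      by (intro continuous_intros continuous_on_compose2[OF m(1)] continuous_on_compose2[OF cr]) auto
  qed simp
  moreover have "integral (cbox l u) (\<lambda>\<xi>. m \<xi> * ?r (\<xi> - \<zeta>)) = (\<integral>\<xi>. m \<xi> / (\<xi> - \<zeta>) \<partial>lborel)"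
    if "\<zeta> \<in> ball a (\<rho> / 2)" for \<zeta>
  proof -
    have c: "continuous_on UNIV (\<lambda>\<xi>. m \<xi> * ?r (\<xi> - \<zeta>))"
      by (intro continuous_intros m continuous_on_compose2[OF cr]) auto
    have "(\<integral>\<xi>. m \<xi> / (\<xi> - \<zeta>) \<partial>lborel) = (\<integral>\<xi>. m \<xi> * ?r (\<xi> - \<zeta>) \<partial>lborel)"
      using reg(1)[OF that] by simp
    also have "\<dots> = integral UNIV (\<lambda>\<xi>. m \<xi> * ?r (\<xi> - \<zeta>))"
      by (rule integral_lborel[symmetric], rule continuous_compact_support_integrable[OF c m(2)])
         (simp add: m(3))
    also have "\<dots> = integral UNIV (\<lambda>\<xi>. if \<xi> \<in> cbox l u then m \<xi> * ?r (\<xi> - \<zeta>) else 0)"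
      by (rule integral_cong) (use K m(3) in auto)
    also have "\<dots> = integral (cbox l u) (\<lambda>\<xi>. m \<xi> * ?r (\<xi> - \<zeta>))"
      by (rule integral_restrict_UNIV)
    finally show ?thesis ..
  qed
  ultimately show ?thesis by (rule holomorphic_transform)
qed

text \<open>Paired with the test function of \<open>cauchy_test_fun\<close>, the weak hypothesis
  says that \<open>mollify s (h j) + Q j\<close> tends to 0, where \<open>Q j\<close> is a Cauchy
  integral over the plateau's edge. The \<open>Q j\<close> are holomorphic and, by Cauchy-Schwarz,
  uniformly Cauchy; so the mollified functions converge to a holomorphic limit that does not depend
  on \<open>s\<close>.\<close>

lemma dbar_limit_local:
  fixes h :: "nat \<Rightarrow> complex \<Rightarrow> complex"
  assumes cont: "\<And>j. continuous_on UNIV (h j)"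
    and L: "\<And>j. L2 (h j)"
    and cauchy: "\<And>e. 0 < e \<Longrightarrow> \<exists>N. \<forall>i\<ge>N. \<forall>j\<ge>N. nrm2 (\<lambda>z. h i z - h j z) < e"
    and weak: "\<And>\<phi> a d. test_fun U \<phi> a d \<Longrightarrow> (\<lambda>j. \<integral>z. h j z * d z \<partial>lborel) \<longlonglongrightarrow> 0"
    and \<rho>: "0 < \<rho>" "cball a (2 * \<rho>) \<subseteq> U"
  obtains l where "l holomorphic_on ball a (\<rho> / 4)"
    "\<And>s \<zeta>. 0 < s \<Longrightarrow> s \<le> \<rho> / 2 \<Longrightarrow> \<zeta> \<in> cball a (\<rho> / 4) \<Longrightarrow> (\<lambda>j. mollify s (h j) \<zeta>) \<longlonglongrightarrow> l \<zeta>"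
proof -
  let ?p = "plateau_dbar a \<rho>"
  define Q where "Q j \<zeta> = (\<integral>\<xi>. h j \<xi> * ?p \<xi> / (\<xi> - \<zeta>) \<partial>lborel)" for j \<zeta>
  note T = test_fun_plateau[OF \<rho>]
  have Lp: "L2 ?p" by (rule L2_test_fun[OF T])
  have pin: "?p \<xi> = 0" if "cmod (\<xi> - a) \<le> \<rho>" for \<xi>
    by (rule plateau_dbar_inside[OF \<rho>(1) that])
  have kernel: "cmod (?p \<xi> / (\<xi> - \<zeta>)) \<le> 2 / \<rho> * cmod (?p \<xi>)" if "\<zeta> \<in> cball a (\<rho> / 4)" for \<xi> \<zeta>
  proof (cases "cmod (\<xi> - a) \<le> \<rho>")
    case False
    have "cmod (\<xi> - a) \<le> cmod (\<xi> - \<zeta>) + cmod (\<zeta> - a)"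
      using norm_triangle_ineq[of "\<xi> - \<zeta>" "\<zeta> - a"] by simp
    then have "\<rho> / 2 \<le> cmod (\<xi> - \<zeta>)"
      using False that \<rho>(1) by (simp add: dist_norm norm_minus_commute)
    moreover have "0 < \<rho> / 2" using \<rho>(1) by simp
    ultimately have "cmod (?p \<xi>) / cmod (\<xi> - \<zeta>) \<le> cmod (?p \<xi>) / (\<rho> / 2)"
      by (intro divide_left_mono mult_pos_pos norm_ge_zero) linarith+
    then show ?thesis by (simp add: norm_divide mult.commute)
  qed (simp add: pin)
  have kmeas: "(\<lambda>\<xi>. ?p \<xi> / (\<xi> - \<zeta>)) \<in> borel_measurable borel" for \<zeta>
    using Lp unfolding L2_def by (intro borel_measurable_divide borel_measurable_diff) auto
  have Lk: "L2 (\<lambda>\<xi>. ?p \<xi> / (\<xi> - \<zeta>))" "nrm2 (\<lambda>\<xi>. ?p \<xi> / (\<xi> - \<zeta>)) \<le> (2 / \<rho>)\<^sup>2 * nrm2 ?p"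
    if "\<zeta> \<in> cball a (\<rho> / 4)" for \<zeta>
    using L2_bound[OF Lp kmeas kernel[OF that]] by blast+
  have Qd: "cmod (Q i \<zeta> - Q j \<zeta>) \<le> sqrt (nrm2 (\<lambda>z. h i z - h j z)) * sqrt ((2 / \<rho>)\<^sup>2 * nrm2 ?p)"
    if "\<zeta> \<in> cball a (\<rho> / 4)" for i j \<zeta>
  proof -
    have "Q i \<zeta> - Q j \<zeta> = (\<integral>\<xi>. (h i \<xi> - h j \<xi>) * (?p \<xi> / (\<xi> - \<zeta>)) \<partial>lborel)"
      unfolding Q_def left_diff_distrib times_divide_eq_right[symmetric]
      by (rule Bochner_Integration.integral_diff[symmetric])
         (intro L2_integrable_mult L Lk that)+
    also have "cmod \<dots> \<le> sqrt (nrm2 (\<lambda>z. h i z - h j z)) * sqrt (nrm2 (\<lambda>\<xi>. ?p \<xi> / (\<xi> - \<zeta>)))"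
      by (intro L2_Cauchy_Schwarz L2_diff L Lk that)
    also have "\<dots> \<le> sqrt (nrm2 (\<lambda>z. h i z - h j z)) * sqrt ((2 / \<rho>)\<^sup>2 * nrm2 ?p)"
      by (intro mult_left_mono real_sqrt_le_mono Lk that) (simp add: nrm2_nonneg)
    finally show ?thesis .
  qed
  have "uniformly_Cauchy_on (cball a (\<rho> / 4)) Q"
  proof (rule uniformly_Cauchy_onI)
    fix e :: real assume e: "0 < e"
    define C where "C = sqrt ((2 / \<rho>)\<^sup>2 * nrm2 ?p) + 1"
    have C: "0 < C" unfolding C_def by (intro add_nonneg_pos) (auto simp: nrm2_nonneg)
    obtain N where N: "\<And>i j. N \<le> i \<Longrightarrow> N \<le> j \<Longrightarrow> nrm2 (\<lambda>z. h i z - h j z) < (e / C)\<^sup>2"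
      using cauchy[of "(e / C)\<^sup>2"] e C by auto
    show "\<exists>M. \<forall>x\<in>cball a (\<rho> / 4). \<forall>m\<ge>M. \<forall>n\<ge>M. dist (Q m x) (Q n x) < e"
    proof (intro exI[of _ N] ballI allI impI)
      fix \<zeta> i j assume \<zeta>: "\<zeta> \<in> cball a (\<rho> / 4)" and ij: "N \<le> i" "N \<le> j"
      have "sqrt (nrm2 (\<lambda>z. h i z - h j z)) < e / C"
        using real_sqrt_less_mono[OF N[OF ij]] e C by simp
      then have "sqrt (nrm2 (\<lambda>z. h i z - h j z)) * C < e"
        using C by (simp add: field_simps)
      moreover have "sqrt (nrm2 (\<lambda>z. h i z - h j z)) * sqrt ((2 / \<rho>)\<^sup>2 * nrm2 ?p) \<le> sqrt (nrm2 (\<lambda>z. h i z - h j z)) * C"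
        unfolding C_def by (intro mult_left_mono) (auto simp: nrm2_nonneg)
      ultimately show "dist (Q i \<zeta>) (Q j \<zeta>) < e"
        using Qd[OF \<zeta>, of i j] by (simp add: dist_norm)
    qed
  qed
  then obtain q where q: "uniform_limit (cball a (\<rho> / 4)) Q q sequentially"
    using Cauchy_uniformly_convergent uniformly_convergent_on_def by blast
  have hol: "Q j holomorphic_on ball a (\<rho> / 2)" for j
  proof -
    obtain K where K: "compact K" "\<And>z. z \<notin> K \<Longrightarrow> ?p z = 0" using test_funE[OF T] by metis
    show ?thesis
      unfolding Q_def[abs_def]
    proof (rule holomorphic_cauchy_integral[OF _ K(1) _ \<rho>(1)])
      show "continuous_on UNIV (\<lambda>\<xi>. h j \<xi> * ?p \<xi>)"
        by (intro continuous_intros cont test_fun_continuous(3)[OF T])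
    qed (auto simp: K(2) pin)
  qed
  have qhol: "q holomorphic_on ball a (\<rho> / 4)"
  proof (rule holomorphic_uniform_limit[OF _ q])
    have sub: "cball a (\<rho> / 4) \<subseteq> ball a (\<rho> / 2)" using \<rho>(1) by auto
    show "\<forall>\<^sub>F n in sequentially. continuous_on (cball a (\<rho> / 4)) (Q n) \<and> Q n holomorphic_on ball a (\<rho> / 4)"
      using holomorphic_on_subset[OF hol] sub ball_subset_cball
      by (intro always_eventually allI conjI holomorphic_on_imp_continuous_on) (blast intro: order_trans)+
  qed auto
  have "(\<lambda>j. mollify s (h j) \<zeta>) \<longlonglongrightarrow> - q \<zeta>"
    if s: "0 < s" "s \<le> \<rho> / 2" and \<zeta>: "\<zeta> \<in> cball a (\<rho> / 4)" for s \<zeta>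
  proof -
    have "cmod (\<zeta> - a) \<le> \<rho> / 2" using \<zeta> \<rho>(1) by (simp add: dist_norm norm_minus_commute)
    from cauchy_test_fun[OF s this \<rho>(2)] obtain \<phi> a'
      where "test_fun U \<phi> a' (\<lambda>z. of_real (moll s (z - \<zeta>)) + ?p z / (z - \<zeta>))" by blast
    from weak[OF this] have "(\<lambda>j. \<integral>z. h j z * (of_real (moll s (z - \<zeta>)) + ?p z / (z - \<zeta>)) \<partial>lborel) \<longlonglongrightarrow> 0" .
    moreover have "(\<integral>z. h j z * (of_real (moll s (z - \<zeta>)) + ?p z / (z - \<zeta>)) \<partial>lborel) = mollify s (h j) \<zeta> + Q j \<zeta>" for j
      unfolding mollify_def Q_def distrib_left times_divide_eq_right[symmetric]
      by (intro Bochner_Integration.integral_add L2_integrable_mult L Lk \<zeta> L2_moll s)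
    ultimately have "(\<lambda>j. mollify s (h j) \<zeta> + Q j \<zeta>) \<longlonglongrightarrow> 0" by simp
    moreover have "(\<lambda>j. Q j \<zeta>) \<longlonglongrightarrow> q \<zeta>" by (rule tendsto_uniform_limitI[OF q \<zeta>])
    ultimately have "(\<lambda>j. mollify s (h j) \<zeta> + Q j \<zeta> - Q j \<zeta>) \<longlonglongrightarrow> 0 - q \<zeta>" by (rule tendsto_diff)
    then show ?thesis by simp
  qed
  moreover have "(\<lambda>\<zeta>. - q \<zeta>) holomorphic_on ball a (\<rho> / 4)"
    using qhol by (intro holomorphic_intros)
  ultimately show thesis using that by blast
qed

text \<open>A version of Weyl's lemma for Cauchy sequences, which avoids the completeness of \<open>L\<^sup>2\<close>.\<close>

lemma dbar_limit_holomorphic: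
  fixes h :: "nat \<Rightarrow> complex \<Rightarrow> complex"
  assumes U: "open U"
    and cont: "\<And>j. continuous_on UNIV (h j)"
    and supp: "\<And>j. \<exists>K. compact K \<and> K \<subseteq> U \<and> (\<forall>z. z \<notin> K \<longrightarrow> h j z = 0)"
    and cauchy: "\<And>e. 0 < e \<Longrightarrow> \<exists>N. \<forall>i\<ge>N. \<forall>j\<ge>N. nrm2 (\<lambda>z. h i z - h j z) < e"
    and weak: "\<And>\<phi> a d. test_fun U \<phi> a d \<Longrightarrow> (\<lambda>j. \<integral>z. h j z * d z \<partial>lborel) \<longlonglongrightarrow> 0"
  obtains H where "H holomorphic_on U" "\<And>z. z \<notin> U \<Longrightarrow> H z = 0" "L2 H"
    "(\<lambda>j. nrm2 (\<lambda>z. h j z - H z)) \<longlonglongrightarrow> 0"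
proof -
  have L: "L2 (h j)" for j
    using supp[of j] L2_continuous_compact[OF cont[of j]] by metis
  have loc: "\<exists>l. l holomorphic_on ball a (\<rho> / 4) \<and>
      (\<forall>s \<zeta>. 0 < s \<longrightarrow> s \<le> \<rho> / 2 \<longrightarrow> \<zeta> \<in> cball a (\<rho> / 4) \<longrightarrow> (\<lambda>j. mollify s (h j) \<zeta>) \<longlonglongrightarrow> l \<zeta>)"
    if "0 < \<rho>" "cball a (2 * \<rho>) \<subseteq> U" for a \<rho>
    by (rule dbar_limit_local[where h = h and U = U and a = a and \<rho> = \<rho>])
       (use cont L cauchy weak that in auto)
  have "\<exists>l. \<forall>s>0. cball \<zeta> (4 * s) \<subseteq> U \<longrightarrow> (\<lambda>j. mollify s (h j) \<zeta>) \<longlonglongrightarrow> l" if "\<zeta> \<in> U" for \<zeta>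
  proof -
    have lim: "\<exists>l. \<forall>s. 0 < s \<and> s \<le> t \<longrightarrow> (\<lambda>j. mollify s (h j) \<zeta>) \<longlonglongrightarrow> l" if t: "0 < t" "cball \<zeta> (4 * t) \<subseteq> U" for t
    proof -
      obtain l where "\<And>s \<xi>. 0 < s \<Longrightarrow> s \<le> 2 * t / 2 \<Longrightarrow> \<xi> \<in> cball \<zeta> (2 * t / 4) \<Longrightarrow> (\<lambda>j. mollify s (h j) \<xi>) \<longlonglongrightarrow> l \<xi>"
        using loc[where \<rho> = "2 * t" and a = \<zeta>] t by force
      from this[of _ \<zeta>] show ?thesis using t by auto
    qed
    obtain t where t: "0 < t" "cball \<zeta> (4 * t) \<subseteq> U"
    proof -
      obtain r where "0 < r" "cball \<zeta> r \<subseteq> U" using U \<open>\<zeta> \<in> U\<close> open_contains_cball by blast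
      then show thesis using that[of "r / 4"] by simp
    qed
    from lim[OF t] obtain l where l: "\<And>s. 0 < s \<Longrightarrow> s \<le> t \<Longrightarrow> (\<lambda>j. mollify s (h j) \<zeta>) \<longlonglongrightarrow> l" by blast
    have "(\<lambda>j. mollify s (h j) \<zeta>) \<longlonglongrightarrow> l" if s: "0 < s" "cball \<zeta> (4 * s) \<subseteq> U" for s
    proof -
      obtain l' where l': "\<And>s'. 0 < s' \<Longrightarrow> s' \<le> s \<Longrightarrow> (\<lambda>j. mollify s' (h j) \<zeta>) \<longlonglongrightarrow> l'"
        using lim[OF s] by blast
      \<comment> \<open>The limits belonging to two radii agree because both are limits at the
        radius \<open>min s t\<close>.\<close>
      have "l = l'" using LIMSEQ_unique[OF l[of "min s t"] l'[of "min s t"]] s t by simp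
      then show ?thesis using l'[of s] s by simp
    qed
    then show ?thesis by blast
  qed
  then obtain M where M: "\<And>\<zeta> s. \<zeta> \<in> U \<Longrightarrow> 0 < s \<Longrightarrow> cball \<zeta> (4 * s) \<subseteq> U \<Longrightarrow> (\<lambda>j. mollify s (h j) \<zeta>) \<longlonglongrightarrow> M \<zeta>"
    by metis
  \<comment> \<open>Dividing by \<open>moll_mass\<close> normalises the mollifier; the value 0
    outside \<open>U\<close> matches the supports of the \<open>h j\<close>.\<close>
  define H where "H \<zeta> = (if \<zeta> \<in> U then M \<zeta> / of_real moll_mass else 0)" for \<zeta>
  have Hlim: "(\<lambda>j. mollify s (h j) \<zeta>) \<longlonglongrightarrow> of_real moll_mass * H \<zeta>"
    if "0 < s" "cball \<zeta> (4 * s) \<subseteq> U" for s \<zeta>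
  proof -
    have "\<zeta> \<in> U" using that by auto
    then show ?thesis using M[OF _ that] moll_mass_pos by (simp add: H_def)
  qed
  have Hhol: "H holomorphic_on U"
    unfolding holomorphic_on_def
  proof
    fix a assume a: "a \<in> U"
    obtain r where r: "0 < r" "cball a r \<subseteq> U" using U a open_contains_cball by blast
    define \<rho> where "\<rho> = r / 2"
    have \<rho>: "0 < \<rho>" "cball a (2 * \<rho>) \<subseteq> U" using r by (auto simp: \<rho>_def)
    obtain l where l: "l holomorphic_on ball a (\<rho> / 4)"
      "\<And>s \<zeta>. 0 < s \<Longrightarrow> s \<le> \<rho> / 2 \<Longrightarrow> \<zeta> \<in> cball a (\<rho> / 4) \<Longrightarrow> (\<lambda>j. mollify s (h j) \<zeta>) \<longlonglongrightarrow> l \<zeta>"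
      using loc[OF \<rho>] by blast
    have eq: "l \<zeta> / of_real moll_mass = H \<zeta>" if "\<zeta> \<in> ball a (\<rho> / 4)" for \<zeta>
    proof -
      have "cball \<zeta> (4 * (\<rho> / 8)) \<subseteq> cball a (2 * \<rho>)"
        using that \<rho> by (intro cball_subset_cball_iff[THEN iffD2]) (simp add: dist_commute)
      then have "(\<lambda>j. mollify (\<rho> / 8) (h j) \<zeta>) \<longlonglongrightarrow> of_real moll_mass * H \<zeta>"
        using \<rho> by (intro Hlim) auto
      moreover have "(\<lambda>j. mollify (\<rho> / 8) (h j) \<zeta>) \<longlonglongrightarrow> l \<zeta>"
        using \<rho> that by (intro l) auto
      ultimately show ?thesis using LIMSEQ_unique moll_mass_pos by fastforce
    qed
    have "(\<lambda>\<zeta>. l \<zeta> / of_real moll_mass) holomorphic_on ball a (\<rho> / 4)"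
      using l(1) moll_mass_pos by (intro holomorphic_intros) auto
    then have "H holomorphic_on ball a (\<rho> / 4)"
      using eq by (rule holomorphic_transform)
    then have "H field_differentiable at a"
      using \<rho>(1) by (intro holomorphic_on_imp_differentiable_at[of _ "ball a (\<rho> / 4)"]) auto
    then show "H field_differentiable at a within U"
      by (rule field_differentiable_at_within)
  qed
  have Hmeas [measurable]: "H \<in> borel_measurable borel"
  proof -
    have "(\<lambda>z. indicator U z *\<^sub>R H z) \<in> borel_measurable borel"
      using U holomorphic_on_imp_continuous_on[OF Hhol]
      by (intro borel_measurable_continuous_on_indicator) auto
    moreover have "(\<lambda>z. indicator U z *\<^sub>R H z) = H" by (auto simp: H_def indicator_def)
    ultimately show ?thesis by simp
  qed
  have off: "h j z = 0" if "z \<notin> U" for j z using supp[of j] that by auto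
  have [measurable]: "h j \<in> borel_measurable borel" for j using L by (simp add: L2_def)
  \<comment> \<open>Fatou's lemma is applied twice: first \<open>i\<close> tends to infinity at a
    fixed radius \<open>s n\<close>, which turns the mollified \<open>h i\<close> into
    \<open>moll_mass * H\<close>; then the radius tends to 0. Young's inequality bounds all the
    integrals by \<open>moll_mass^2 * e\<close>.\<close>
  have key: "(\<integral>\<^sup>+ z. ennreal ((cmod (h j z - H z))\<^sup>2) \<partial>lborel) \<le> ennreal e"
    if je: "\<And>i. N \<le> i \<Longrightarrow> nrm2 (\<lambda>z. h i z - h j z) \<le> e" and e: "0 \<le> e" for j N e
  proof -
    define s where "s n = 1 / (real n + 1)" for n
    have s: "0 < s n" for n by (simp add: s_def)
    have s0: "s \<longlonglongrightarrow> 0"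
      using LIMSEQ_inverse_real_of_nat unfolding s_def[abs_def] by (simp add: inverse_eq_divide add.commute)
    define u where "u n i \<zeta> = ennreal ((cmod (mollify (s n) (\<lambda>z. h i z - h j z) \<zeta>))\<^sup>2)" for n i \<zeta>
    have [measurable]: "u n i \<in> borel_measurable lborel" for n i
      using mollify_measurable[OF L2_diff[OF L L]] unfolding u_def[abs_def] by measurable
    have ule: "(\<integral>\<^sup>+ \<zeta>. u n i \<zeta> \<partial>lborel) \<le> ennreal (moll_mass\<^sup>2 * e)" if "N \<le> i" for n i
    proof -
      have "(\<integral>\<^sup>+ \<zeta>. u n i \<zeta> \<partial>lborel) \<le> ennreal (moll_mass\<^sup>2 * nrm2 (\<lambda>z. h i z - h j z))"
        unfolding u_def by (rule nn_integral_mollify_le[OF L2_diff[OF L L] s])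
      also have "\<dots> \<le> ennreal (moll_mass\<^sup>2 * e)"
        using je[OF that] by (intro ennreal_leI mult_left_mono) auto
      finally show ?thesis .
    qed
    define v where "v n \<zeta> = liminf (\<lambda>i. u n i \<zeta>)" for n \<zeta>
    have [measurable]: "v n \<in> borel_measurable lborel" for n
      unfolding v_def[abs_def] by measurable
    have vle: "(\<integral>\<^sup>+ \<zeta>. v n \<zeta> \<partial>lborel) \<le> ennreal (moll_mass\<^sup>2 * e)" for n
    proof -
      have "(\<integral>\<^sup>+ \<zeta>. v n \<zeta> \<partial>lborel) \<le> liminf (\<lambda>i. \<integral>\<^sup>+ \<zeta>. u n i \<zeta> \<partial>lborel)"
        unfolding v_def by (rule nn_integral_liminf) measurable
      also have "\<dots> \<le> liminf (\<lambda>i. ennreal (moll_mass\<^sup>2 * e))"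
        by (rule Liminf_mono) (use ule in \<open>auto simp: eventually_sequentially\<close>)
      finally show ?thesis by (simp add: Liminf_const)
    qed
    have "ennreal (moll_mass\<^sup>2) * ennreal ((cmod (h j \<zeta> - H \<zeta>))\<^sup>2) \<le> liminf (\<lambda>n. v n \<zeta>)" for \<zeta>
    proof (cases "\<zeta> \<in> U")
      case False
      then show ?thesis using off by (simp add: H_def)
    next
      case True
      obtain r where r: "0 < r" "cball \<zeta> r \<subseteq> U" using U True open_contains_cball by blast
      have "\<forall>\<^sub>F n in sequentially. s n < r / 4"
        using r by (intro order_tendstoD(2)[OF s0]) simp
      then have ev: "\<forall>\<^sub>F n in sequentially. v n \<zeta> = ennreal ((cmod (of_real moll_mass * H \<zeta> - mollify (s n) (h j) \<zeta>))\<^sup>2)"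
      proof eventually_elim
        fix n assume "s n < r / 4"
        then have "cball \<zeta> (4 * s n) \<subseteq> U" using r(2) subset_cball[of "4 * s n" r \<zeta>] by auto
        from Hlim[OF s this] have "(\<lambda>i. ennreal ((cmod (mollify (s n) (h i) \<zeta> - mollify (s n) (h j) \<zeta>))\<^sup>2))
            \<longlonglongrightarrow> ennreal ((cmod (of_real moll_mass * H \<zeta> - mollify (s n) (h j) \<zeta>))\<^sup>2)"
          by (intro tendsto_intros)
        then have "(\<lambda>i. u n i \<zeta>) \<longlonglongrightarrow> ennreal ((cmod (of_real moll_mass * H \<zeta> - mollify (s n) (h j) \<zeta>))\<^sup>2)"
          unfolding u_def mollify_diff[OF L L s] .
        then show "v n \<zeta> = ennreal ((cmod (of_real moll_mass * H \<zeta> - mollify (s n) (h j) \<zeta>))\<^sup>2)"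
          unfolding v_def by (intro lim_imp_Liminf) auto
      qed
      have "(\<lambda>n. mollify (s n) (h j) \<zeta>) \<longlonglongrightarrow> of_real moll_mass * h j \<zeta>"
        by (rule mollify_tendsto[OF cont L s s0])
      then have "(\<lambda>n. ennreal ((cmod (of_real moll_mass * H \<zeta> - mollify (s n) (h j) \<zeta>))\<^sup>2)) \<longlonglongrightarrow>
          ennreal ((cmod (of_real moll_mass * H \<zeta> - of_real moll_mass * h j \<zeta>))\<^sup>2)"
        by (intro tendsto_intros)
      then have "(\<lambda>n. v n \<zeta>) \<longlonglongrightarrow> ennreal ((cmod (of_real moll_mass * H \<zeta> - of_real moll_mass * h j \<zeta>))\<^sup>2)"
        using ev by (subst tendsto_cong)
      then have "liminf (\<lambda>n. v n \<zeta>) = ennreal ((cmod (of_real moll_mass * H \<zeta> - of_real moll_mass * h j \<zeta>))\<^sup>2)"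
        by (intro lim_imp_Liminf) auto
      also have "(cmod (of_real moll_mass * H \<zeta> - of_real moll_mass * h j \<zeta>))\<^sup>2 = moll_mass\<^sup>2 * (cmod (h j \<zeta> - H \<zeta>))\<^sup>2"
        using moll_mass_pos
        by (simp add: norm_mult power_mult_distrib norm_minus_commute flip: right_diff_distrib)
      finally show ?thesis by (simp add: ennreal_mult)
    qed
    then have "(\<integral>\<^sup>+ z. ennreal (moll_mass\<^sup>2) * ennreal ((cmod (h j z - H z))\<^sup>2) \<partial>lborel) \<le> (\<integral>\<^sup>+ z. liminf (\<lambda>n. v n z) \<partial>lborel)"
      by (rule nn_integral_mono)
    also have "\<dots> \<le> liminf (\<lambda>n. \<integral>\<^sup>+ \<zeta>. v n \<zeta> \<partial>lborel)"
      by (rule nn_integral_liminf) measurable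
    also have "\<dots> \<le> liminf (\<lambda>n::nat. ennreal (moll_mass\<^sup>2 * e))"
      by (rule Liminf_mono) (use vle in auto)
    also have "\<dots> = ennreal (moll_mass\<^sup>2) * ennreal e"
      using e by (simp add: Liminf_const ennreal_mult)
    also have "(\<integral>\<^sup>+ z. ennreal (moll_mass\<^sup>2) * ennreal ((cmod (h j z - H z))\<^sup>2) \<partial>lborel) =
        ennreal (moll_mass\<^sup>2) * (\<integral>\<^sup>+ z. ennreal ((cmod (h j z - H z))\<^sup>2) \<partial>lborel)"
      by (rule nn_integral_cmult) measurable
    finally show ?thesis
      using moll_mass_pos by (simp add: ennreal_mult_le_mult_iff)
  qed
  have diff: "L2 (\<lambda>z. h j z - H z) \<and> nrm2 (\<lambda>z. h j z - H z) \<le> e"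
    if "\<And>i. N \<le> i \<Longrightarrow> nrm2 (\<lambda>z. h i z - h j z) \<le> e" "0 \<le> e" for j N e
  proof -
    note le = key[of N j e, OF that]
    have i: "integrable lborel (\<lambda>z. (cmod (h j z - H z))\<^sup>2)"
      by (rule integrableI_bounded) (use le in \<open>auto intro: le_less_trans\<close>)
    then have "ennreal (nrm2 (\<lambda>z. h j z - H z)) \<le> ennreal e"
      using le nn_integral_eq_integral[OF i] by (simp add: nrm2_def)
    then show ?thesis using i that(2) by (auto simp: L2_def)
  qed
  have LH: "L2 H"
  proof -
    obtain N where "\<And>i j. N \<le> i \<Longrightarrow> N \<le> j \<Longrightarrow> nrm2 (\<lambda>z. h i z - h j z) < 1"
      using cauchy[of 1] by auto
    then have "L2 (\<lambda>z. h N z - H z)" using diff[of N N 1] by fastforce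
    from L2_diff[OF L[of N] this] show ?thesis by simp
  qed
  have "(\<lambda>j. nrm2 (\<lambda>z. h j z - H z)) \<longlonglongrightarrow> 0"
  proof (rule LIMSEQ_I)
    fix e :: real assume e: "0 < e"
    obtain N where N: "\<And>i j. N \<le> i \<Longrightarrow> N \<le> j \<Longrightarrow> nrm2 (\<lambda>z. h i z - h j z) < e / 2"
      using cauchy[of "e / 2"] e by auto
    have "nrm2 (\<lambda>z. h j z - H z) \<le> e / 2" if "N \<le> j" for j
      using diff[of N j "e / 2"] N that e by fastforce
    then have "norm (nrm2 (\<lambda>z. h j z - H z) - 0) < e" if "N \<le> j" for j
      using e nrm2_nonneg[of "\<lambda>z. h j z - H z"] that by force
    then show "\<exists>N. \<forall>j\<ge>N. norm (nrm2 (\<lambda>z. h j z - H z) - 0) < e" by blast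
  qed
  then show thesis using that[of H] Hhol LH by (simp add: H_def)
qed

subsection \<open>The Bergman kernel\<close>

definition zext :: "complex set \<Rightarrow> (complex \<Rightarrow> complex) \<Rightarrow> complex \<Rightarrow> complex" where
  "zext D f z = (if z \<in> D then f z else 0)"

lemma bergman_space_iff:
  assumes "open D"
  shows "f \<in> bergman_space D \<longleftrightarrow> f holomorphic_on D \<and> L2 (zext D f)"
proof -
  have eq: "(\<lambda>z. indicator D z *\<^sub>R (cmod (f z))\<^sup>2) = (\<lambda>z. (cmod (zext D f z))\<^sup>2)"
    by (auto simp: zext_def indicator_def)
  have "zext D f \<in> borel_measurable borel" if "f holomorphic_on D"
  proof -
    have "(\<lambda>z. indicator D z *\<^sub>R f z) \<in> borel_measurable borel"
      using assms holomorphic_on_imp_continuous_on[OF that]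
      by (intro borel_measurable_continuous_on_indicator) auto
    moreover have "(\<lambda>z. indicator D z *\<^sub>R f z) = zext D f" by (auto simp: zext_def indicator_def)
    ultimately show ?thesis by simp
  qed
  then show ?thesis
    unfolding bergman_space_def L2_def set_integrable_def mem_Collect_eq eq by blast
qed

lemma set_integral_zext: "(LINT z:D|lborel. f z * g z) = (\<integral>z. zext D f z * g z \<partial>lborel)"
  unfolding set_lebesgue_integral_def
  by (rule Bochner_Integration.integral_cong) (auto simp: zext_def)

lemma nrm2_expand:
  assumes "L2 f" "L2 g"
  shows "nrm2 (\<lambda>z. f z - t * g z) =
         nrm2 f - 2 * Re (cnj t * (\<integral>z. f z * cnj (g z) \<partial>lborel)) + (cmod t)\<^sup>2 * nrm2 g"
proof -
  have pw: "(cmod (x - t * y))\<^sup>2 = (cmod x)\<^sup>2 - 2 * Re (cnj t * (x * cnj y)) + (cmod t)\<^sup>2 * (cmod y)\<^sup>2" for x y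
  proof -
    have "(cmod (x - t * y))\<^sup>2 = (cmod x)\<^sup>2 + (cmod (t * y))\<^sup>2 - 2 * Re (x * cnj (t * y))"
      unfolding cmod_power2 by (simp add: power2_eq_square algebra_simps)
    then show ?thesis by (simp add: norm_mult power_mult_distrib mult_ac)
  qed
  have i: "integrable lborel (\<lambda>z. f z * cnj (g z))"
    by (rule L2_integrable_mult[OF assms(1) L2_cnj[OF assms(2)]])
  then have i': "integrable lborel (\<lambda>z. cnj t * (f z * cnj (g z)))"
    by (rule integrable_mult_right)
  have iR: "integrable lborel (\<lambda>z. 2 * Re (cnj t * (f z * cnj (g z))))"
    by (intro integrable_mult_right integrable_Re i')
  have if2: "integrable lborel (\<lambda>z. (cmod (f z))\<^sup>2)" and ig2: "integrable lborel (\<lambda>z. (cmod t)\<^sup>2 * (cmod (g z))\<^sup>2)"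
    using assms by (auto simp: L2_def)
  have "nrm2 (\<lambda>z. f z - t * g z) =
      (\<integral>z. (cmod (f z))\<^sup>2 - 2 * Re (cnj t * (f z * cnj (g z))) + (cmod t)\<^sup>2 * (cmod (g z))\<^sup>2 \<partial>lborel)"
    unfolding nrm2_def pw ..
  also have "\<dots> = (\<integral>z. (cmod (f z))\<^sup>2 \<partial>lborel) - (\<integral>z. 2 * Re (cnj t * (f z * cnj (g z))) \<partial>lborel)
      + (\<integral>z. (cmod t)\<^sup>2 * (cmod (g z))\<^sup>2 \<partial>lborel)"
    unfolding Bochner_Integration.integral_add[OF Bochner_Integration.integrable_diff[OF if2 iR] ig2]
      Bochner_Integration.integral_diff[OF if2 iR] ..
  also have "(\<integral>z. 2 * Re (cnj t * (f z * cnj (g z))) \<partial>lborel) = 2 * Re (cnj t * (\<integral>z. f z * cnj (g z) \<partial>lborel))"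
    unfolding integral_mult_right_zero integral_Re[OF i'] ..
  also have "(\<integral>z. (cmod t)\<^sup>2 * (cmod (g z))\<^sup>2 \<partial>lborel) = (cmod t)\<^sup>2 * nrm2 g"
    by (simp add: nrm2_def)
  finally show ?thesis by (simp only: nrm2_def)
qed

lemma nrm2_parallelogram:
  assumes "L2 f" "L2 g"
  shows "nrm2 (\<lambda>z. f z - g z) = 2 * nrm2 f + 2 * nrm2 g - 4 * nrm2 (\<lambda>z. (f z + g z) / 2)"
proof -
  have "nrm2 (\<lambda>z. (f z + g z) / 2) = nrm2 (\<lambda>z. f z + g z) / 4"
    unfolding nrm2_def by (simp add: norm_divide power_divide)
  then show ?thesis
    using nrm2_expand[OF assms, of 1] nrm2_expand[OF assms, of "-1"] by simp
qed

text \<open>The radial bump that evaluates holomorphic functions at its centre. Its norm does not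
  depend on \<open>w\<close>, which later makes the kernel bounds uniform.\<close>

definition peak :: "real \<Rightarrow> complex \<Rightarrow> complex \<Rightarrow> complex" where
  "peak s w z = of_real (moll s (z - w) / moll_mass)"

lemma L2_peak: "0 < s \<Longrightarrow> L2 (peak s w)"
  using L2_cmult[OF L2_moll, of s "1 / of_real moll_mass" w] by (simp add: peak_def[abs_def])

lemma cnj_peak [simp]: "cnj (peak s w z) = peak s w z"
  by (simp add: peak_def)

lemma continuous_peak: "continuous_on UNIV (peak s w)"
  unfolding peak_def[abs_def] using moll_mass_pos by (auto intro!: continuous_intros)

lemma integral_peak:
  assumes "open D" "f holomorphic_on D" "0 < s" "cball w (4 * s) \<subseteq> D"
  shows "(\<integral>z. zext D f z * peak s w z \<partial>lborel) = f w"
proof -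
  have "(\<integral>z. zext D f z * peak s w z \<partial>lborel) =
      (\<integral>z. zext D f z * of_real (moll s (z - w)) \<partial>lborel) / of_real moll_mass"
    unfolding peak_def by simp
  also have "\<dots> = f w"
    using moll_mean_value[OF assms] moll_mass_pos unfolding set_integral_zext by simp
  finally show ?thesis .
qed

lemma nrm2_peak: "nrm2 (peak s w) = nrm2 (peak s 0)" if "0 < s"
proof -
  have "integrable lborel (\<lambda>z. (cmod (peak s w z))\<^sup>2)" using L2_peak[OF that] by (simp add: L2_def)
  from integral_lborel_translate(2)[OF this, of w] show ?thesis by (simp add: nrm2_def peak_def)
qed

text \<open>The predicate under \<open>THE\<close> in \<open>bergman_kernel\<close>; prescribing 0
  outside \<open>D\<close> makes the function unique.\<close>

definition reproduces :: "complex set \<Rightarrow> complex \<Rightarrow> (complex \<Rightarrow> complex) \<Rightarrow> bool" where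
  "reproduces D w k \<longleftrightarrow> k \<in> bergman_space D \<and> (\<forall>\<zeta>. \<zeta> \<notin> D \<longrightarrow> k \<zeta> = 0) \<and>
     (\<forall>f\<in>bergman_space D. f w = (LINT \<zeta>:D|lborel. f \<zeta> * cnj (k \<zeta>)))"

lemma reproduces_zext: "reproduces D w k \<Longrightarrow> zext D k = k"
  by (auto simp: reproduces_def zext_def)

text \<open>The kernel is obtained by minimising the distance from \<open>peak s w\<close> to the conjugated \<open>dbar\<close> derivatives of
  test functions, which are orthogonal to the Bergman space; the approximation clause is what survives
  the removal of a set of small capacity.\<close>

lemma kernel_exists:
  assumes U: "open U" and s: "0 < s" "cball w (4 * s) \<subseteq> U"
  shows "\<exists>k. reproduces U w k \<and>
    (\<forall>e>0. \<exists>\<phi> a d. test_fun U \<phi> a d \<and> nrm2 (\<lambda>z. peak s w z - cnj (d z) - k z) < e)"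
proof -
  define T where "T = {d. \<exists>\<phi> a. test_fun U \<phi> a d}"
  define N where "N d = nrm2 (\<lambda>z. peak s w z - cnj (d z))" for d
  define \<mu> where "\<mu> = Inf (N ` T)"
  have T0: "(\<lambda>z. 0) \<in> T" using test_fun_zero unfolding T_def by blast
  have Tadd: "(\<lambda>z. d z + d' z) \<in> T" if "d \<in> T" "d' \<in> T" for d d'
    using that test_fun_add unfolding T_def by blast
  have Tcm: "(\<lambda>z. c * d z) \<in> T" if "d \<in> T" for c d
    using that test_fun_cmult unfolding T_def by blast
  have TL: "L2 (\<lambda>z. cnj (d z))" if "d \<in> T" for d
    using that L2_test_fun L2_cnj unfolding T_def by blast
  have Lp: "L2 (peak s w)" by (rule L2_peak[OF s(1)])
  have bdd: "bdd_below (N ` T)" by (rule bdd_belowI[of _ 0]) (auto simp: N_def nrm2_nonneg)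
  have \<mu>le: "\<mu> \<le> N d" if "d \<in> T" for d
    unfolding \<mu>_def using bdd that by (intro cInf_lower) auto
  have "\<exists>d\<in>T. N d < \<mu> + 1 / (real j + 1)" for j
  proof -
    have "\<mu> < \<mu> + 1 / (real j + 1)" by simp
    then show ?thesis
      using cInf_lessD[of "N ` T"] T0 unfolding \<mu>_def by blast
  qed
  then obtain d where d: "\<And>j. d j \<in> T" "\<And>j. N (d j) < \<mu> + 1 / (real j + 1)" by metis
  define h where "h j z = peak s w z - cnj (d j z)" for j z
  have Lh: "L2 (h j)" for j unfolding h_def by (intro L2_diff Lp TL d)
  have nh: "nrm2 (h j) < \<mu> + 1 / (real j + 1)" for j using d(2)[of j] by (simp add: N_def h_def[abs_def])
  have inv0: "(\<lambda>j. 1 / (real j + 1)) \<longlonglongrightarrow> 0"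
    using LIMSEQ_inverse_real_of_nat by (simp add: inverse_eq_divide add.commute)
  have diff: "nrm2 (\<lambda>z. h i z - h j z) \<le> 2 / (real i + 1) + 2 / (real j + 1)" for i j
  proof -
    \<comment> \<open>The midpoint of two competitors is a competitor, so the parallelogram law
      makes the minimising sequence Cauchy.\<close>
    have "(\<lambda>z. 1 / 2 * (d i z + d j z)) \<in> T" by (intro Tcm Tadd d)
    from \<mu>le[OF this] have "\<mu> \<le> nrm2 (\<lambda>z. (h i z + h j z) / 2)"
      by (simp add: N_def h_def field_simps)
    then show ?thesis
      using nrm2_parallelogram[OF Lh Lh, of i j] nh[of i] nh[of j] by simp
  qed
  obtain H where H: "H holomorphic_on U" "\<And>z. z \<notin> U \<Longrightarrow> H z = 0" "L2 H" "(\<lambda>j. nrm2 (\<lambda>z. h j z - H z)) \<longlonglongrightarrow> 0"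
  proof (rule dbar_limit_holomorphic[where U = U and h = h])
    show "open U" by fact
    show "continuous_on UNIV (h j)" for j
      using d(1)[of j] test_fun_continuous(3) continuous_peak
      unfolding h_def[abs_def] T_def by (auto intro!: continuous_intros)
    show "\<exists>K. compact K \<and> K \<subseteq> U \<and> (\<forall>z. z \<notin> K \<longrightarrow> h j z = 0)" for j
    proof -
      obtain \<phi> a where "test_fun U \<phi> a (d j)" using d(1)[of j] unfolding T_def by blast
      then obtain K where K: "compact K" "K \<subseteq> U" "\<And>z. z \<notin> K \<Longrightarrow> d j z = 0" using test_funE by metis
      have "cball w s \<subseteq> U" using s subset_cball[of s "4 * s" w] by auto
      then show ?thesis
        using K moll_support[OF s(1), of _ w]
        by (intro exI[of _ "K \<union> cball w s"]) (auto simp: h_def peak_def)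
    qed
    show "\<exists>N. \<forall>i\<ge>N. \<forall>j\<ge>N. nrm2 (\<lambda>z. h i z - h j z) < e" if e: "0 < e" for e
    proof -
      have "\<forall>\<^sub>F j in sequentially. 1 / (real j + 1) < e / 4"
        using e by (intro order_tendstoD(2)[OF inv0]) simp
      then obtain M where M: "\<And>j. M \<le> j \<Longrightarrow> 1 / (real j + 1) < e / 4"
        unfolding eventually_sequentially by blast
      have "nrm2 (\<lambda>z. h i z - h j z) < e" if "M \<le> i" "M \<le> j" for i j
        using diff[of i j] M[OF that(1)] M[OF that(2)] by linarith
      then show ?thesis by blast
    qed
    show "(\<lambda>j. \<integral>z. h j z * d' z \<partial>lborel) \<longlonglongrightarrow> 0" if "test_fun U \<phi> a d'" for \<phi> a d'
    proof -
      have d': "d' \<in> T" using that unfolding T_def by blast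
      define g where "g z = cnj (d' z)" for z
      have Lg: "L2 g" unfolding g_def[abs_def] by (rule TL[OF d'])
      \<comment> \<open>The added 1 keeps \<open>M\<close> positive when \<open>g\<close> is null.
        The variation with \<open>t = I / M\<close> lowers the squared distance by at least
        \<open>|I|^2 / M\<close>, which cannot exceed the excess \<open>1 / (j + 1)\<close> over the
        infimum.\<close>
      define M where "M = nrm2 g + 1"
      have M: "0 < M" "nrm2 g \<le> M" using nrm2_nonneg[of g] by (auto simp: M_def)
      have bound: "(cmod (\<integral>z. h j z * d' z \<partial>lborel))\<^sup>2 \<le> M * (1 / (real j + 1))" for j
      proof -
        define I where "I = (\<integral>z. h j z * d' z \<partial>lborel)"
        define t where "t = of_real (1 / M) * I"
        have "(\<lambda>z. d j z + cnj t * d' z) \<in> T" by (intro Tadd Tcm d d')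
        from \<mu>le[OF this] have "\<mu> \<le> nrm2 (\<lambda>z. h j z - t * g z)"
          by (simp add: N_def h_def g_def algebra_simps)
        also have "\<dots> = nrm2 (h j) - 2 * Re (cnj t * I) + (cmod t)\<^sup>2 * nrm2 g"
          using nrm2_expand[OF Lh Lg, of j t] by (simp add: I_def g_def)
        also have "Re (cnj t * I) = (cmod I)\<^sup>2 / M"
        proof -
          have "cnj t * I = of_real (1 / M) * (I * cnj I)" by (simp add: t_def mult_ac)
          also have "I * cnj I = of_real ((cmod I)\<^sup>2)" by (rule complex_norm_square[symmetric])
          also have "of_real (1 / M) * \<dots> = (of_real ((cmod I)\<^sup>2 / M) :: complex)" by simp
          finally show ?thesis by (simp only: Re_complex_of_real)
        qed
        also have "(cmod t)\<^sup>2 * nrm2 g \<le> (cmod I)\<^sup>2 / M"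
        proof -
          have "(cmod t)\<^sup>2 * nrm2 g = (cmod I)\<^sup>2 / M\<^sup>2 * nrm2 g"
            using M by (simp add: t_def norm_mult power_mult_distrib power_divide norm_divide)
          also have "\<dots> \<le> (cmod I)\<^sup>2 / M\<^sup>2 * M" using M by (intro mult_left_mono) auto
          also have "\<dots> = (cmod I)\<^sup>2 / M" using M by (simp add: power2_eq_square)
          finally show ?thesis .
        qed
        finally have "(cmod I)\<^sup>2 / M \<le> 1 / (real j + 1)" using nh[of j] by linarith
        then show ?thesis using M(1) unfolding I_def[symmetric] by (simp add: field_simps)
      qed
      have "(\<lambda>j. (cmod (\<integral>z. h j z * d' z \<partial>lborel))\<^sup>2) \<longlonglongrightarrow> 0"
      proof (rule Lim_null_comparison[OF always_eventually])
        show "\<forall>j. norm ((cmod (\<integral>z. h j z * d' z \<partial>lborel))\<^sup>2) \<le> M * (1 / (real j + 1))"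
          using bound by (simp only: real_norm_def abs_power2 simp_thms)
        show "(\<lambda>j. M * (1 / (real j + 1))) \<longlonglongrightarrow> 0"
          by (rule tendsto_mult_right_zero[OF inv0])
      qed
      then have "(\<lambda>j. sqrt ((cmod (\<integral>z. h j z * d' z \<partial>lborel))\<^sup>2)) \<longlonglongrightarrow> sqrt 0"
        by (rule tendsto_real_sqrt)
      then show ?thesis by (simp add: tendsto_norm_zero_iff)
    qed
  qed (rule that)
  have zH: "zext U H = H" using H(2) by (auto simp: zext_def)
  have HB: "H \<in> bergman_space U" using H(1,3) by (simp add: bergman_space_iff[OF U] zH)
  have "f w = (LINT \<zeta>:U|lborel. f \<zeta> * cnj (H \<zeta>))" if f: "f \<in> bergman_space U" for f
  proof -
    have fh: "f holomorphic_on U" and Lf: "L2 (zext U f)" using f by (auto simp: bergman_space_iff[OF U])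
    \<comment> \<open>Each \<open>h j\<close> already has the reproducing property: the peak
      evaluates \<open>f\<close> at \<open>w\<close>, and \<open>f\<close> annihilates
      \<open>d j\<close>. It remains to pass to the limit in \<open>L^2\<close>.\<close>
    have val: "(\<integral>z. zext U f z * cnj (h j z) \<partial>lborel) = f w" for j
    proof -
      obtain \<phi> a where tf: "test_fun U \<phi> a (d j)" using d(1)[of j] unfolding T_def by blast
      have "(\<integral>z. zext U f z * cnj (h j z) \<partial>lborel) = (\<integral>z. zext U f z * peak s w z - zext U f z * d j z \<partial>lborel)"
        by (simp add: h_def algebra_simps)
      also have "\<dots> = (\<integral>z. zext U f z * peak s w z \<partial>lborel) - (\<integral>z. zext U f z * d j z \<partial>lborel)"
        by (intro Bochner_Integration.integral_diff L2_integrable_mult Lf Lp L2_test_fun[OF tf])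
      also have "(\<integral>z. zext U f z * d j z \<partial>lborel) = 0"
        using integral_holomorphic_dbar_zero[OF U fh tf] by (simp add: set_integral_zext)
      finally show ?thesis using integral_peak[OF U fh s] by simp
    qed
    have "(\<lambda>j. (\<integral>z. zext U f z * cnj (h j z) \<partial>lborel) - (\<integral>z. zext U f z * cnj (H z) \<partial>lborel)) \<longlonglongrightarrow> 0"
    proof (rule Lim_null_comparison[OF always_eventually])
      show "\<forall>j. norm ((\<integral>z. zext U f z * cnj (h j z) \<partial>lborel) - (\<integral>z. zext U f z * cnj (H z) \<partial>lborel))
          \<le> sqrt (nrm2 (zext U f)) * sqrt (nrm2 (\<lambda>z. h j z - H z))"
      proof
        fix j
        have "(\<integral>z. zext U f z * cnj (h j z) \<partial>lborel) - (\<integral>z. zext U f z * cnj (H z) \<partial>lborel)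
            = (\<integral>z. zext U f z * cnj (h j z - H z) \<partial>lborel)"
          unfolding complex_cnj_diff right_diff_distrib
          by (intro Bochner_Integration.integral_diff[symmetric] L2_integrable_mult Lf L2_cnj Lh H)
        also have "cmod \<dots> \<le> sqrt (nrm2 (zext U f)) * sqrt (nrm2 (\<lambda>z. cnj (h j z - H z)))"
          by (intro L2_Cauchy_Schwarz Lf L2_cnj L2_diff Lh H)
        also have "nrm2 (\<lambda>z. cnj (h j z - H z)) = nrm2 (\<lambda>z. h j z - H z)"
          unfolding nrm2_def by (simp only: complex_mod_cnj)
        finally show "norm ((\<integral>z. zext U f z * cnj (h j z) \<partial>lborel) - (\<integral>z. zext U f z * cnj (H z) \<partial>lborel))
          \<le> sqrt (nrm2 (zext U f)) * sqrt (nrm2 (\<lambda>z. h j z - H z))" .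
      qed
      have "(\<lambda>j. sqrt (nrm2 (zext U f)) * sqrt (nrm2 (\<lambda>z. h j z - H z))) \<longlonglongrightarrow> sqrt (nrm2 (zext U f)) * sqrt 0"
        by (intro tendsto_mult_left tendsto_real_sqrt H)
      then show "(\<lambda>j. sqrt (nrm2 (zext U f)) * sqrt (nrm2 (\<lambda>z. h j z - H z))) \<longlonglongrightarrow> 0" by simp
    qed
    then have "f w - (\<integral>z. zext U f z * cnj (H z) \<partial>lborel) = 0"
      unfolding val by (rule LIMSEQ_unique[OF tendsto_const])
    then show ?thesis by (simp add: set_integral_zext)
  qed
  then have "reproduces U w H" using HB H(2) by (simp add: reproduces_def)
  moreover have "\<exists>\<phi> a d. test_fun U \<phi> a d \<and> nrm2 (\<lambda>z. peak s w z - cnj (d z) - H z) < e" if e: "0 < e" for e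
  proof -
    obtain j where "nrm2 (\<lambda>z. h j z - H z) < e"
      using order_tendstoD(2)[OF H(4) e] by (auto simp: eventually_sequentially)
    moreover obtain \<phi> a where "test_fun U \<phi> a (d j)" using d(1)[of j] unfolding T_def by blast
    ultimately show ?thesis unfolding h_def by blast
  qed
  ultimately show ?thesis by blast
qed

lemma reproduces_symmetric:
  assumes "open D" "reproduces D w k" "reproduces D z k'"
  shows "k z = cnj (k' w)"
proof -
  have "k z = (\<integral>\<zeta>. zext D k \<zeta> * cnj (k' \<zeta>) \<partial>lborel)" "k' w = (\<integral>\<zeta>. zext D k' \<zeta> * cnj (k \<zeta>) \<partial>lborel)"
    using assms by (auto simp: reproduces_def set_integral_zext)
  then have "k z = (\<integral>\<zeta>. k \<zeta> * cnj (k' \<zeta>) \<partial>lborel)" "k' w = (\<integral>\<zeta>. k' \<zeta> * cnj (k \<zeta>) \<partial>lborel)"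
    using assms reproduces_zext by simp_all
  moreover have "cnj (\<integral>\<zeta>. k' \<zeta> * cnj (k \<zeta>) \<partial>lborel) = (\<integral>\<zeta>. cnj (k' \<zeta> * cnj (k \<zeta>)) \<partial>lborel)"
    by (rule Bochner_Integration.integral_cnj[symmetric])
  ultimately show ?thesis by (simp add: mult.commute)
qed

lemma ball_in_open_scale:
  assumes "open U" "w \<in> U"
  obtains s where "0 < s" "cball w (4 * s) \<subseteq> U"
proof -
  obtain r where "0 < r" "cball w r \<subseteq> U" using assms open_contains_cball by blast
  then show thesis using that[of "r / 4"] by simp
qed

text \<open>Uniqueness follows from symmetry: the value at \<open>z\<close> of any kernel function
  for \<open>w\<close> is the conjugate of the value at \<open>w\<close> of a kernel function for
  \<open>z\<close>.\<close>

lemma bergman_kernel_eqI: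
  assumes U: "open U" and k: "reproduces U w k"
  shows "bergman_kernel U z w = k z"
proof -
  have "(THE k. reproduces U w k) = k"
  proof (rule the_equality)
    show "reproduces U w k" by fact
    fix k1 assume k1: "reproduces U w k1"
    show "k1 = k"
    proof
      fix z
      show "k1 z = k z"
      proof (cases "z \<in> U")
        case True
        then obtain s where "0 < s" "cball z (4 * s) \<subseteq> U" using ball_in_open_scale[OF U] by blast
        then obtain k' where "reproduces U z k'" using kernel_exists[OF U] by blast
        then show ?thesis using reproduces_symmetric[OF U k1] reproduces_symmetric[OF U k] by simp
      next
        case False
        then show ?thesis using k k1 by (simp add: reproduces_def)
      qed
    qed
  qed
  then show ?thesis unfolding bergman_kernel_def reproduces_def by simp
qed

text \<open>Here \<open>nrm2 k\<close> equals the modulus of \<open>k w\<close>, and integration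
  against the peak bounds \<open>k w\<close> by Cauchy-Schwarz. The bound sees \<open>D\<close> only
  through \<open>s\<close>, hence it is uniform in the removed set.\<close>

lemma reproduces_nrm2_le:
  assumes D: "open D" and s: "0 < s" "cball w (4 * s) \<subseteq> D" and k: "reproduces D w k"
  shows "sqrt (nrm2 k) \<le> sqrt (nrm2 (peak s 0))"
proof -
  have kB: "k \<in> bergman_space D" using k by (simp add: reproduces_def)
  have kh: "k holomorphic_on D" and L: "L2 k"
    using kB reproduces_zext[OF k] by (auto simp: bergman_space_iff[OF D])
  have "k w = (LINT \<zeta>:D|lborel. k \<zeta> * cnj (k \<zeta>))"
    using k kB unfolding reproduces_def by blast
  also have "\<dots> = (\<integral>\<zeta>. k \<zeta> * cnj (k \<zeta>) \<partial>lborel)"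
    unfolding set_integral_zext reproduces_zext[OF k] ..
  also have "\<dots> = (\<integral>\<zeta>. of_real ((cmod (k \<zeta>))\<^sup>2) \<partial>lborel)"
    by (simp only: complex_norm_square)
  also have "\<dots> = of_real (nrm2 k)" unfolding nrm2_def by (rule integral_of_real) (use L in \<open>simp add: L2_def\<close>)
  finally have "nrm2 k = cmod (k w)" using nrm2_nonneg[of k] by simp
  also have "k w = (\<integral>z. k z * peak s w z \<partial>lborel)"
    using integral_peak[OF D kh s] reproduces_zext[OF k] by simp
  also have "cmod \<dots> \<le> sqrt (nrm2 k) * sqrt (nrm2 (peak s w))"
    by (intro L2_Cauchy_Schwarz L L2_peak s)
  finally have "sqrt (nrm2 k) * sqrt (nrm2 k) \<le> sqrt (nrm2 k) * sqrt (nrm2 (peak s 0))"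
    using nrm2_nonneg[of k] nrm2_peak[OF s(1), of w] by simp
  then have *: "sqrt (nrm2 k) \<le> sqrt (nrm2 (peak s 0))" if "0 < sqrt (nrm2 k)"
    using mult_le_cancel_left_pos[OF that] by blast
  show ?thesis
  proof (cases "nrm2 k = 0")
    case False
    then have "0 < sqrt (nrm2 k)" using nrm2_nonneg[of k] by simp
    then show ?thesis by (rule *)
  qed (simp add: nrm2_nonneg)
qed

text \<open>This will replace the points \<open>z\<close> by a finite net. For centres closer than
  \<open>s\<close> both peaks live in the disc of radius \<open>2 * s\<close> about
  \<open>z\<close>, whose area is \<open>C\<close>.\<close>

lemma peak_uniformly_continuous:
  assumes s: "0 < s" and e: "0 < e"
  shows "\<exists>\<tau>>0. \<forall>z z'. dist z z' < \<tau> \<longrightarrow> nrm2 (\<lambda>\<xi>. peak s z \<xi> - peak s z' \<xi>) \<le> e"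
proof -
  define C where "C = pi * (2 * s)\<^sup>2"
  have C: "0 < C" using s by (simp add: C_def)
  have "uniformly_continuous_on (cball 0 (3 * s)) (\<lambda>z. peak s 0 z)"
    by (intro compact_uniformly_continuous continuous_on_subset[OF continuous_peak]) auto
  moreover have "0 < sqrt (e / C)" using e C by simp
  ultimately obtain \<tau> where \<tau>: "0 < \<tau>"
    "\<And>x y. x \<in> cball 0 (3 * s) \<Longrightarrow> y \<in> cball 0 (3 * s) \<Longrightarrow> dist y x < \<tau> \<Longrightarrow> dist (peak s 0 y) (peak s 0 x) < sqrt (e / C)"
    unfolding uniformly_continuous_on_def by metis
  have "nrm2 (\<lambda>\<xi>. peak s z \<xi> - peak s z' \<xi>) \<le> e" if zz: "dist z z' < min \<tau> s" for z z'
  proof -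
    have le: "(cmod (peak s z \<xi> - peak s z' \<xi>))\<^sup>2 \<le> e / C * indicator (cball z (2 * s)) \<xi>" for \<xi>
    proof (cases "\<xi> \<in> cball z (2 * s)")
      case True
      have "\<xi> - z \<in> cball 0 (3 * s)" using True s by (simp add: dist_norm norm_minus_commute)
      moreover have "\<xi> - z' \<in> cball 0 (3 * s)"
        using True zz norm_triangle_ineq[of "\<xi> - z" "z - z'"] by (simp add: dist_norm norm_minus_commute)
      moreover have "dist (\<xi> - z) (\<xi> - z') < \<tau>" using zz by (simp add: dist_norm norm_minus_commute)
      ultimately have "dist (peak s 0 (\<xi> - z)) (peak s 0 (\<xi> - z')) < sqrt (e / C)" by (intro \<tau>)
      then have "cmod (peak s z \<xi> - peak s z' \<xi>) \<le> sqrt (e / C)" by (simp add: peak_def dist_norm)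
      then have "(cmod (peak s z \<xi> - peak s z' \<xi>))\<^sup>2 \<le> (sqrt (e / C))\<^sup>2" by (rule power_mono) simp
      then show ?thesis using True e C by simp
    next
      case False
      then have "2 * s < cmod (\<xi> - z)" by (simp add: dist_norm norm_minus_commute)
      moreover have "cmod (\<xi> - z) \<le> cmod (\<xi> - z') + cmod (z - z')"
        using norm_triangle_ineq4[of "\<xi> - z'" "z - z'"] by simp
      ultimately have "s \<le> cmod (\<xi> - z)" "s \<le> cmod (\<xi> - z')"
        using zz s by (auto simp: dist_norm)
      then show ?thesis using False moll_outside[OF s] by (simp add: peak_def)
    qed
    have "nrm2 (\<lambda>\<xi>. peak s z \<xi> - peak s z' \<xi>) \<le> (\<integral>\<xi>. e / C * indicator (cball z (2 * s)) \<xi> \<partial>lborel)"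
      unfolding nrm2_def
    proof (rule integral_mono[OF _ _ le])
      show "integrable lborel (\<lambda>\<xi>. (cmod (peak s z \<xi> - peak s z' \<xi>))\<^sup>2)"
        using L2_diff[OF L2_peak[OF s] L2_peak[OF s]] by (simp add: L2_def)
      show "integrable lborel (\<lambda>\<xi>. e / C * indicator (cball z (2 * s)) \<xi>)"
        by (intro integrable_mult_right integrable_indicator_cball)
    qed
    also have "\<dots> = e / C * C" using s by (simp add: measure_cball_complex C_def)
    also have "\<dots> = e" using C by simp
    finally show ?thesis .
  qed
  then show ?thesis using \<tau>(1) s by (intro exI[of _ "min \<tau> s"]) auto
qed

subsection \<open>Stability of the kernel\<close>

text \<open>The first factor bounds the norm of \<open>f\<close>, \<open>e\<close> is the error of
  the approximation by a test function, and the two terms of \<open>dbar (\<theta> \<phi>)\<close>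
  cost \<open>B * sqrt \<eta>\<close> each.\<close>

lemma kernel_difference_le:
  assumes U: "open U" and D: "open D" "D \<subseteq> U" "U - D \<subseteq> K0"
    and cut: "C1_cutoff K0 \<eta> \<theta> g"
    and s: "0 < s" "cball z (4 * s) \<subseteq> D" "cball w (4 * s) \<subseteq> D"
    and kz: "reproduces U z kz" and kw: "reproduces U w kw" and f: "reproduces D w f"
    and T: "test_fun U \<phi> a d" and e: "nrm2 (\<lambda>\<xi>. peak s z \<xi> - cnj (d \<xi>) - kz \<xi>) \<le> e\<^sup>2" "0 \<le> e"
    and B: "\<And>\<xi>. cmod (\<phi> \<xi>) \<le> B" "\<And>\<xi>. cmod (d \<xi>) \<le> B"
  shows "cmod (f z - kw z) \<le> sqrt (nrm2 (peak s 0)) * (e + 2 * B * sqrt \<eta>)"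
proof -
  define N0 where "N0 = sqrt (nrm2 (peak s 0))"
  have N0: "0 \<le> N0" by (simp add: N0_def nrm2_nonneg)
  have B0: "0 \<le> B" using B(1)[of 0] norm_ge_zero[of "\<phi> 0"] by linarith
  have fB: "f \<in> bergman_space D" using f by (simp add: reproduces_def)
  have fh: "f holomorphic_on D" and Lf: "L2 f"
    using fB reproduces_zext[OF f] by (auto simp: bergman_space_iff[OF D(1)])
  have fN: "sqrt (nrm2 f) \<le> N0"
    unfolding N0_def by (rule reproduces_nrm2_le[OF D(1) s(1,3) f])
  have Lk: "L2 kz" and kh: "kz holomorphic_on U"
    using kz reproduces_zext[OF kz] by (auto simp: reproduces_def bergman_space_iff[OF U])
  have Lp: "L2 (peak s z)" by (rule L2_peak[OF s(1)])
  have Ld: "L2 d" by (rule L2_test_fun[OF T])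
  have CS: "cmod (\<integral>\<xi>. f \<xi> * u \<xi> \<partial>lborel) \<le> N0 * c" if "L2 u" "nrm2 u \<le> c\<^sup>2" "0 \<le> c" for u c
  proof -
    have "cmod (\<integral>\<xi>. f \<xi> * u \<xi> \<partial>lborel) \<le> sqrt (nrm2 f) * sqrt (nrm2 u)"
      by (rule L2_Cauchy_Schwarz[OF Lf that(1)])
    also have "\<dots> \<le> N0 * c"
      by (intro mult_mono[OF fN real_le_lsqrt]) (auto simp: nrm2_nonneg N0 that)
    finally show ?thesis .
  qed
  have fz: "f z = (\<integral>\<xi>. f \<xi> * peak s z \<xi> \<partial>lborel)"
    using integral_peak[OF D(1) fh s(1,2)] reproduces_zext[OF f] by simp
  \<comment> \<open>Restricted to \<open>D\<close>, \<open>kz\<close> lies in the Bergman space of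
    \<open>D\<close>, so \<open>f\<close> reproduces it at \<open>w\<close>; the symmetry of the
    kernel of \<open>U\<close> turns \<open>cnj (kz w)\<close> into \<open>kw z\<close>.\<close>
  have kD: "kw z = (\<integral>\<xi>. f \<xi> * cnj (kz \<xi>) \<partial>lborel)"
  proof -
    have "kz \<in> bergman_space D"
    proof -
      have "L2 (zext D kz)"
      proof (rule L2_bound(1)[OF Lk, of _ 1])
        have "(\<lambda>z. indicator D z *\<^sub>R kz z) \<in> borel_measurable borel"
          using D(1) Lk unfolding L2_def by (intro borel_measurable_scaleR borel_measurable_indicator) auto
        moreover have "(\<lambda>z. indicator D z *\<^sub>R kz z) = zext D kz" by (auto simp: zext_def indicator_def)
        ultimately show "zext D kz \<in> borel_measurable borel" by simp
      qed (simp add: zext_def)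
      then show ?thesis using holomorphic_on_subset[OF kh D(2)] by (simp add: bergman_space_iff[OF D(1)])
    qed
    then have "kz w = (LINT \<zeta>:D|lborel. kz \<zeta> * cnj (f \<zeta>))" using f by (simp add: reproduces_def)
    also have "\<dots> = (\<integral>\<zeta>. kz \<zeta> * cnj (f \<zeta>) \<partial>lborel)"
      unfolding set_lebesgue_integral_def
      by (rule Bochner_Integration.integral_cong) (use f in \<open>auto simp: reproduces_def indicator_def\<close>)
    finally have "cnj (kz w) = (\<integral>\<zeta>. cnj (kz \<zeta> * cnj (f \<zeta>)) \<partial>lborel)"
      by (simp only: Bochner_Integration.integral_cnj)
    then show ?thesis using reproduces_symmetric[OF U kw kz] by (simp add: mult.commute)
  qed
  have "f z - kw z = (\<integral>\<xi>. f \<xi> * cnj (peak s z \<xi> - cnj (d \<xi>) - kz \<xi>) \<partial>lborel) + (\<integral>\<xi>. f \<xi> * d \<xi> \<partial>lborel)"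
  proof -
    have i1: "integrable lborel (\<lambda>\<xi>. f \<xi> * peak s z \<xi>)" by (rule L2_integrable_mult[OF Lf Lp])
    have i2: "integrable lborel (\<lambda>\<xi>. f \<xi> * d \<xi>)" by (rule L2_integrable_mult[OF Lf Ld])
    have i3: "integrable lborel (\<lambda>\<xi>. f \<xi> * cnj (kz \<xi>))" by (rule L2_integrable_mult[OF Lf L2_cnj[OF Lk]])
    have "(\<integral>\<xi>. f \<xi> * cnj (peak s z \<xi> - cnj (d \<xi>) - kz \<xi>) \<partial>lborel) =
        (\<integral>\<xi>. f \<xi> * peak s z \<xi> - f \<xi> * d \<xi> - f \<xi> * cnj (kz \<xi>) \<partial>lborel)"
      by (simp add: algebra_simps)
    also have "\<dots> = f z - (\<integral>\<xi>. f \<xi> * d \<xi> \<partial>lborel) - kw z"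
      using i1 i2 i3 by (simp add: fz kD)
    finally show ?thesis by simp
  qed
  moreover have "cmod (\<integral>\<xi>. f \<xi> * cnj (peak s z \<xi> - cnj (d \<xi>) - kz \<xi>) \<partial>lborel) \<le> N0 * e"
  proof (rule CS[OF _ _ e(2)])
    show "L2 (\<lambda>\<xi>. cnj (peak s z \<xi> - cnj (d \<xi>) - kz \<xi>))"
      by (intro L2_cnj L2_diff Lp Ld Lk)
    show "nrm2 (\<lambda>\<xi>. cnj (peak s z \<xi> - cnj (d \<xi>) - kz \<xi>)) \<le> e\<^sup>2"
      using e(1) unfolding nrm2_def by (simp only: complex_mod_cnj)
  qed
  moreover have "cmod (\<integral>\<xi>. f \<xi> * d \<xi> \<partial>lborel) \<le> N0 * (2 * B * sqrt \<eta>)"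
  proof -
    obtain V where V: "open V" "K0 \<subseteq> V" "\<And>\<xi>. \<xi> \<in> V \<Longrightarrow> \<theta> \<xi> = 1"
      and der: "\<And>\<xi>. (\<theta> has_derivative (\<lambda>h. g \<xi> \<bullet> h)) (at \<xi>)" and cg: "continuous_on UNIV g"
      and i\<theta>: "integrable lborel (\<lambda>\<xi>. (\<theta> \<xi>)\<^sup>2)" "(\<integral>\<xi>. (\<theta> \<xi>)\<^sup>2 \<partial>lborel) \<le> \<eta>"
      and ig: "integrable lborel (\<lambda>\<xi>. (cmod (g \<xi>))\<^sup>2)" "(\<integral>\<xi>. (cmod (g \<xi>))\<^sup>2 \<partial>lborel) \<le> \<eta>"
      using cut unfolding C1_cutoff_def by blast
    have \<eta>: "0 \<le> \<eta>"
    proof -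
      have "0 \<le> (\<integral>\<xi>. (\<theta> \<xi>)\<^sup>2 \<partial>lborel)" by simp
      then show ?thesis using i\<theta>(2) by linarith
    qed
    have c\<theta>: "continuous_on UNIV \<theta>"
      using der by (auto simp: continuous_on_eq_continuous_at intro: has_derivative_continuous)
    have "wirtinger (\<lambda>\<xi>. of_real (1 - \<theta> \<xi>)) (\<lambda>\<xi>. cnj (- g \<xi>) / 2) (\<lambda>\<xi>. - g \<xi> / 2)"
    proof (rule wirtinger_of_real)
      show "((\<lambda>\<xi>. 1 - \<theta> \<xi>) has_derivative (\<lambda>h. - g \<xi> \<bullet> h)) (at \<xi>)" for \<xi>
        using has_derivative_diff[OF has_derivative_const[of 1] der[of \<xi>]] by simp
    qed (use cg in \<open>auto intro!: continuous_intros\<close>)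
    from test_fun_mult[OF T this]
    have TU: "test_fun U (\<lambda>\<xi>. \<phi> \<xi> * of_real (1 - \<theta> \<xi>)) (\<lambda>\<xi>. \<phi> \<xi> * (cnj (- g \<xi>) / 2) + a \<xi> * of_real (1 - \<theta> \<xi>))
        (\<lambda>\<xi>. \<phi> \<xi> * (- g \<xi> / 2) + d \<xi> * of_real (1 - \<theta> \<xi>))" .
    obtain K where K: "compact K" "K \<subseteq> U" "\<And>\<xi>. \<xi> \<notin> K \<Longrightarrow> \<phi> \<xi> = 0" using test_funE[OF T] by metis
    \<comment> \<open>All of \<open>U - D\<close> lies in \<open>V\<close>, where
      \<open>1 - \<theta>\<close> vanishes; what is left of the support is a compact subset of
      \<open>D\<close>.\<close>
    have "compact (K - V)" "K - V \<subseteq> D" using K V D(3) by (auto intro: compact_diff)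
    moreover have "\<forall>\<xi>. \<xi> \<notin> K - V \<longrightarrow> \<phi> \<xi> * of_real (1 - \<theta> \<xi>) = 0" using K(3) V(3) by auto
    ultimately have TD: "test_fun D (\<lambda>\<xi>. \<phi> \<xi> * of_real (1 - \<theta> \<xi>)) (\<lambda>\<xi>. \<phi> \<xi> * (cnj (- g \<xi>) / 2) + a \<xi> * of_real (1 - \<theta> \<xi>))
        (\<lambda>\<xi>. \<phi> \<xi> * (- g \<xi> / 2) + d \<xi> * of_real (1 - \<theta> \<xi>))"
      using TU unfolding test_fun_def by blast
    have zero: "(\<integral>\<xi>. f \<xi> * (\<phi> \<xi> * (- g \<xi> / 2) + d \<xi> * of_real (1 - \<theta> \<xi>)) \<partial>lborel) = 0"
      using integral_holomorphic_dbar_zero[OF D(1) fh TD] reproduces_zext[OF f] by (simp add: set_integral_zext)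
    have [measurable]: "\<theta> \<in> borel_measurable borel" "g \<in> borel_measurable borel" "\<phi> \<in> borel_measurable borel" "d \<in> borel_measurable borel"
      using c\<theta> cg test_fun_continuous[OF T] by (auto intro: borel_measurable_continuous_onI)
    have L\<theta>: "L2 (\<lambda>\<xi>. of_real (\<theta> \<xi>))" using i\<theta>(1) by (simp add: L2_def)
    have Lg: "L2 g" using ig(1) by (simp add: L2_def)
    have L1: "L2 (\<lambda>\<xi>. d \<xi> * of_real (\<theta> \<xi>))" "nrm2 (\<lambda>\<xi>. d \<xi> * of_real (\<theta> \<xi>)) \<le> B\<^sup>2 * nrm2 (\<lambda>\<xi>. of_real (\<theta> \<xi>))"
      using L2_bound[OF L\<theta>, of "\<lambda>\<xi>. d \<xi> * of_real (\<theta> \<xi>)" B] B(2) by (auto simp: norm_mult mult_right_mono)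
    have L2': "L2 (\<lambda>\<xi>. \<phi> \<xi> * (g \<xi> / 2))" "nrm2 (\<lambda>\<xi>. \<phi> \<xi> * (g \<xi> / 2)) \<le> B\<^sup>2 * nrm2 g"
    proof -
      have "cmod (\<phi> \<xi> * (g \<xi> / 2)) \<le> B * cmod (g \<xi>)" for \<xi>
      proof -
        have "cmod (\<phi> \<xi>) * (cmod (g \<xi>) / 2) \<le> B * cmod (g \<xi>)"
          using B(1)[of \<xi>] B0 by (intro mult_mono) auto
        then show ?thesis by (simp add: norm_mult norm_divide)
      qed
      then show "L2 (\<lambda>\<xi>. \<phi> \<xi> * (g \<xi> / 2))" "nrm2 (\<lambda>\<xi>. \<phi> \<xi> * (g \<xi> / 2)) \<le> B\<^sup>2 * nrm2 g"
        using L2_bound[OF Lg, of "\<lambda>\<xi>. \<phi> \<xi> * (g \<xi> / 2)" B] by auto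
    qed
    have n\<theta>: "nrm2 (\<lambda>\<xi>. of_real (\<theta> \<xi>)) \<le> \<eta>" using i\<theta>(2) by (simp add: nrm2_def)
    have ng: "nrm2 g \<le> \<eta>" using ig(2) by (simp add: nrm2_def)
    have sq: "B\<^sup>2 * x \<le> (B * sqrt \<eta>)\<^sup>2" if "x \<le> \<eta>" for x
      using that \<eta> by (simp add: power_mult_distrib mult_left_mono)
    have i1: "integrable lborel (\<lambda>\<xi>. f \<xi> * (d \<xi> * of_real (\<theta> \<xi>)))" by (rule L2_integrable_mult[OF Lf L1(1)])
    have i2: "integrable lborel (\<lambda>\<xi>. f \<xi> * (\<phi> \<xi> * (g \<xi> / 2)))" by (rule L2_integrable_mult[OF Lf L2'(1)])
    have i3: "integrable lborel (\<lambda>\<xi>. f \<xi> * (\<phi> \<xi> * (- g \<xi> / 2) + d \<xi> * of_real (1 - \<theta> \<xi>)))"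
      by (rule L2_integrable_mult[OF Lf L2_test_fun[OF TD]])
    \<comment> \<open>Split \<open>d\<close> into the \<open>dbar\<close> derivative of
      \<open>(1 - \<theta>) \<phi>\<close>, which \<open>f\<close> annihilates, and the two terms
      \<open>\<theta> d\<close> and \<open>\<phi> g / 2\<close> of that of
      \<open>\<theta> \<phi>\<close>.\<close>
    have "(\<integral>\<xi>. f \<xi> * d \<xi> \<partial>lborel) = (\<integral>\<xi>. f \<xi> * (\<phi> \<xi> * (- g \<xi> / 2) + d \<xi> * of_real (1 - \<theta> \<xi>))
        + (f \<xi> * (d \<xi> * of_real (\<theta> \<xi>)) + f \<xi> * (\<phi> \<xi> * (g \<xi> / 2))) \<partial>lborel)"
      by (intro Bochner_Integration.integral_cong) (auto simp: algebra_simps)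
    also have "\<dots> = (\<integral>\<xi>. f \<xi> * (d \<xi> * of_real (\<theta> \<xi>)) \<partial>lborel) + (\<integral>\<xi>. f \<xi> * (\<phi> \<xi> * (g \<xi> / 2)) \<partial>lborel)"
      unfolding Bochner_Integration.integral_add[OF i3 Bochner_Integration.integrable_add[OF i1 i2]]
        Bochner_Integration.integral_add[OF i1 i2] zero by simp
    also have "cmod \<dots> \<le> N0 * (B * sqrt \<eta>) + N0 * (B * sqrt \<eta>)"
      using B0 \<eta> order_trans[OF L1(2) sq[OF n\<theta>]] order_trans[OF L2'(2) sq[OF ng]]
      by (intro norm_triangle_le add_mono CS L1(1) L2'(1)) auto
    finally show ?thesis by (simp add: mult_ac)
  qed
  ultimately have "cmod (f z - kw z) \<le> N0 * e + N0 * (2 * B * sqrt \<eta>)"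
    using norm_triangle_ineq[of "\<integral>\<xi>. f \<xi> * cnj (peak s z \<xi> - cnj (d \<xi>) - kz \<xi>) \<partial>lborel"
        "\<integral>\<xi>. f \<xi> * d \<xi> \<partial>lborel"] by simp
  then show ?thesis by (simp add: N0_def distrib_left)
qed

text \<open>Equicontinuity of the kernel functions, uniform over all \<open>D\<close> containing the
  three discs: a difference of values is the pairing with a difference of peaks.\<close>

lemma reproduces_difference_le:
  assumes "open D" "0 < s" "cball w (4 * s) \<subseteq> D" "cball z (4 * s) \<subseteq> D" "cball z' (4 * s) \<subseteq> D"
    and f: "reproduces D w f" and e: "nrm2 (\<lambda>\<xi>. peak s z \<xi> - peak s z' \<xi>) \<le> e\<^sup>2" "0 \<le> e"
  shows "cmod (f z - f z') \<le> sqrt (nrm2 (peak s 0)) * e"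
proof -
  have fh: "f holomorphic_on D" and Lf: "L2 f"
    using f reproduces_zext[OF f] by (auto simp: reproduces_def bergman_space_iff[OF assms(1)])
  note Lp = L2_peak[OF assms(2)]
  have "f z = (\<integral>\<xi>. f \<xi> * peak s z \<xi> \<partial>lborel)" "f z' = (\<integral>\<xi>. f \<xi> * peak s z' \<xi> \<partial>lborel)"
    using integral_peak[OF assms(1) fh assms(2)] assms(4,5) reproduces_zext[OF f] by simp_all
  then have "f z - f z' = (\<integral>\<xi>. f \<xi> * peak s z \<xi> - f \<xi> * peak s z' \<xi> \<partial>lborel)"
    using Bochner_Integration.integral_diff[OF L2_integrable_mult[OF Lf Lp] L2_integrable_mult[OF Lf Lp]] by metis
  also have "\<dots> = (\<integral>\<xi>. f \<xi> * (peak s z \<xi> - peak s z' \<xi>) \<partial>lborel)" by (simp add: right_diff_distrib)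
  also have "cmod \<dots> \<le> sqrt (nrm2 f) * sqrt (nrm2 (\<lambda>\<xi>. peak s z \<xi> - peak s z' \<xi>))"
    by (intro L2_Cauchy_Schwarz Lf L2_diff Lp)
  also have "\<dots> \<le> sqrt (nrm2 (peak s 0)) * e"
    by (intro mult_mono[OF reproduces_nrm2_le[OF assms(1,2,3) f] real_le_lsqrt]) (auto simp: nrm2_nonneg e)
  finally show ?thesis .
qed

section \<open>Uniformity over all points at distance \<open>r0\<close> from the boundary\<close>

lemma bdist_imp_ball:
  assumes "r \<le> bdist D z"
  shows "ball z r \<subseteq> D"
proof
  fix x assume x: "x \<in> ball z r"
  show "x \<in> D"
  proof (rule ccontr)
    assume "x \<notin> D"
    then have "bdist D z \<le> dist z x" unfolding bdist_def by (intro infdist_le) simp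
    then show False using assms x by simp
  qed
qed

theorem theorem1p3:
  fixes \<Omega> :: "complex set"
  assumes "open \<Omega>" and "connected \<Omega>" and "\<Omega> \<noteq> {}" and "bounded \<Omega>"
  shows "\<exists>R>0. \<forall>r0. 0 < r0 \<and> r0 < R \<longrightarrow>
           (\<forall>\<epsilon>>0. \<exists>\<gamma>>0. \<forall>E z w. closed E \<and> log_capacity E < ereal \<gamma> \<and>
               z \<in> \<Omega> \<and> w \<in> \<Omega> \<and>
               min (bdist (\<Omega> - E) z) (bdist (\<Omega> - E) w) \<ge> r0 \<longrightarrow>
               cmod (bergman_kernel (\<Omega> - E) z w - bergman_kernel \<Omega> z w) < \<epsilon>)"
proof -
  have main: "\<exists>\<gamma>>0. \<forall>E z w. closed E \<and> log_capacity E < ereal \<gamma> \<and> z \<in> \<Omega> \<and> w \<in> \<Omega> \<and>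
      min (bdist (\<Omega> - E) z) (bdist (\<Omega> - E) w) \<ge> r0 \<longrightarrow>
      cmod (bergman_kernel (\<Omega> - E) z w - bergman_kernel \<Omega> z w) < \<epsilon>"
    if r0: "0 < r0" and \<epsilon>: "0 < \<epsilon>" for r0 \<epsilon>
  proof -
    \<comment> \<open>Then \<open>4 * s = r0 / 2\<close>, and discs of radius \<open>4 * s\<close>
      fit into \<open>D\<close> around \<open>z\<close>, around \<open>w\<close>, and around every
      net point closer than \<open>r0 / 2\<close> to \<open>z\<close>.\<close>
    define s where "s = r0 / 8"
    have s: "0 < s" using r0 by (simp add: s_def)
    define N0 where "N0 = sqrt (nrm2 (peak s 0))"
    have N0: "0 \<le> N0" by (simp add: N0_def nrm2_nonneg)
    \<comment> \<open>Four errors \<open>N0 * e\<close>, each at most \<open>\<epsilon> / 8\<close>,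
      will be collected; the \<open>+ 1\<close> covers \<open>N0 = 0\<close>.\<close>
    define e where "e = \<epsilon> / (8 * (N0 + 1))"
    have e: "0 < e" using \<epsilon> N0 by (simp add: e_def)
    have N0e: "N0 * e \<le> \<epsilon> / 8"
    proof -
      have "N0 * e \<le> (N0 + 1) * e" using e by simp
      also have "\<dots> = \<epsilon> / 8" using N0 by (simp add: e_def field_simps)
      finally show ?thesis .
    qed
    obtain A where A: "\<And>x. x \<in> \<Omega> \<Longrightarrow> cmod x \<le> A" using assms(4) bounded_iff by metis
    obtain \<tau> where \<tau>: "0 < \<tau>" "\<And>z z'. dist z z' < \<tau> \<Longrightarrow> nrm2 (\<lambda>\<xi>. peak s z \<xi> - peak s z' \<xi>) \<le> e\<^sup>2"
      using peak_uniformly_continuous[OF s, of "e\<^sup>2"] e by auto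
    \<comment> \<open>A compact set that depends only on \<Omega> and \<open>r0\<close> and contains
      the admissible points \<open>z\<close> for every \<open>E\<close>. The net and its test
      functions are therefore fixed before \<open>E\<close>.\<close>
    define S where "S = {z. ball z r0 \<subseteq> \<Omega>}"
    have "closed S"
    proof -
      have "S = (\<Inter>x\<in>-\<Omega>. {z. r0 \<le> dist z x})" by (force simp: S_def)
      moreover have "closed {z. r0 \<le> dist z x}" for x :: complex
        by (intro closed_Collect_le continuous_intros)
      ultimately show ?thesis by auto
    qed
    moreover have "S \<subseteq> \<Omega>" using r0 by (auto simp: S_def)
    ultimately have "compact S"
      using assms(4) bounded_subset by (auto simp: compact_eq_bounded_closed)
    moreover have "S \<subseteq> (\<Union>x\<in>S. ball x (min \<tau> (r0 / 2)))" using \<tau>(1) r0 by force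
    ultimately obtain Z where Z: "finite Z" "Z \<subseteq> S" "S \<subseteq> (\<Union>x\<in>Z. ball x (min \<tau> (r0 / 2)))"
      using compactE_image[of S S "\<lambda>x. ball x (min \<tau> (r0 / 2))"] by (metis open_ball)
    define ker where "ker D w z = bergman_kernel D z w" for D w z
    have ker: "reproduces D w (ker D w)" if D: "open D" "w \<in> D" for D w
    proof -
      obtain t where "0 < t" "cball w (4 * t) \<subseteq> D" using ball_in_open_scale[OF D] by blast
      then obtain k where k: "reproduces D w k" using kernel_exists[OF D(1)] by blast
      then have "ker D w = k" using bergman_kernel_eqI[OF D(1) k] by (auto simp: ker_def)
      then show ?thesis using k by simp
    qed
    have "\<exists>\<phi> a d B. test_fun \<Omega> \<phi> a d \<and> nrm2 (\<lambda>\<xi>. peak s x \<xi> - cnj (d \<xi>) - ker \<Omega> x \<xi>) \<le> e\<^sup>2 \<and>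
        (\<forall>\<xi>. cmod (\<phi> \<xi>) \<le> B \<and> cmod (d \<xi>) \<le> B)" if x: "x \<in> Z" for x
    proof -
      have "cball x (4 * s) \<subseteq> ball x r0" using r0 by (auto simp: s_def)
      moreover have "ball x r0 \<subseteq> \<Omega>" using x Z(2) by (auto simp: S_def)
      ultimately have sub: "cball x (4 * s) \<subseteq> \<Omega>" by blast
      obtain k where k: "reproduces \<Omega> x k"
        "\<forall>e>0. \<exists>\<phi> a d. test_fun \<Omega> \<phi> a d \<and> nrm2 (\<lambda>z. peak s x z - cnj (d z) - k z) < e"
        using kernel_exists[OF assms(1) s sub] by blast
      have "ker \<Omega> x = k" using bergman_kernel_eqI[OF assms(1) k(1)] by (auto simp: ker_def)
      then obtain \<phi> a d where T: "test_fun \<Omega> \<phi> a d" "nrm2 (\<lambda>z. peak s x z - cnj (d z) - ker \<Omega> x z) < e\<^sup>2"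
        using k(2) e by (metis zero_less_power)
      obtain K where K: "compact K" "\<And>z. z \<notin> K \<Longrightarrow> \<phi> z = 0" "\<And>z. z \<notin> K \<Longrightarrow> d z = 0"
        using test_funE[OF T(1)] by metis
      obtain B1 where B1: "\<And>z. cmod (\<phi> z) \<le> B1"
        using continuous_compact_support_bounded[OF test_fun_continuous(1)[OF T(1)] K(1,2)] by metis
      obtain B2 where B2: "\<And>z. cmod (d z) \<le> B2"
        using continuous_compact_support_bounded[OF test_fun_continuous(3)[OF T(1)] K(1,3)] by metis
      have "cmod (\<phi> \<xi>) \<le> max B1 B2 \<and> cmod (d \<xi>) \<le> max B1 B2" for \<xi>
        using B1[of \<xi>] B2[of \<xi>] by auto
      then show ?thesis using T less_imp_le by blast
    qed
    then have "\<forall>x\<in>Z. \<exists>p. case p of (\<phi>, a, d, B) \<Rightarrow> test_fun \<Omega> \<phi> a d \<and>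
        nrm2 (\<lambda>\<xi>. peak s x \<xi> - cnj (d \<xi>) - ker \<Omega> x \<xi>) \<le> e\<^sup>2 \<and>
        (\<forall>\<xi>. cmod (\<phi> \<xi>) \<le> B \<and> cmod (d \<xi>) \<le> B)"
      by (simp only: split_paired_Ex prod.case) blast
    then obtain p where p: "\<And>x. x \<in> Z \<Longrightarrow> case p x of (\<phi>, a, d, B) \<Rightarrow> test_fun \<Omega> \<phi> a d \<and>
        nrm2 (\<lambda>\<xi>. peak s x \<xi> - cnj (d \<xi>) - ker \<Omega> x \<xi>) \<le> e\<^sup>2 \<and>
        (\<forall>\<xi>. cmod (\<phi> \<xi>) \<le> B \<and> cmod (d \<xi>) \<le> B)"
      by (meson bchoice)
    define \<phi> a d B0 where "\<phi> x = fst (p x)" and "a x = fst (snd (p x))"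
      and "d x = fst (snd (snd (p x)))" and "B0 x = snd (snd (snd (p x)))" for x
    have T: "test_fun \<Omega> (\<phi> x) (a x) (d x)"
      "nrm2 (\<lambda>\<xi>. peak s x \<xi> - cnj (d x \<xi>) - ker \<Omega> x \<xi>) \<le> e\<^sup>2"
      "cmod (\<phi> x \<xi>) \<le> B0 x" "cmod (d x \<xi>) \<le> B0 x" if "x \<in> Z" for x \<xi>
      using p[OF that] by (auto simp: \<phi>_def a_def d_def B0_def case_prod_beta)
    \<comment> \<open>One bound for all chosen test functions; the \<open>+ 1\<close> keeps it
      positive when the net is empty.\<close>
    define B where "B = (\<Sum>x\<in>Z. \<bar>B0 x\<bar>) + 1"
    have B: "0 < B" "\<And>x. x \<in> Z \<Longrightarrow> B0 x \<le> B"
    proof -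
      show "0 < B" unfolding B_def by (intro add_nonneg_pos sum_nonneg) auto
      fix x assume "x \<in> Z"
      then have "\<bar>B0 x\<bar> \<le> (\<Sum>x\<in>Z. \<bar>B0 x\<bar>)" using Z(1) by (intro member_le_sum) auto
      then show "B0 x \<le> B" by (simp add: B_def)
    qed
    define \<eta> where "\<eta> = (e / (2 * B))\<^sup>2"
    have \<eta>: "0 < \<eta>" "2 * B * sqrt \<eta> = e" using e B by (auto simp: \<eta>_def)
    obtain \<gamma> where \<gamma>: "0 < \<gamma>"
      "\<And>E. closed E \<Longrightarrow> log_capacity E < ereal \<gamma> \<Longrightarrow> \<exists>\<theta> g. C1_cutoff (E \<inter> cball 0 A) \<eta> \<theta> g"
      using small_capacity_cutoff[OF \<eta>(1), of A] by blast
    show ?thesis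
    proof (intro exI[of _ \<gamma>] conjI allI impI \<gamma>(1))
      fix E z w
      assume asm: "closed E \<and> log_capacity E < ereal \<gamma> \<and> z \<in> \<Omega> \<and> w \<in> \<Omega> \<and>
          r0 \<le> min (bdist (\<Omega> - E) z) (bdist (\<Omega> - E) w)"
      define D where "D = \<Omega> - E"
      have D: "open D" "D \<subseteq> \<Omega>" "\<Omega> - D \<subseteq> E \<inter> cball 0 A"
        using asm assms(1) A by (auto simp: D_def)
      have bz: "ball z r0 \<subseteq> D" and bw: "ball w r0 \<subseteq> D"
        using asm bdist_imp_ball unfolding D_def by auto
      obtain \<theta> g where cut: "C1_cutoff (E \<inter> cball 0 A) \<eta> \<theta> g" using \<gamma>(2) asm by blast
      have "z \<in> S" using bz D(2) by (auto simp: S_def)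
      then obtain x where x: "x \<in> Z" "dist x z < \<tau>" "dist x z < r0 / 2" using Z(3) by auto
      have zD: "cball z (4 * s) \<subseteq> D" and wD: "cball w (4 * s) \<subseteq> D" and xD: "cball x (4 * s) \<subseteq> D"
      proof -
        have "cball y (4 * s) \<subseteq> ball y r0" for y :: complex using r0 by (auto simp: s_def)
        then show "cball z (4 * s) \<subseteq> D" "cball w (4 * s) \<subseteq> D" using bz bw by blast+
        have "cball x (4 * s) \<subseteq> ball z r0"
        proof
          fix y assume "y \<in> cball x (4 * s)"
          then show "y \<in> ball z r0"
            using x(3) dist_triangle[of z y x] by (simp add: s_def dist_commute)
        qed
        then show "cball x (4 * s) \<subseteq> D" using bz by blast
      qed
      have "w \<in> cball w (4 * s)" "x \<in> cball x (4 * s)" using s by simp_all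
      then have wm: "w \<in> D" and xm: "x \<in> \<Omega>" using wD xD D(2) by blast+
      note rD = ker[OF D(1) wm] and rx = ker[OF assms(1) xm]
      have rw: "reproduces \<Omega> w (ker \<Omega> w)" using ker[OF assms(1)] wm D(2) by blast
      have near: "nrm2 (\<lambda>\<xi>. peak s z \<xi> - peak s x \<xi>) \<le> e\<^sup>2" using \<tau>(2)[of z x] x(2) by (simp add: dist_commute)
      have 1: "cmod (ker D w z - ker D w x) \<le> N0 * e"
        unfolding N0_def using e by (intro reproduces_difference_le[OF D(1) s wD zD xD rD near]) simp
      have 2: "cmod (ker \<Omega> w z - ker \<Omega> w x) \<le> N0 * e"
        unfolding N0_def using e D(2) wD zD xD
        by (intro reproduces_difference_le[OF assms(1) s _ _ _ rw near]) auto
      have 3: "cmod (ker D w x - ker \<Omega> w x) \<le> N0 * (e + 2 * B * sqrt \<eta>)"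
        unfolding N0_def
      proof (rule kernel_difference_le[OF assms(1) D cut s xD wD rx rw rD T(1)[OF x(1)] T(2)[OF x(1)]])
        show "cmod (\<phi> x \<xi>) \<le> B" "cmod (d x \<xi>) \<le> B" for \<xi>
          using T(3,4)[OF x(1), of \<xi>] B(2)[OF x(1)] by linarith+
      qed (use e in simp)
      \<comment> \<open>Only \<open>z\<close> moves to the net point \<open>x\<close>; the
        dependence on \<open>w\<close> is absorbed by the uniform norm bound. The middle difference
        costs \<open>2 * N0 * e\<close>, the outer two \<open>N0 * e\<close> each.\<close>
      have "ker D w z - ker \<Omega> w z = (ker D w z - ker D w x) + (ker D w x - ker \<Omega> w x) - (ker \<Omega> w z - ker \<Omega> w x)"
        by simp
      also have "cmod \<dots> \<le> cmod (ker D w z - ker D w x) + cmod (ker D w x - ker \<Omega> w x) + cmod (ker \<Omega> w z - ker \<Omega> w x)"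
        using norm_triangle_ineq4[of "(ker D w z - ker D w x) + (ker D w x - ker \<Omega> w x)" "ker \<Omega> w z - ker \<Omega> w x"]
          norm_triangle_ineq[of "ker D w z - ker D w x" "ker D w x - ker \<Omega> w x"] by linarith
      also have "\<dots> \<le> 4 * (N0 * e)" using 1 2 3 unfolding \<eta>(2) by (simp add: distrib_left)
      also have "\<dots> < \<epsilon>" using N0e \<epsilon> by linarith
      finally show "cmod (bergman_kernel (\<Omega> - E) z w - bergman_kernel \<Omega> z w) < \<epsilon>"
        by (simp add: ker_def D_def)
    qed
  qed
  \<comment> \<open>\<open>main\<close> treats every positive \<open>r0\<close>, so the witness 1
    for \<open>R\<close> is arbitrary.\<close>
  show ?thesis by (intro exI[of _ 1] conjI allI impI main) auto
qed

end
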